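(* Let $R$ be an $F$-finite complete local Noetherian domain of characteristic $p>0$, let $B$ be a perfect BCM* $R^+$-algebra, and let $\mathfrak a,J\subseteq R$ be proper nonzero ideals with $\mathfrak a\subseteq\sqrt J$. Then $$c_*^J(\mathfrak a)=\sup\{t\in\mathbb R_{\ge0}\mid(\mathfrak aR^+)_{>t}\not\subseteq JB\}.$$
   Context: $R^+$ denotes an absolute integral closure of the domain $R$. A valuation of $K(R^+)$ "over" $R^+$ is a valuation (arbitrary ordered value group, $v(0)=\infty$) that is nonnegative on $R^+$. For an ideal $I\subseteq R^+$ and rational $q\ge 0$, $I_q$ is the ideal of all $x\in R^+$ such that for each valuation $v$ of $K(R^+)$ over $R^+$ there is $y\in I$ with $v(x)\ge q\,v(y)$. For real $t\ge 0$, $(\mathfrak aR^+)_{>t}:=\bigcup_{q\in\mathbb Q,\,q>t}(\mathfrak aR^+)_q$. A (balanced) big Cohen–Macaulay (BCM) algebra over a local ring $S$ is an $S$-algebra $B$ such that every system of parameters of $S$ is a regular sequence on $B$. A BCM $S$-algebra $B$ is BCM* for $S$ (captures tight closure) if $(IB)\cap S=I^*$ for all ideals $I\subseteq S$, where $I^*$ is tight closure. A BCM* $R^+$-algebra is an $R^+$-algebra, BCM over $R$, that is BCM* for every finite extension $R\subseteq S\subseteq R^+$. Perfect means that Frobenius is bijective on $B$. The tight closure $F$-threshold is $c_*^J(\mathfrak a)=\lim_{e\to\infty}\nu_{\mathfrak a}^{*J}(p^e)/p^e$, where $\nu_{\mathfrak a}^{*J}(p^e)=\max\{n>0\mid\mathfrak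 a^n\not\subseteq(J^{[p^e]})^*\}$ (the limit exists). *)

theory Defs
  imports
    "HOL-Algebra.Algebraic_Closure"
    "HOL-Algebra.Ideal_Product"
    "HOL-Algebra.Generated_Fields"
    "HOL-Computational_Algebra.Primes"
    "HOL-Library.Extended_Real"
begin

hide_const (open) Divisibility.prime

text \<open>
  All rings between $R$ and $R^+$ are subsets of one algebraically closed field \<open>L\<close>; a subring
  \<open>S\<close> is viewed as a ring through \<open>L\<lparr>carrier := S\<rparr>\<close>.
\<close>

section \<open>Local rings and completeness\<close>

definition local_ring :: "('a, 'm) ring_scheme \<Rightarrow> bool"
  where "local_ring S \<longleftrightarrow> cring S \<and> (\<exists>!M. maximalideal M S)"

definition max_ideal :: "('a, 'm) ring_scheme \<Rightarrow> 'a set"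
  where "max_ideal S = (THE M. maximalideal M S)"

text \<open>
  Bijectivity of $S \to \varprojlim_n S/\mathfrak m^n$: a point of the limit is represented by a
  sequence of lifts \<open>x n\<close> of its components, and \<open>\<exists>!\<close> includes separatedness.
\<close>

definition complete_local_ring :: "('a, 'm) ring_scheme \<Rightarrow> bool"
  where "complete_local_ring S \<longleftrightarrow> local_ring S \<and>
    (\<forall>x :: nat \<Rightarrow> 'a.
      (\<forall>n. x n \<in> carrier S) \<and>
      (\<forall>n. x (Suc n) \<ominus>\<^bsub>S\<^esub> x n \<in> max_ideal S [^]\<^bsub>ideals_set S\<^esub> n) \<longrightarrow>
      (\<exists>!y. y \<in> carrier S \<and> (\<forall>n. y \<ominus>\<^bsub>S\<^esub> x n \<in> max_ideal S [^]\<^bsub>ideals_set S\<^esub> n)))"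

section \<open>Finite extensions and integral closure\<close>

definition module_finite :: "('a, 'm) ring_scheme \<Rightarrow> 'a set \<Rightarrow> 'a set \<Rightarrow> bool"
  where "module_finite L R S \<longleftrightarrow>
    (\<exists>A. finite A \<and> A \<subseteq> S \<and>
      (\<forall>x\<in>S. \<exists>c \<in> A \<rightarrow> R. x = (\<Oplus>\<^bsub>L\<^esub>a\<in>A. c a \<otimes>\<^bsub>L\<^esub> a)))"

text \<open>Finiteness of the Frobenius endomorphism, i.e. of \<open>R\<close> over its subring of \<open>p\<close>-th powers.\<close>

definition F_finite :: "('a, 'm) ring_scheme \<Rightarrow> 'a set \<Rightarrow> nat \<Rightarrow> bool"
  where "F_finite L R p \<longleftrightarrow> module_finite L ((\<lambda>x. x [^]\<^bsub>L\<^esub> p) ` R) R"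

definition integral_closure :: "('a, 'm) ring_scheme \<Rightarrow> 'a set \<Rightarrow> 'a set"
  where "integral_closure L R =
    {x \<in> carrier L. \<exists>f. polynomial\<^bsub>L\<^esub> R f \<and> f \<noteq> [] \<and> lead_coeff f = \<one>\<^bsub>L\<^esub> \<and>
      ring.eval L f x = \<zero>\<^bsub>L\<^esub>}"

section \<open>Systems of parameters and big Cohen--Macaulay algebras\<close>

definition radical_ideal :: "('a, 'm) ring_scheme \<Rightarrow> 'a set \<Rightarrow> 'a set"
  where "radical_ideal S I = {x \<in> carrier S. \<exists>n::nat. 0 < n \<and> x [^]\<^bsub>S\<^esub> n \<in> I}"

definition krull_dim :: "('a, 'm) ring_scheme \<Rightarrow> enat"
  where "krull_dim S =
    Sup {enat n | n. \<exists>P :: nat \<Rightarrow> 'a set.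
      (\<forall>i\<le>n. primeideal (P i) S) \<and> (\<forall>i<n. P i \<subset> P (Suc i))}"

definition system_of_parameters :: "('a, 'm) ring_scheme \<Rightarrow> 'a list \<Rightarrow> bool"
  where "system_of_parameters S xs \<longleftrightarrow>
    set xs \<subseteq> max_ideal S \<and> enat (length xs) = krull_dim S \<and>
    radical_ideal S (Idl\<^bsub>S\<^esub> (set xs)) = max_ideal S"

text \<open>
  The second clause says that \<open>ys ! i\<close> is a nonzerodivisor on the quotient of \<open>B\<close> by the
  preceding elements.
\<close>

definition regular_sequence :: "('b, 'n) ring_scheme \<Rightarrow> 'b list \<Rightarrow> bool"
  where "regular_sequence B ys \<longleftrightarrow>
    set ys \<subseteq> carrier B \<and>
    (\<forall>i<length ys. \<forall>b\<in>carrier B.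
      ys ! i \<otimes>\<^bsub>B\<^esub> b \<in> Idl\<^bsub>B\<^esub> (set (take i ys)) \<longrightarrow> b \<in> Idl\<^bsub>B\<^esub> (set (take i ys))) \<and>
    Idl\<^bsub>B\<^esub> (set ys) \<noteq> carrier B"

definition bcm_algebra ::
    "('a, 'm) ring_scheme \<Rightarrow> ('b, 'n) ring_scheme \<Rightarrow> ('a \<Rightarrow> 'b) \<Rightarrow> bool"
  where "bcm_algebra S B \<phi> \<longleftrightarrow> cring B \<and> \<phi> \<in> ring_hom S B \<and>
    (\<forall>xs. system_of_parameters S xs \<longrightarrow> regular_sequence B (map \<phi> xs))"

section \<open>Tight closure\<close>

definition frobenius_power :: "('a, 'm) ring_scheme \<Rightarrow> 'a set \<Rightarrow> nat \<Rightarrow> 'a set"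
  where "frobenius_power S I q = Idl\<^bsub>S\<^esub> ((\<lambda>x. x [^]\<^bsub>S\<^esub> q) ` I)"

definition minimal_prime :: "('a, 'm) ring_scheme \<Rightarrow> 'a set \<Rightarrow> bool"
  where "minimal_prime S P \<longleftrightarrow>
    primeideal P S \<and> (\<forall>Q. primeideal Q S \<and> Q \<subseteq> P \<longrightarrow> Q = P)"

definition tight_closure :: "('a, 'm) ring_scheme \<Rightarrow> nat \<Rightarrow> 'a set \<Rightarrow> 'a set"
  where "tight_closure S p I =
    {x \<in> carrier S. \<exists>c \<in> carrier S. (\<forall>P. minimal_prime S P \<longrightarrow> c \<notin> P) \<and>
      (\<exists>N. \<forall>e\<ge>N. c \<otimes>\<^bsub>S\<^esub> x [^]\<^bsub>S\<^esub> (p ^ e) \<in> frobenius_power S I (p ^ e))}"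

definition bcm_star ::
    "('a, 'm) ring_scheme \<Rightarrow> nat \<Rightarrow> ('b, 'n) ring_scheme \<Rightarrow> ('a \<Rightarrow> 'b) \<Rightarrow> bool"
  where "bcm_star S p B \<phi> \<longleftrightarrow> bcm_algebra S B \<phi> \<and>
    (\<forall>I. ideal I S \<longrightarrow> {x \<in> carrier S. \<phi> x \<in> Idl\<^bsub>B\<^esub> (\<phi> ` I)} = tight_closure S p I)"

definition bcm_star_plus_algebra ::
    "('a, 'm) ring_scheme \<Rightarrow> 'a set \<Rightarrow> nat \<Rightarrow> ('b, 'n) ring_scheme \<Rightarrow> ('a \<Rightarrow> 'b) \<Rightarrow> bool"
  where "bcm_star_plus_algebra L R p B \<phi> \<longleftrightarrow>
    cring B \<and> \<phi> \<in> ring_hom (L\<lparr>carrier := integral_closure L R\<rparr>) B \<and>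
    bcm_algebra (L\<lparr>carrier := R\<rparr>) B \<phi> \<and>
    (\<forall>S. subring S L \<and> R \<subseteq> S \<and> S \<subseteq> integral_closure L R \<and> module_finite L R S \<longrightarrow>
      bcm_star (L\<lparr>carrier := S\<rparr>) p B \<phi>)"

definition perfect_ring :: "nat \<Rightarrow> ('b, 'n) ring_scheme \<Rightarrow> bool"
  where "perfect_ring p B \<longleftrightarrow> bij_betw (\<lambda>b. b [^]\<^bsub>B\<^esub> p) (carrier B) (carrier B)"

text \<open>
  The supremum in \<open>nat\<close> is the maximum of a finite nonempty set, and \<open>0\<close> for the empty set
  (which occurs only for finitely many \<open>e\<close> when the ideals are proper and nonzero).
\<close>

definition tight_closure_nu ::
    "('a, 'm) ring_scheme \<Rightarrow> nat \<Rightarrow> 'a set \<Rightarrow> 'a set \<Rightarrow> nat \<Rightarrow> nat"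
  where "tight_closure_nu S p \<aa> J e =
    Sup {n. 0 < n \<and>
      \<not> \<aa> [^]\<^bsub>ideals_set S\<^esub> n \<subseteq> tight_closure S p (frobenius_power S J (p ^ e))}"

definition tight_closure_F_threshold ::
    "('a, 'm) ring_scheme \<Rightarrow> nat \<Rightarrow> 'a set \<Rightarrow> 'a set \<Rightarrow> real"
  where "tight_closure_F_threshold S p \<aa> J =
    lim (\<lambda>e. real (tight_closure_nu S p \<aa> J e) / real (p ^ e))"

section \<open>Valuations and rational powers\<close>

text \<open>
  Value groups are written multiplicatively; \<open>None\<close> is the value \<open>\<infinity>\<close>.
\<close>

locale ordered_abelian_group = comm_group \<Gamma> for \<Gamma> :: "('g, 'k) monoid_scheme" (structure) +
  fixes r :: "('g \<times> 'g) set"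
  assumes linear_order: "linear_order_on (carrier \<Gamma>) r"
    and translate: "\<lbrakk>(a, b) \<in> r; c \<in> carrier \<Gamma>\<rbrakk> \<Longrightarrow> (a \<otimes> c, b \<otimes> c) \<in> r"

definition val_le :: "('g \<times> 'g) set \<Rightarrow> 'g option \<Rightarrow> 'g option \<Rightarrow> bool"
  where "val_le r a b \<longleftrightarrow>
    b = None \<or> (\<exists>g h. a = Some g \<and> b = Some h \<and> (g, h) \<in> r)"

definition val_mult :: "('g, 'k) monoid_scheme \<Rightarrow> 'g option \<Rightarrow> 'g option \<Rightarrow> 'g option"
  where "val_mult \<Gamma> a b =
    (case (a, b) of (Some g, Some h) \<Rightarrow> Some (g \<otimes>\<^bsub>\<Gamma>\<^esub> h) | _ \<Rightarrow> None)"

definition val_pow :: "('g, 'k) monoid_scheme \<Rightarrow> nat \<Rightarrow> 'g option \<Rightarrow> 'g option"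
  where "val_pow \<Gamma> n a = map_option (\<lambda>g. g [^]\<^bsub>\<Gamma>\<^esub> n) a"

locale valuation = K: field K + G: ordered_abelian_group \<Gamma> r
  for K :: "('a, 'm) ring_scheme" and \<Gamma> :: "('g, 'k) monoid_scheme" and r +
  fixes v :: "'a \<Rightarrow> 'g option"
  assumes val_zero: "v \<zero>\<^bsub>K\<^esub> = None"
    and val_nonzero: "\<lbrakk>x \<in> carrier K; x \<noteq> \<zero>\<^bsub>K\<^esub>\<rbrakk> \<Longrightarrow> v x \<in> Some ` carrier \<Gamma>"
    and val_times: "\<lbrakk>x \<in> carrier K; y \<in> carrier K\<rbrakk> \<Longrightarrow> v (x \<otimes>\<^bsub>K\<^esub> y) = val_mult \<Gamma> (v x) (v y)"
    and val_plus: "\<lbrakk>x \<in> carrier K; y \<in> carrier K\<rbrakk> \<Longrightarrow>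
      val_le r (v x) (v (x \<oplus>\<^bsub>K\<^esub> y)) \<or> val_le r (v y) (v (x \<oplus>\<^bsub>K\<^esub> y))"

text \<open>Valuations of the fraction field of a subring \<open>A\<close> of \<open>L\<close> that are nonnegative on \<open>A\<close>.\<close>

definition valuation_over ::
    "('a, 'm) ring_scheme \<Rightarrow> 'a set \<Rightarrow> ('g, 'k) monoid_scheme \<Rightarrow> ('g \<times> 'g) set \<Rightarrow>
      ('a \<Rightarrow> 'g option) \<Rightarrow> bool"
  where "valuation_over L A \<Gamma> r v \<longleftrightarrow>
    valuation (L\<lparr>carrier := generate_field L A\<rparr>) \<Gamma> r v \<and>
    (\<forall>z\<in>A. val_le r (Some \<one>\<^bsub>\<Gamma>\<^esub>) (v z))"

text \<open>
  \<open>val_ge_rat \<Gamma> r q a b\<close> is $a \ge q\,b$, i.e. $n a \ge m b$ where $q = m/n$ in lowest terms with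
  $n > 0$; it is meant for \<open>q \<ge> 0\<close>.
\<close>

definition val_ge_rat ::
    "('g, 'k) monoid_scheme \<Rightarrow> ('g \<times> 'g) set \<Rightarrow> rat \<Rightarrow> 'g option \<Rightarrow> 'g option \<Rightarrow> bool"
  where "val_ge_rat \<Gamma> r q a b \<longleftrightarrow>
    (case quotient_of q of (m, n) \<Rightarrow>
      val_le r (val_pow \<Gamma> (nat m) b) (val_pow \<Gamma> (nat n) a))"

text \<open>
  The quantifier over value groups ranges over ordered groups whose elements have type
  \<open>'a set\<close>. This is no restriction: the value group of a valuation on \<open>K\<close> is a quotient of the
  multiplicative group of \<open>K\<close>, hence can be realised on sets of elements of \<open>K\<close>, as is shown in
  \<open>rational_power_any_value_group\<close> below.
\<close>

definition rational_power :: "('a, 'm) ring_scheme \<Rightarrow> 'a set \<Rightarrow> 'a set \<Rightarrow> rat \<Rightarrow> 'a set"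
  where "rational_power L A I q =
    {x \<in> A. \<forall>(\<Gamma> :: 'a set monoid) r v. valuation_over L A \<Gamma> r v \<longrightarrow>
      (\<exists>y\<in>I. val_ge_rat \<Gamma> r q (v x) (v y))}"

definition rational_power_gt :: "('a, 'm) ring_scheme \<Rightarrow> 'a set \<Rightarrow> 'a set \<Rightarrow> real \<Rightarrow> 'a set"
  where "rational_power_gt L A I t = (\<Union>q \<in> {q. t < real_of_rat q}. rational_power L A I q)"

lemma rational_power_any_value_group:
  fixes L :: "('a, 'm) ring_scheme" and \<Gamma> :: "('g, 'k) monoid_scheme"
  assumes x: "x \<in> rational_power L A I q"
    and v: "valuation_over L A \<Gamma> r v"
    and I: "I \<subseteq> A"
  shows "\<exists>y\<in>I. val_ge_rat \<Gamma> r q (v x) (v y)"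
proof -
  define F where "F = generate_field L A"
  define K where "K = L\<lparr>carrier := F\<rparr>"
  interpret V: valuation K \<Gamma> r v
    using v unfolding valuation_over_def K_def F_def by blast
  have cK: "carrier K = F" by (simp add: K_def)
  have AF: "A \<subseteq> F" unfolding F_def by (auto intro: generate_field.incl)
  have xA: "x \<in> A" using x unfolding rational_power_def by blast
  define h where "h g = {z \<in> F. v z = Some g}" for g
  define G where "G = {g. \<exists>z\<in>F. v z = Some g}"
  have GI: "g \<in> G" if "z \<in> F" "v z = Some g" for z g
    using that unfolding G_def by blast
  have nz: "z \<noteq> \<zero>\<^bsub>K\<^esub>" if "v z = Some g" for z g
    using that V.val_zero by auto
  have Gc: "G \<subseteq> carrier \<Gamma>"
    using V.val_nonzero nz unfolding G_def cK by fastforce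
  have inj: "inj_on h G"
  proof (rule inj_onI)
    fix g g' assume g: "g \<in> G" and eq: "h g = h g'"
    from g obtain z where "z \<in> F" "v z = Some g" unfolding G_def by blast
    then have "z \<in> h g'" using eq[symmetric] by (simp add: h_def)
    then show "g = g'" using \<open>v z = Some g\<close> by (simp add: h_def)
  qed
  define k where "k = inv_into G h"
  have kh [simp]: "k (h g) = g" if "g \<in> G" for g
    unfolding k_def using inv_into_f_f[OF inj that] .
  have Gmult: "g \<otimes>\<^bsub>\<Gamma>\<^esub> g' \<in> G" if g: "g \<in> G" "g' \<in> G" for g g'
  proof -
    obtain z z' where z: "z \<in> F" "z' \<in> F" "v z = Some g" "v z' = Some g'"
      using g unfolding G_def by blast
    then have "v (z \<otimes>\<^bsub>K\<^esub> z') = Some (g \<otimes>\<^bsub>\<Gamma>\<^esub> g')"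
      using V.val_times[of z z'] cK by (simp add: val_mult_def)
    moreover have "z \<otimes>\<^bsub>K\<^esub> z' \<in> F" using z cK V.K.m_closed by blast
    ultimately show ?thesis using GI by blast
  qed
  obtain u where u: "v \<one>\<^bsub>K\<^esub> = Some u" "u \<in> carrier \<Gamma>"
    using V.val_nonzero[of "\<one>\<^bsub>K\<^esub>"] by auto
  have "u \<otimes>\<^bsub>\<Gamma>\<^esub> u = u"
    using V.val_times[of "\<one>\<^bsub>K\<^esub>" "\<one>\<^bsub>K\<^esub>"] u by (simp add: val_mult_def)
  then have u1: "u = \<one>\<^bsub>\<Gamma>\<^esub>"
    using u(2) V.G.l_cancel_one by blast
  have Gone: "\<one>\<^bsub>\<Gamma>\<^esub> \<in> G"
    using GI[of "\<one>\<^bsub>K\<^esub>"] u u1 V.K.one_closed cK by simp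
  have Ginv: "\<exists>g'\<in>G. g' \<otimes>\<^bsub>\<Gamma>\<^esub> g = \<one>\<^bsub>\<Gamma>\<^esub>" if g: "g \<in> G" for g
  proof -
    obtain z where z: "z \<in> F" "v z = Some g" using g unfolding G_def by blast
    then have "z \<in> Units K" using nz V.K.field_Units cK by blast
    then obtain w where w: "w \<in> carrier K" "w \<otimes>\<^bsub>K\<^esub> z = \<one>\<^bsub>K\<^esub>"
      using V.K.Units_l_inv_ex by blast
    have "val_mult \<Gamma> (v w) (v z) = Some \<one>\<^bsub>\<Gamma>\<^esub>"
      using V.val_times[of w z] w z u u1 cK by simp
    then obtain g' where "v w = Some g'" "g' \<otimes>\<^bsub>\<Gamma>\<^esub> g = \<one>\<^bsub>\<Gamma>\<^esub>"
      using z by (auto simp: val_mult_def split: option.splits)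
    then show ?thesis using GI w cK by blast
  qed
  define \<Delta> where
    "\<Delta> = \<lparr>carrier = h ` G, monoid.mult = (\<lambda>a b. h (k a \<otimes>\<^bsub>\<Gamma>\<^esub> k b)), one = h \<one>\<^bsub>\<Gamma>\<^esub>\<rparr>"
  define s where "s = {(h a, h b) | a b. a \<in> G \<and> b \<in> G \<and> (a, b) \<in> r}"
  define w where "w z = map_option h (v z)" for z
  have D [simp]: "carrier \<Delta> = h ` G" "\<one>\<^bsub>\<Delta>\<^esub> = h \<one>\<^bsub>\<Gamma>\<^esub>"
    "a \<otimes>\<^bsub>\<Delta>\<^esub> b = h (k a \<otimes>\<^bsub>\<Gamma>\<^esub> k b)" for a b
    by (simp_all add: \<Delta>_def)
  have hs: "(h a, h b) \<in> s \<longleftrightarrow> (a, b) \<in> r" if "a \<in> G" "b \<in> G" for a b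
    using that inj unfolding s_def inj_on_def by blast
  have com: "comm_group \<Delta>"
  proof (rule comm_groupI)
    fix a b c assume "a \<in> carrier \<Delta>" "b \<in> carrier \<Delta>" "c \<in> carrier \<Delta>"
    then obtain a' b' c' where *: "a = h a'" "b = h b'" "c = h c'" "a' \<in> G" "b' \<in> G" "c' \<in> G"
      by auto
    then show "a \<otimes>\<^bsub>\<Delta>\<^esub> b \<otimes>\<^bsub>\<Delta>\<^esub> c = a \<otimes>\<^bsub>\<Delta>\<^esub> (b \<otimes>\<^bsub>\<Delta>\<^esub> c)"
      using Gc by (simp add: Gmult V.G.m_assoc subset_iff)
  next
    fix a b assume "a \<in> carrier \<Delta>" "b \<in> carrier \<Delta>"
    then obtain a' b' where *: "a = h a'" "b = h b'" "a' \<in> G" "b' \<in> G"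
      by auto
    then show "a \<otimes>\<^bsub>\<Delta>\<^esub> b \<in> carrier \<Delta>" by (simp add: Gmult)
    show "a \<otimes>\<^bsub>\<Delta>\<^esub> b = b \<otimes>\<^bsub>\<Delta>\<^esub> a"
      using * Gc by (simp add: V.G.m_comm subset_iff)
  next
    show "\<one>\<^bsub>\<Delta>\<^esub> \<in> carrier \<Delta>" using Gone by simp
  next
    fix a assume "a \<in> carrier \<Delta>"
    then obtain a' where *: "a = h a'" "a' \<in> G" by auto
    then show "\<one>\<^bsub>\<Delta>\<^esub> \<otimes>\<^bsub>\<Delta>\<^esub> a = a" using Gone Gc by (simp add: subset_iff)
    obtain b' where "b' \<in> G" "b' \<otimes>\<^bsub>\<Gamma>\<^esub> a' = \<one>\<^bsub>\<Gamma>\<^esub>" using Ginv * by blast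
    then show "\<exists>b\<in>carrier \<Delta>. b \<otimes>\<^bsub>\<Delta>\<^esub> a = \<one>\<^bsub>\<Delta>\<^esub>"
      using * by (intro bexI[of _ "h b'"]) auto
  qed
  have lin: "linear_order_on (carrier \<Delta>) s"
  proof -
    have L: "refl_on (carrier \<Gamma>) r" "trans r" "antisym r" "total_on (carrier \<Gamma>) r"
      using V.G.linear_order unfolding order_on_defs by auto
    have sD: "\<exists>a b. x = h a \<and> y = h b \<and> a \<in> G \<and> b \<in> G \<and> (a, b) \<in> r" if "(x, y) \<in> s" for x y
      using that unfolding s_def by blast
    have "refl_on (h ` G) s"
    proof (rule refl_onI)
      fix x assume "x \<in> h ` G"
      then obtain a where a: "x = h a" "a \<in> G" by blast
      then have "(a, a) \<in> r" using L(1) Gc by (auto dest: refl_onD)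
      then show "(x, x) \<in> s" using a hs by simp
    qed
    moreover have "s \<subseteq> h ` G \<times> h ` G" unfolding s_def by blast
    moreover have "trans s"
    proof (rule transI)
      fix x y z assume "(x, y) \<in> s" "(y, z) \<in> s"
      then obtain a b b' c where *: "x = h a" "y = h b" "y = h b'" "z = h c"
        "a \<in> G" "b \<in> G" "b' \<in> G" "c \<in> G" "(a, b) \<in> r" "(b', c) \<in> r"
        by (blast dest: sD)
      then have "b = b'" by (metis kh)
      then have "(a, c) \<in> r" using * transD[OF L(2)] by blast
      then show "(x, z) \<in> s" using * hs by simp
    qed
    moreover have "antisym s"
    proof (rule antisymI)
      fix x y assume xy: "(x, y) \<in> s" "(y, x) \<in> s"
      then obtain a b where *: "x = h a" "y = h b" "a \<in> G" "b \<in> G" "(a, b) \<in> r"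
        by (blast dest: sD)
      then have "(b, a) \<in> r" using xy(2) hs by simp
      then show "x = y" using * antisymD[OF L(3)] by blast
    qed
    moreover have "total_on (h ` G) s"
    proof (rule total_onI)
      fix x y assume "x \<in> h ` G" "y \<in> h ` G" "x \<noteq> y"
      then obtain a b where *: "x = h a" "y = h b" "a \<in> G" "b \<in> G" "a \<noteq> b" by blast
      then have "(a, b) \<in> r \<or> (b, a) \<in> r" using L(4) Gc unfolding total_on_def by blast
      then show "(x, y) \<in> s \<or> (y, x) \<in> s" using * hs by simp
    qed
    ultimately show ?thesis unfolding order_on_defs by simp
  qed
  have trans: "(a \<otimes>\<^bsub>\<Delta>\<^esub> c, b \<otimes>\<^bsub>\<Delta>\<^esub> c) \<in> s" if ab: "(a, b) \<in> s" "c \<in> carrier \<Delta>" for a b c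
  proof -
    from ab obtain a' b' c' where *: "a = h a'" "b = h b'" "c = h c'"
        "a' \<in> G" "b' \<in> G" "c' \<in> G" "(a', b') \<in> r"
      unfolding s_def by auto
    then show ?thesis using V.G.translate[of a' b' c'] Gc Gmult hs by auto
  qed
  have og: "ordered_abelian_group \<Delta> s"
    using com lin trans by (simp add: ordered_abelian_group_def ordered_abelian_group_axioms_def)
  have wle: "val_le s (map_option h a) (map_option h b) \<longleftrightarrow> val_le r a b"
    if "set_option a \<subseteq> G" "set_option b \<subseteq> G" for a b
    using that hs by (cases a; cases b) (auto simp: val_le_def)
  have setv: "set_option (v z) \<subseteq> G" if "z \<in> F" for z
    using GI that by (auto simp: elem_set)
  have "valuation K \<Delta> s w"
  proof (intro valuation.intro valuation_axioms.intro)
    show "field K" by (rule V.K.field_axioms)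
    show "ordered_abelian_group \<Delta> s" by (rule og)
    show "w \<zero>\<^bsub>K\<^esub> = None" by (simp add: w_def V.val_zero)
    fix y assume y: "y \<in> carrier K"
    show "w y \<in> Some ` carrier \<Delta>" if "y \<noteq> \<zero>\<^bsub>K\<^esub>"
      using V.val_nonzero[OF y that] setv[of y] y cK by (auto simp: w_def)
    fix z assume z: "z \<in> carrier K"
    show "w (y \<otimes>\<^bsub>K\<^esub> z) = val_mult \<Delta> (w y) (w z)"
      using V.val_times[OF y z] setv[of y] setv[of z] y z cK
      by (auto simp: w_def val_mult_def split: option.splits)
    have "y \<oplus>\<^bsub>K\<^esub> z \<in> F" using y z cK V.K.a_closed by blast
    then show "val_le s (w y) (w (y \<oplus>\<^bsub>K\<^esub> z)) \<or> val_le s (w z) (w (y \<oplus>\<^bsub>K\<^esub> z))"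
      using V.val_plus[OF y z] setv y z cK unfolding w_def by (simp add: wle)
  qed
  moreover have "val_le s (Some \<one>\<^bsub>\<Delta>\<^esub>) (w z)" if "z \<in> A" for z
    using v that wle[of "Some \<one>\<^bsub>\<Gamma>\<^esub>" "v z"] setv[of z] AF Gone
    unfolding valuation_over_def w_def by auto
  ultimately have "valuation_over L A \<Delta> s w"
    unfolding valuation_over_def K_def F_def by blast
  then obtain y where y: "y \<in> I" "val_ge_rat \<Delta> s q (w x) (w y)"
    using x unfolding rational_power_def by blast
  have pow: "h g [^]\<^bsub>\<Delta>\<^esub> n = h (g [^]\<^bsub>\<Gamma>\<^esub> n) \<and> g [^]\<^bsub>\<Gamma>\<^esub> n \<in> G" if "g \<in> G" for g and n :: nat
  proof (induction n)
    case 0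
    show ?case using Gone by simp
  next
    case (Suc n)
    then show ?case using that Gmult by simp
  qed
  have wpow: "val_pow \<Delta> n (w z) = map_option h (val_pow \<Gamma> n (v z)) \<and>
      set_option (val_pow \<Gamma> n (v z)) \<subseteq> G" if "z \<in> F" for n z
    using setv[OF that] pow by (cases "v z") (auto simp: w_def val_pow_def)
  have "x \<in> F" "y \<in> F" using xA y(1) I AF by auto
  then have "val_ge_rat \<Gamma> r q (v x) (v y)"
    using y(2) wpow unfolding val_ge_rat_def by (auto simp: wle split: prod.splits)
  then show ?thesis using y(1) by blast
qed

end

theory Submission
  imports Defs "HOL-Algebra.Ring_Divisibility"
begin

text \<open>
  Both sides of the equality are governed by membership in $JB$. The algebra $B$ computes tight
  closures of ideals of $R$ by contraction, and Frobenius is bijective on $B$. Hence an element $y$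
  of $R$ with a $p^e$-th root $z$ in $R^+$ lies in $(J^{[p^e]})^*$ if and only if the image of $z$
  lies in $JB$ (\<open>closure_pow_root_iff\<close>). Taking $p$-th powers of such elements shows that
  $\nu(p^e)/p^e$ is increasing (\<open>nu_Suc\<close>). By the pigeonhole principle it is bounded, because
  $\mathfrak a \subseteq \sqrt J$ (\<open>witnesses_bounded\<close>). So the threshold is its supremum.

  For one inequality, choose $y \in \mathfrak a^{\nu(p^e)}$ outside $(J^{[p^e]})^*$. For every
  valuation, the value of its root $z$ is at least $\nu(p^e)/p^e$ times the value of some element
  of $\mathfrak a$. So $z$ lies in the rational power with this exponent, and not in $JB$
  (\<open>below_ratio_not_in_JB\<close>).

  For the other inequality, let $x$ be in the rational power with exponent $s = m/n > t$ and not in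
  $JB$. By the valuative criterion, $x^n$ is integral over $(\mathfrak a R^+)^m$. An integral
  equation of degree $D + 1$ yields $x^{n(k+D)} \in (\mathfrak a R^+)^{mk}$ for all $k$
  (\<open>rational_power_integral\<close>). If $k$ is largest with $n(k+D) \le p^e$, then
  $x^{p^e} \in \mathfrak a^{mk} R^+$ but $x^{p^e} \notin J^{[p^e]} B$, so $\nu(p^e) \ge mk$. The
  error term $D$ disappears after division by $p^e$ (\<open>not_in_JB_le_lim\<close>). The valuations that the
  criterion requires come from Zorn's lemma (\<open>valuative_criterion\<close>); they also show
  that $R^+$ is a ring.

  A supremum over the empty set would be $-\infty$, so it remains to see that $\nu(p^e) > 0$ for
  some $e$. This holds because the ideals $(J^{[p^e]})^*$ intersect in zero. There is a nonzero $t$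
  that multiplies the tight closure of every ideal into the ideal (\<open>test_element_exists\<close>), and no
  nonzero element lies in all $J^{[p^e]}$ (\<open>frobenius_colon\<close>). The test element is obtained from
  additive maps $\theta : R \to R$ with $\theta(r^{p^k} x) = r\,\theta(x)$. As $R$ is finite over
  its $p$-th powers, there are enough of them to move any nonzero $c$ to a power of one fixed $d$.
  Such a map turns $c\,x^{p^{k+l}} \in I^{[p^{k+l}]}$ into $d^j x^{p^l} \in I^{[p^l]}$, and for
  $p^l \ge j$ this implies $(dx)^{p^l} \in I^{[p^l]}$, where $c$ and $j$ no longer occur.
\<close>

section \<open>Frobenius and powers of ideals\<close>

lemma (in cring) binomial_expansion:
  assumes x: "x \<in> carrier R" and y: "y \<in> carrier R"
  shows "(x \<oplus> y) [^] (n::nat) = (\<Oplus>i\<in>{..n}. [(n choose i)] \<cdot> (x [^] i \<otimes> y [^] (n - i)))"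
proof (induction n)
  case 0
  show ?case using x y by simp
next
  case (Suc n)
  define t where "t m i = [(m choose i)] \<cdot> (x [^] i \<otimes> y [^] (m - i))" for m i :: nat
  have tc: "t m i \<in> carrier R" for m i using x y by (simp add: t_def)
  have mult_x: "t n i \<otimes> x = [(n choose i)] \<cdot> (x [^] Suc i \<otimes> y [^] (n - i))" for i
    using x y by (simp add: t_def add_pow_rdistr m_comm[of _ x] m_lcomm[of x] m_assoc)
  have mult_y: "t n i \<otimes> y = [(n choose i)] \<cdot> (x [^] i \<otimes> y [^] (Suc n - i))" if "i \<le> n" for i
    using x y that by (simp add: t_def add_pow_rdistr Suc_diff_le m_comm[of _ y] m_lcomm[of y] m_assoc)
  define a b where "a i = [(n choose i)] \<cdot> (x [^] Suc i \<otimes> y [^] (n - i))"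
    and "b i = [(n choose i)] \<cdot> (x [^] i \<otimes> y [^] (Suc n - i))" for i
  have ac: "a i \<in> carrier R" and bc: "b i \<in> carrier R" for i using x y by (simp_all add: a_def b_def)
  have IH: "(x \<oplus> y) [^] n = (\<Oplus>i\<in>{..n}. t n i)" using Suc unfolding t_def .
  have "(x \<oplus> y) [^] Suc n = (\<Oplus>i\<in>{..n}. t n i) \<otimes> x \<oplus> (\<Oplus>i\<in>{..n}. t n i) \<otimes> y"
    unfolding nat_pow_Suc IH using x y tc by (intro r_distr finsum_closed) auto
  also have "(\<Oplus>i\<in>{..n}. t n i) \<otimes> x = (\<Oplus>i\<in>{..n}. a i)"
    using finsum_ldistr[of "{..n}" x "t n"] x tc by (simp add: mult_x a_def del: nat_pow_Suc)
  also have "(\<Oplus>i\<in>{..n}. t n i) \<otimes> y = (\<Oplus>i\<in>{..n}. t n i \<otimes> y)"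
    using finsum_ldistr[of "{..n}" y "t n"] y tc by simp
  also have "\<dots> = (\<Oplus>i\<in>{..n}. b i)"
    using bc by (intro add.finprod_cong') (auto simp: mult_y b_def)
  also have "\<dots> = (\<Oplus>i\<in>{..Suc n}. b i)"
    using x y bc by (simp add: finsum_Suc b_def binomial_eq_0)
  also have "\<dots> = (\<Oplus>i\<in>{..n}. b (Suc i)) \<oplus> b 0"
    using bc by (intro finsum_Suc2) auto
  also have "(\<Oplus>i\<in>{..n}. a i) \<oplus> ((\<Oplus>i\<in>{..n}. b (Suc i)) \<oplus> b 0) =
      ((\<Oplus>i\<in>{..n}. a i) \<oplus> (\<Oplus>i\<in>{..n}. b (Suc i))) \<oplus> b 0"
    using ac bc by (intro a_assoc[symmetric] finsum_closed) auto
  also have "(\<Oplus>i\<in>{..n}. a i) \<oplus> (\<Oplus>i\<in>{..n}. b (Suc i)) = (\<Oplus>i\<in>{..n}. a i \<oplus> b (Suc i))"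
    using ac bc by (intro finsum_addf[symmetric]) auto
  also have "\<dots> = (\<Oplus>i\<in>{..n}. t (Suc n) (Suc i))"
    using x y tc by (intro add.finprod_cong') (auto simp: a_def b_def t_def add.nat_pow_mult add.m_comm)
  also have "b 0 = t (Suc n) 0" by (simp add: b_def t_def)
  also have "(\<Oplus>i\<in>{..n}. t (Suc n) (Suc i)) \<oplus> t (Suc n) 0 = (\<Oplus>i\<in>{..Suc n}. t (Suc n) i)"
    using tc by (intro finsum_Suc2[symmetric]) auto
  finally show ?case by (simp only: t_def)
qed

locale char_p_cring = cring +
  fixes p :: nat
  assumes prime_p: "prime p" and char_p: "[p] \<cdot> \<one> = \<zero>"
begin

lemma p_pos: "0 < p" "1 < p" using prime_p prime_gt_1_nat[of p] by auto

lemma dvd_mult_zero: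
  assumes "p dvd n" "a \<in> carrier R"
  shows "[n] \<cdot> a = \<zero>"
proof -
  obtain k where k: "n = p * k" using assms(1) by blast
  have "[n] \<cdot> a = ([n] \<cdot> \<one>) \<otimes> a" using assms(2) by (simp add: add_pow_ldistr)
  also have "[n] \<cdot> \<one> = [k] \<cdot> ([p] \<cdot> \<one>)" using k by (simp add: add.nat_pow_pow)
  finally show ?thesis using assms(2) char_p by simp
qed

lemma frob_add1:
  assumes x: "x \<in> carrier R" and y: "y \<in> carrier R"
  shows "(x \<oplus> y) [^] p = x [^] p \<oplus> y [^] p"
proof -
  define t where "t i = [(p choose i)] \<cdot> (x [^] i \<otimes> y [^] (p - i))" for i :: nat
  have tc: "t i \<in> carrier R" for i using x y by (simp add: t_def)
  obtain n where n: "p = Suc (Suc n)" using p_pos that[of "p - 2"] by simp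
  have "(\<Oplus>i\<in>{..n}. t (Suc i)) = (\<Oplus>i\<in>{..n}. \<zero>)"
  proof (rule add.finprod_cong')
    fix i assume "i \<in> {..n}"
    then have "p dvd (p choose Suc i)"
      using dvd_choose_prime[of "Suc i" p] prime_p n by simp
    then show "t (Suc i) = \<zero>" using x y dvd_mult_zero by (simp add: t_def)
  qed (use tc in auto)
  then have "(\<Oplus>i\<in>{..p}. t i) = t p \<oplus> t 0"
    using finsum_Suc2[of t "Suc n"] finsum_Suc[of "\<lambda>i. t (Suc i)" n] tc n by simp
  then show ?thesis using binomial_expansion[OF x y, of p] x y by (simp add: t_def)
qed

lemma frob_add:
  assumes x: "x \<in> carrier R" and y: "y \<in> carrier R"
  shows "(x \<oplus> y) [^] (p ^ e) = x [^] (p ^ e) \<oplus> y [^] (p ^ e)"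
proof (induction e)
  case (Suc e)
  have "(x \<oplus> y) [^] (p ^ Suc e) = ((x \<oplus> y) [^] (p ^ e)) [^] p"
    using x y by (simp add: nat_pow_pow power_Suc2 del: power_Suc)
  also have "\<dots> = (x [^] (p ^ e)) [^] p \<oplus> (y [^] (p ^ e)) [^] p"
    unfolding Suc using x y by (intro frob_add1) auto
  finally show ?case using x y by (simp add: nat_pow_pow power_Suc2 del: power_Suc)
qed (use x y in simp)

lemma frob_zero: "\<zero> [^] (p ^ e) = \<zero>"
  using p_pos by (simp add: nat_pow_zero)

lemma frob_minus:
  assumes x: "x \<in> carrier R"
  shows "(\<ominus> x) [^] (p ^ e) = \<ominus> (x [^] (p ^ e))"
proof -
  have "(\<ominus> x) [^] (p ^ e) \<oplus> x [^] (p ^ e) = \<zero>"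
    using frob_add[of "\<ominus> x" x e] x frob_zero[of e] by (simp add: l_neg)
  from minus_equality[OF this] show ?thesis using x by simp
qed

end

lemma (in cring) ideal_criterion:
  assumes "H \<subseteq> carrier R" "\<zero> \<in> H" "\<And>a b. a \<in> H \<Longrightarrow> b \<in> H \<Longrightarrow> a \<oplus> b \<in> H"
    "\<And>r a. r \<in> carrier R \<Longrightarrow> a \<in> H \<Longrightarrow> r \<otimes> a \<in> H"
  shows "ideal H R"
proof (rule idealI)
  show "ring R" by (rule ring_axioms)
  have inv: "\<ominus> a \<in> H" if "a \<in> H" for a
  proof -
    have ac: "a \<in> carrier R" using that assms(1) by blast
    have "\<ominus> \<one> \<otimes> a \<in> H" using assms(4)[of "\<ominus> \<one>" a] that by simp
    then show ?thesis using ac by (simp add: l_minus)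
  qed
  show "subgroup H (add_monoid R)"
  proof (rule add.subgroupI)
    show "\<ominus> a \<in> H" if "a \<in> H" for a using inv[OF that] .
  qed (use assms in auto)
  show "x \<otimes> a \<in> H" if "a \<in> H" "x \<in> carrier R" for a x using assms that by blast
  show "a \<otimes> x \<in> H" if "a \<in> H" "x \<in> carrier R" for a x
    using assms(1,4) that m_comm by (metis subsetD)
qed

lemma (in ideal) ideal_facts:
  "I \<subseteq> carrier R" "\<zero> \<in> I" "\<And>a b. a \<in> I \<Longrightarrow> b \<in> I \<Longrightarrow> a \<oplus> b \<in> I"
  "\<And>r a. r \<in> carrier R \<Longrightarrow> a \<in> I \<Longrightarrow> r \<otimes> a \<in> I"
  "\<And>r a. r \<in> carrier R \<Longrightarrow> a \<in> I \<Longrightarrow> a \<otimes> r \<in> I"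
  "\<And>a. a \<in> I \<Longrightarrow> \<ominus> a \<in> I"
  using I_l_closed I_r_closed a_subset by auto

lemmas idealD = ideal.ideal_facts

context cring
begin

definition ipow :: "'a set \<Rightarrow> nat \<Rightarrow> 'a set"
  where "ipow I n = I [^]\<^bsub>ideals_set R\<^esub> n"

lemma ipow_0: "ipow I 0 = carrier R"
  by (simp add: ipow_def ideals_set_def nat_pow_def)

lemma ipow_Suc: "ipow I (Suc n) = ipow I n \<cdot> I"
  by (simp add: ipow_def ideals_set_def nat_pow_def)

lemma ipow_ideal: "ideal I R \<Longrightarrow> ideal (ipow I n) R"
  by (induction n) (auto simp: ipow_0 ipow_Suc oneideal ideal_prod_is_ideal)

lemma ipow_1: "ideal I R \<Longrightarrow> ipow I 1 = I"
  using ideal_prod_commute[OF oneideal, of I] by (simp add: ipow_0 ipow_Suc ideal_prod_one)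

lemma ideal_prod_mono: "I \<subseteq> I' \<Longrightarrow> J \<subseteq> J' \<Longrightarrow> I \<cdot> J \<subseteq> I' \<cdot> J'"
proof
  fix x assume "I \<subseteq> I'" "J \<subseteq> J'" "x \<in> I \<cdot> J"
  from this(3,1,2) show "x \<in> I' \<cdot> J'"
    by (induction rule: ideal_prod.induct) (auto intro: ideal_prod.intros)
qed

lemma ideal_prod_subset:
  assumes "ideal H R" "\<And>i j. i \<in> I \<Longrightarrow> j \<in> J \<Longrightarrow> i \<otimes> j \<in> H"
  shows "I \<cdot> J \<subseteq> H"
proof
  fix x assume "x \<in> I \<cdot> J"
  then show "x \<in> H"
    by (induction rule: ideal_prod.induct) (auto intro: assms idealD(3)[OF assms(1)])
qed

lemma ipow_add:
  assumes "ideal I R" shows "ipow I (m + n) = ipow I m \<cdot> ipow I n"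
proof -
  interpret S: comm_monoid "ideals_set R" by (rule ideals_set_is_comm_monoid)
  show ?thesis
    using assms S.nat_pow_mult[of I m n] by (simp add: ipow_def ideals_set_def)
qed

lemma ipow_mult:
  assumes "ideal I R" shows "ipow (ipow I m) n = ipow I (m * n)"
proof -
  interpret S: comm_monoid "ideals_set R" by (rule ideals_set_is_comm_monoid)
  show ?thesis
    using assms S.nat_pow_pow[of I m n] by (simp add: ipow_def ideals_set_def)
qed

lemma pow_in_ipow:
  assumes "ideal I R" "x \<in> I" shows "x [^] n \<in> ipow I n"
proof (induction n)
  case (Suc n)
  then show ?case using assms(2) by (simp add: ipow_Suc ideal_prod.prod)
qed (simp add: ipow_0)

text \<open>
  Monomials in generators of an ideal are products of lists: the exponent of \<open>g\<close> is then
  \<open>count_list xs g\<close>, and the total degree is the length.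
\<close>

definition lprod :: "'a list \<Rightarrow> 'a"
  where "lprod xs = foldr (\<otimes>) xs \<one>"

lemma lprod_simps [simp]: "lprod [] = \<one>" "lprod (x # xs) = x \<otimes> lprod xs"
  by (simp_all add: lprod_def)

lemma lprod_closed [simp]: "set xs \<subseteq> carrier R \<Longrightarrow> lprod xs \<in> carrier R"
  by (induction xs) auto

lemma colon_ideal:
  assumes H: "ideal H R" and g: "g \<in> carrier R"
  shows "ideal {r \<in> carrier R. r \<otimes> g \<in> H} R"
  using idealD[OF H] g by (intro ideal_criterion) (auto simp: l_distr m_assoc)

text \<open>
  Powers of an ideal are generated by the monomials in its generators. To multiply by a generator
  \<open>g\<close>, the induction passes from \<open>H\<close> to the colon ideal $(H : g)$.
\<close>

lemma ipow_genideal_subset: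
  assumes U: "U \<subseteq> carrier R" and H: "ideal H R"
    and "\<And>xs. length xs = n \<Longrightarrow> set xs \<subseteq> U \<Longrightarrow> lprod xs \<in> H"
  shows "ipow (Idl U) n \<subseteq> H"
  using assms(2,3)
proof (induction n arbitrary: H)
  case 0
  then have "\<one> \<in> H" using 0(2)[of "[]"] by simp
  then show ?case using idealD(4)[OF 0(1), of _ \<one>] by (auto simp: ipow_0)
next
  case (Suc n)
  have *: "ipow (Idl U) n \<subseteq> {r \<in> carrier R. r \<otimes> g \<in> H}" if g: "g \<in> U" for g
  proof (rule Suc.IH)
    show "ideal {r \<in> carrier R. r \<otimes> g \<in> H} R"
      using colon_ideal Suc.prems(1) g U by blast
    fix xs assume "length xs = n" "set xs \<subseteq> U"
    then show "lprod xs \<in> {r \<in> carrier R. r \<otimes> g \<in> H}"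
      using Suc.prems(2)[of "g # xs"] g U by (auto simp: m_comm subset_iff)
  qed
  show ?case unfolding ipow_Suc
  proof (rule ideal_prod_subset[OF Suc.prems(1)])
    fix i j assume i: "i \<in> ipow (Idl U) n" and j: "j \<in> Idl U"
    have ic: "i \<in> carrier R" using i idealD(1)[OF ipow_ideal[OF genideal_ideal[OF U]]] by blast
    have "Idl U \<subseteq> {r \<in> carrier R. r \<otimes> i \<in> H}"
    proof (intro genideal_minimal colon_ideal Suc.prems(1) ic subsetI)
      fix g assume g: "g \<in> U"
      then have "i \<otimes> g \<in> H" "g \<in> carrier R" using *[OF g] i U by auto
      then show "g \<in> {r \<in> carrier R. r \<otimes> i \<in> H}" using m_comm ic by simp
    qed
    then show "i \<otimes> j \<in> H" using j ic m_comm by auto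
  qed
qed

lemma lprod_count:
  assumes "set xs \<subseteq> carrier R" "g \<in> carrier R"
  shows "lprod xs = g [^] count_list xs g \<otimes> lprod (filter (\<lambda>x. x \<noteq> g) xs)"
  using assms(1)
proof (induction xs)
  case (Cons x xs)
  have "lprod (filter (\<lambda>x. x \<noteq> g) xs) \<in> carrier R" using Cons.prems by (auto intro!: lprod_closed)
  then show ?case using Cons assms(2) by (auto simp: m_ac)
qed simp

text \<open>
  Pigeonhole principle: a monomial of degree larger than $|U| q$ contains the \<open>q\<close>-th power of
  one of its variables.
\<close>

lemma ipow_pigeonhole:
  assumes U: "U \<subseteq> carrier R" "finite U" and H: "ideal H R"
    and q: "\<And>g. g \<in> U \<Longrightarrow> g [^] (q::nat) \<in> H" and n: "card U * q < n"
  shows "ipow (Idl U) n \<subseteq> H"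
proof (rule ipow_genideal_subset[OF U(1) H])
  fix xs assume xs: "length xs = n" "set xs \<subseteq> U"
  have "\<exists>g\<in>U. q \<le> count_list xs g"
  proof (rule ccontr)
    assume "\<not> (\<exists>g\<in>U. q \<le> count_list xs g)"
    then have "(\<Sum>g\<in>U. count_list xs g) \<le> (\<Sum>g\<in>U. q)" by (intro sum_mono) auto
    moreover have "(\<Sum>g\<in>U. count_list xs g) = length xs"
      using xs(2) U(2) sum_count_set by blast
    ultimately show False using n xs(1) by simp
  qed
  then obtain g where g: "g \<in> U" "q \<le> count_list xs g" by blast
  have gc: "g \<in> carrier R" and xc: "set xs \<subseteq> carrier R" using g U xs by auto
  let ?r = "lprod (filter (\<lambda>x. x \<noteq> g) xs)"
  have rc: "?r \<in> carrier R" using xc by (auto intro!: lprod_closed)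
  have "g [^] count_list xs g = g [^] (count_list xs g - q) \<otimes> g [^] q"
    using gc g(2) by (simp add: nat_pow_mult)
  also have "\<dots> \<in> H" using idealD(4)[OF H _ q[OF g(1)]] gc by simp
  finally show "lprod xs \<in> H"
    unfolding lprod_count[OF xc gc] using idealD(5)[OF H rc] by blast
qed

end

section \<open>Existence of valuation rings\<close>

context field
begin

text \<open>
  The elements $m_0 + m_1 x + \dots + m_n x^n$ with all $m_i$ in an ideal of \<open>V\<close> need not lie in
  \<open>V\<close>, so modules inside the field are needed, not only ideals of \<open>V\<close>.
\<close>

definition submod :: "'a set \<Rightarrow> 'a set \<Rightarrow> bool"
  where "submod V M \<longleftrightarrow> M \<subseteq> carrier R \<and> \<zero> \<in> M \<and> (\<forall>a\<in>M. \<forall>b\<in>M. a \<oplus> b \<in> M) \<and>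
    (\<forall>v\<in>V. \<forall>a\<in>M. v \<otimes> a \<in> M)"

text \<open>
  Values at \<open>x\<close> of the polynomials of degree at most \<open>n\<close> with coefficients in \<open>M\<close>.
\<close>

primrec polys :: "'a set \<Rightarrow> 'a \<Rightarrow> nat \<Rightarrow> 'a set" where
  "polys M x 0 = M"
| "polys M x (Suc n) = {t \<oplus> m \<otimes> x [^] Suc n | t m. t \<in> polys M x n \<and> m \<in> M}"

lemma submodD:
  assumes "submod V M"
  shows "M \<subseteq> carrier R" "\<zero> \<in> M" "\<And>a b. a \<in> M \<Longrightarrow> b \<in> M \<Longrightarrow> a \<oplus> b \<in> M"
    "\<And>v a. v \<in> V \<Longrightarrow> a \<in> M \<Longrightarrow> v \<otimes> a \<in> M" "\<And>a. a \<in> M \<Longrightarrow> a \<in> carrier R"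
  using assms by (auto simp: submod_def)

lemma submod_minus:
  assumes "subring V R" "submod V M" "a \<in> M"
  shows "\<ominus> a \<in> M"
proof -
  have "\<ominus> \<one> \<otimes> a \<in> M" using submodD(4)[OF assms(2)] subringE(3,5)[OF assms(1)] assms(3) by blast
  then show ?thesis using submodD(5)[OF assms(2,3)] by (simp add: l_minus)
qed

lemma submod_self: "subring V R \<Longrightarrow> submod V V"
  using subringE[of V R] by (auto simp: submod_def)

lemma polys_SucI: "t \<in> polys M x n \<Longrightarrow> m \<in> M \<Longrightarrow> t \<oplus> m \<otimes> x [^] Suc n \<in> polys M x (Suc n)"
  by auto

lemma polys_SucE:
  assumes "a \<in> polys M x (Suc n)"
  obtains t m where "t \<in> polys M x n" "m \<in> M" "a = t \<oplus> m \<otimes> x [^] Suc n"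
  using assms by auto

context
  fixes V M x
  assumes V: "subring V R" and M: "submod V M" and x: "x \<in> carrier R"
begin

lemma Vc: "v \<in> V \<Longrightarrow> v \<in> carrier R" using subringE(1)[OF V] by blast

lemma polys_submod: "submod V (polys M x n)"
proof (induction n)
  case (Suc n)
  note IH = submodD[OF Suc] and M' = submodD[OF M]
  show ?case unfolding submod_def
  proof (intro conjI ballI subsetI)
    fix a assume "a \<in> polys M x (Suc n)"
    then show "a \<in> carrier R" using IH(5) M'(5) x by (auto elim!: polys_SucE)
  next
    show "\<zero> \<in> polys M x (Suc n)"
      using polys_SucI[OF IH(2) M'(2)] x by (simp del: polys.simps)
  next
    fix a b assume "a \<in> polys M x (Suc n)" "b \<in> polys M x (Suc n)"
    then obtain t m t' m' where *: "t \<in> polys M x n" "m \<in> M" "a = t \<oplus> m \<otimes> x [^] Suc n"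
      "t' \<in> polys M x n" "m' \<in> M" "b = t' \<oplus> m' \<otimes> x [^] Suc n"
      by (elim polys_SucE)
    have "a \<oplus> b = (t \<oplus> t') \<oplus> (m \<oplus> m') \<otimes> x [^] Suc n"
    proof -
      define u where "u = x [^] Suc n"
      have "u \<in> carrier R" "t \<in> carrier R" "m \<in> carrier R" "t' \<in> carrier R" "m' \<in> carrier R"
        using * IH(5) M'(5) x by (auto simp: u_def)
      then show ?thesis
        unfolding *(3,6) u_def[symmetric] by (simp add: l_distr a_ac)
    qed
    then show "a \<oplus> b \<in> polys M x (Suc n)"
      using polys_SucI[OF IH(3) M'(3)] * by metis
  next
    fix v a assume v: "v \<in> V" and "a \<in> polys M x (Suc n)"
    then obtain t m where *: "t \<in> polys M x n" "m \<in> M" "a = t \<oplus> m \<otimes> x [^] Suc n"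
      by (elim polys_SucE)
    have "v \<otimes> a = v \<otimes> t \<oplus> (v \<otimes> m) \<otimes> x [^] Suc n"
      using * IH(5) M'(5) x Vc[OF v] by (simp add: r_distr m_assoc del: nat_pow_Suc)
    then show "v \<otimes> a \<in> polys M x (Suc n)"
      using polys_SucI[OF IH(4) M'(4)] * v by metis
  qed
qed (use M in simp)

lemma polys_Suc_mono: "polys M x n \<subseteq> polys M x (Suc n)"
proof
  fix t assume t: "t \<in> polys M x n"
  show "t \<in> polys M x (Suc n)"
    using polys_SucI[OF t submodD(2)[OF M]] submodD(5)[OF polys_submod t] x by (simp del: polys.simps)
qed

lemma polys_mono: "i \<le> n \<Longrightarrow> polys M x i \<subseteq> polys M x n"
  by (rule lift_Suc_mono_le[of "polys M x"]) (rule polys_Suc_mono)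

lemma polys_monom:
  assumes "m \<in> M" "i \<le> n" shows "m \<otimes> x [^] i \<in> polys M x n"
proof -
  have mc: "m \<in> carrier R" using submodD(5)[OF M assms(1)] .
  have "m \<otimes> x [^] i \<in> polys M x i"
  proof (cases i)
    case 0
    then show ?thesis using assms mc by simp
  next
    case (Suc j)
    then show ?thesis
      using polys_SucI[OF submodD(2)[OF polys_submod] assms(1), of j] mc x
      by (simp del: polys.simps nat_pow_Suc)
  qed
  then show ?thesis using polys_mono[OF assms(2)] by blast
qed

lemma polys_shift: "b \<in> polys M x j \<Longrightarrow> x [^] i \<otimes> b \<in> polys M x (i + j)"
proof (induction j arbitrary: b)
  case 0
  then show ?case using polys_monom[of b i "i + 0"] submodD(5)[OF M] x by (simp add: m_comm)
next
  case (Suc j)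
  then obtain t m where *: "t \<in> polys M x j" "m \<in> M" "b = t \<oplus> m \<otimes> x [^] Suc j"
    by (elim polys_SucE)
  have tc: "t \<in> carrier R" "m \<in> carrier R" using * submodD(5)[OF polys_submod] submodD(5)[OF M] by auto
  have "x [^] i \<otimes> b = x [^] i \<otimes> t \<oplus> m \<otimes> (x [^] i \<otimes> x [^] Suc j)"
    unfolding *(3) using tc x by (simp add: r_distr m_lcomm del: nat_pow_Suc)
  also have "x [^] i \<otimes> x [^] Suc j = x [^] Suc (i + j)"
    using x nat_pow_mult[of x i "Suc j"] by (simp del: nat_pow_Suc)
  finally show ?case using polys_SucI[OF Suc.IH[OF *(1)] *(2)] by simp
qed

end

lemma polys_mult:
  assumes V: "subring V R" and M: "submod V M" and x: "x \<in> carrier R"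
    and "a \<in> polys V x i" "b \<in> polys M x j"
  shows "a \<otimes> b \<in> polys M x (i + j)"
  using assms(4)
proof (induction i arbitrary: a)
  case 0
  then show ?case using submodD(4)[OF polys_submod[OF V M x]] assms(5) by simp
next
  case (Suc i)
  then obtain t v where *: "t \<in> polys V x i" "v \<in> V" "a = t \<oplus> v \<otimes> x [^] Suc i"
    by (elim polys_SucE)
  have bc: "b \<in> carrier R" using submodD(5)[OF polys_submod[OF V M x] assms(5)] .
  have vc: "v \<in> carrier R" using subringE(1)[OF V] *(2) by blast
  have tc: "t \<in> carrier R" using submodD(5)[OF polys_submod[OF V submod_self[OF V] x] *(1)] .
  have tb: "t \<otimes> b \<in> polys M x (Suc i + j)"
    using Suc.IH[OF *(1)] polys_Suc_mono[OF V M x] by (simp del: polys.simps) blast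
  have vb: "v \<otimes> (x [^] Suc i \<otimes> b) \<in> polys M x (Suc i + j)"
    using submodD(4)[OF polys_submod[OF V M x] *(2)] polys_shift[OF V M x assms(5)] by blast
  have "a \<otimes> b = t \<otimes> b \<oplus> v \<otimes> (x [^] Suc i \<otimes> b)"
    unfolding *(3) using bc vc x tc by (simp add: l_distr m_assoc del: nat_pow_Suc)
  then show ?case using submodD(3)[OF polys_submod[OF V M x] tb vb] by simp
qed

text \<open>
  Zorn's lemma is applied to subrings together with a proper ideal. The ideal is recorded so that
  its elements stay non-units when the ring grows.
\<close>

definition ring_ideal_pair :: "'a set \<Rightarrow> 'a set \<Rightarrow> bool"
  where "ring_ideal_pair V M \<longleftrightarrow> subring V R \<and> submod V M \<and> M \<subseteq> V \<and> \<one> \<notin> M"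

text \<open>
  Adjoining \<open>x\<close> to the ring can fail for one reason only: the extended ideal contains
  \<open>\<one>\<close>, that is, $1 = m_0 + m_1 x + \dots + m_n x^n$ with all $m_i \in M$.
\<close>

lemma ring_ideal_pair_adjoin:
  assumes VM: "ring_ideal_pair V M" and x: "x \<in> carrier R" and one: "\<And>n. \<one> \<notin> polys M x n"
  shows "ring_ideal_pair (\<Union>n. polys V x n) (\<Union>n. polys M x n)"
proof -
  let ?V = "\<Union>n. polys V x n" and ?M = "\<Union>n. polys M x n"
  have V: "subring V R" and M: "submod V M" and MV: "M \<subseteq> V" using VM by (auto simp: ring_ideal_pair_def)
  note V' = submod_self[OF V]
  have up: "\<exists>n. a \<in> polys N x n \<and> b \<in> polys N x n" if "a \<in> polys N x i" "b \<in> polys N x j" "submod V N" for a b N i j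
    using that polys_mono[OF V that(3) x, of i "max i j"] polys_mono[OF V that(3) x, of j "max i j"] by auto
  have add: "\<exists>n. a \<oplus> b \<in> polys N x n" if "a \<in> polys N x i" "b \<in> polys N x j" "submod V N" for a b N i j
    using up[OF that] submodD(3)[OF polys_submod[OF V that(3) x]] by blast
  have sub: "subring ?V R"
  proof (rule subringI)
    show "?V \<subseteq> carrier R" using submodD(5)[OF polys_submod[OF V V' x]] by blast
    have "\<one> \<in> polys V x 0" using subringE(3)[OF V] by simp
    then show "\<one> \<in> ?V" by blast
    show "\<ominus> h \<in> ?V" if "h \<in> ?V" for h
      using that submod_minus[OF V polys_submod[OF V V' x]] by blast
    show "h \<otimes> k \<in> ?V" if "h \<in> ?V" "k \<in> ?V" for h k
      using that by (auto intro: polys_mult[OF V V' x])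
    show "h \<oplus> k \<in> ?V" if "h \<in> ?V" "k \<in> ?V" for h k
      using that by (auto intro: add[OF _ _ V'])
  qed
  have "submod ?V ?M"
    unfolding submod_def
  proof (intro conjI ballI)
    show "?M \<subseteq> carrier R" using submodD(5)[OF polys_submod[OF V M x]] by blast
    show "\<zero> \<in> ?M" using submodD(2)[OF polys_submod[OF V M x]] by blast
    show "a \<oplus> b \<in> ?M" if "a \<in> ?M" "b \<in> ?M" for a b
      using that by (auto intro: add[OF _ _ M])
    show "v \<otimes> b \<in> ?M" if "v \<in> ?V" "b \<in> ?M" for v b
      using that by (auto intro: polys_mult[OF V M x])
  qed
  moreover have "polys M x n \<subseteq> polys V x n" for n using MV by (induction n) auto
  ultimately show ?thesis using sub one unfolding ring_ideal_pair_def by blast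
qed

definition maximal_pair :: "'a set \<Rightarrow> 'a set \<Rightarrow> bool"
  where "maximal_pair V M \<longleftrightarrow> ring_ideal_pair V M \<and>
    (\<forall>V' M'. ring_ideal_pair V' M' \<and> V \<subseteq> V' \<and> M \<subseteq> M' \<longrightarrow> V' = V \<and> M' = M)"

lemma maximal_pair_exists:
  assumes "ring_ideal_pair V0 M0"
  shows "\<exists>V M. maximal_pair V M \<and> V0 \<subseteq> V \<and> M0 \<subseteq> M"
proof -
  define A where "A = {(V, M). ring_ideal_pair V M \<and> V0 \<subseteq> V \<and> M0 \<subseteq> M}"
  define P where "P a b \<longleftrightarrow> fst a \<subseteq> fst b \<and> snd a \<subseteq> snd b" for a b :: "'a set \<times> 'a set"
  have "\<exists>m\<in>A. \<forall>a\<in>A. P m a \<longrightarrow> a = m"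
  proof (rule predicate_Zorn)
    show "partial_order_on A (relation_of P A)"
      by (rule partial_order_on_relation_ofI) (auto simp: P_def prod_eq_iff)
    fix C assume C: "C \<in> Chains (relation_of P A)"
    have CA: "C \<subseteq> A" using C by (auto simp: Chains_def relation_of_def)
    have tot: "P a b \<or> P b a" if "a \<in> C" "b \<in> C" for a b
      using C that by (auto simp: Chains_def relation_of_def)
    show "\<exists>u\<in>A. \<forall>a\<in>C. P a u"
    proof (cases "C = {}")
      case True
      then show ?thesis using assms by (auto simp: A_def)
    next
      case False
      define W N where "W = (\<Union>c\<in>C. fst c)" and "N = (\<Union>c\<in>C. snd c)"
      have pr: "subring (fst c) R" "submod (fst c) (snd c)" "snd c \<subseteq> fst c" "\<one> \<notin> snd c"
        "V0 \<subseteq> fst c" "M0 \<subseteq> snd c" if "c \<in> C" for c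
        using subsetD[OF CA that] by (auto simp: A_def ring_ideal_pair_def)
      have WI: "h \<in> W" if "h \<in> fst c" "c \<in> C" for h c using that by (auto simp: W_def)
      have NI: "h \<in> N" if "h \<in> snd c" "c \<in> C" for h c using that by (auto simp: N_def)
      have W2: "\<exists>c\<in>C. a \<in> fst c \<and> b \<in> fst c" if "a \<in> W" "b \<in> W" for a b
        using that tot unfolding W_def P_def by blast
      have N2: "\<exists>c\<in>C. a \<in> snd c \<and> b \<in> snd c" if "a \<in> N" "b \<in> N" for a b
        using that tot unfolding N_def P_def by blast
      have WN2: "\<exists>c\<in>C. a \<in> fst c \<and> b \<in> snd c" if "a \<in> W" "b \<in> N" for a b
        using that tot unfolding W_def N_def P_def by blast
      have "subring W R"
      proof (rule subringI)
        show "W \<subseteq> carrier R" using subringE(1)[OF pr(1)] by (auto simp: W_def)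
        show "\<one> \<in> W" using False subringE(3)[OF pr(1)] by (auto simp: W_def)
        show "\<ominus> h \<in> W" if "h \<in> W" for h
          using that subringE(5)[OF pr(1)] by (auto simp: W_def)
        show "h \<otimes> k \<in> W" if "h \<in> W" "k \<in> W" for h k
          using W2[OF that] subringE(6)[OF pr(1)] WI by blast
        show "h \<oplus> k \<in> W" if "h \<in> W" "k \<in> W" for h k
          using W2[OF that] subringE(7)[OF pr(1)] WI by blast
      qed
      moreover have "submod W N"
        unfolding submod_def
      proof (intro conjI ballI)
        show "N \<subseteq> carrier R" using submodD(1)[OF pr(2)] by (auto simp: N_def)
        show "\<zero> \<in> N" using False submodD(2)[OF pr(2)] by (auto simp: N_def)
        show "a \<oplus> b \<in> N" if "a \<in> N" "b \<in> N" for a b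
          using N2[OF that] submodD(3)[OF pr(2)] NI by blast
        show "v \<otimes> b \<in> N" if "v \<in> W" "b \<in> N" for v b
          using WN2[OF that] submodD(4)[OF pr(2)] NI by blast
      qed
      moreover have "N \<subseteq> W" using pr(3) by (auto simp: N_def W_def)
      moreover have "\<one> \<notin> N" using pr(4) by (auto simp: N_def)
      moreover have "V0 \<subseteq> W" "M0 \<subseteq> N" using False pr(5,6) unfolding W_def N_def by blast+
      ultimately have "(W, N) \<in> A" by (simp add: A_def ring_ideal_pair_def)
      moreover have "\<forall>a\<in>C. P a (W, N)" by (auto simp: P_def W_def N_def)
      ultimately show ?thesis by blast
    qed
  qed
  then obtain V M where VM: "(V, M) \<in> A" "\<forall>a\<in>A. P (V, M) a \<longrightarrow> a = (V, M)" by auto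
  have "maximal_pair V M"
    unfolding maximal_pair_def
  proof (intro conjI allI impI)
    show "ring_ideal_pair V M" using VM(1) by (simp add: A_def)
    fix V' M' assume "ring_ideal_pair V' M' \<and> V \<subseteq> V' \<and> M \<subseteq> M'"
    then have "(V', M') \<in> A" "P (V, M) (V', M')" using VM(1) by (auto simp: A_def P_def)
    then show "V' = V" "M' = M" using VM(2) by auto
  qed
  then show ?thesis using VM(1) by (auto simp: A_def)
qed

lemma maximal_pair_adjoin:
  assumes VM: "maximal_pair V M" and x: "x \<in> carrier R" "x \<notin> V"
  shows "\<exists>n. \<one> \<in> polys M x n"
proof (rule ccontr)
  assume "\<not> ?thesis"
  then have pair: "ring_ideal_pair (\<Union>n. polys V x n) (\<Union>n. polys M x n)"
    using VM x(1) unfolding maximal_pair_def by (intro ring_ideal_pair_adjoin) blast+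
  have V: "subring V R" using VM unfolding ring_ideal_pair_def maximal_pair_def by blast
  have "V \<subseteq> (\<Union>n. polys V x n)" "M \<subseteq> (\<Union>n. polys M x n)"
    using UN_upper[of 0 UNIV "polys V x"] UN_upper[of 0 UNIV "polys M x"] by simp_all
  then have "(\<Union>n. polys V x n) = V" using VM pair unfolding maximal_pair_def by blast
  moreover have "\<one> \<otimes> x [^] (1::nat) \<in> polys V x 1"
    using polys_monom[OF V submod_self[OF V] x(1), of \<one> 1 1] subringE(3)[OF V] by blast
  ultimately have "\<one> \<otimes> x [^] (1::nat) \<in> V" by blast
  then show False using x by simp
qed

text \<open>
  Put $s = 1 - m$. If $s^{-1} \notin V$, then by maximality $1$ is a polynomial in $s^{-1}$ with
  coefficients in \<open>M\<close>. Clearing denominators gives $s^n \in M$, which is absurd because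
  $s \equiv 1$ modulo \<open>M\<close>.
\<close>

lemma maximal_pair_unit:
  assumes VM: "maximal_pair V M" and m: "m \<in> M"
  shows "\<exists>w\<in>V. w \<otimes> (\<one> \<ominus> m) = \<one>"
proof -
  have V: "subring V R" and M: "submod V M" and MV: "M \<subseteq> V" and one: "\<one> \<notin> M"
    using VM unfolding ring_ideal_pair_def maximal_pair_def by blast+
  have mc: "m \<in> carrier R" using submodD(5)[OF M m] .
  define s where "s = \<one> \<ominus> m"
  have sc: "s \<in> carrier R" using mc by (simp add: s_def)
  have sV: "s \<in> V"
    unfolding s_def a_minus_def using m MV by (intro subringE(3,5,7)[OF V]) blast
  have "s \<noteq> \<zero>" using m one r_right_minus_eq[OF one_closed mc] unfolding s_def by metis
  then have sU: "s \<in> Units R" using sc field_Units by blast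
  then have w: "inv s \<in> carrier R" "inv s \<otimes> s = \<one>" by simp_all
  have "inv s \<in> V"
  proof (rule ccontr)
    assume "inv s \<notin> V"
    then obtain n where n: "\<one> \<in> polys M (inv s) n" using maximal_pair_adjoin[OF VM w(1)] by blast
    have clear: "s [^] i \<otimes> t \<in> M" if "t \<in> polys M (inv s) i" for t i
      using that
    proof (induction i arbitrary: t)
      case 0
      then show ?case using submodD(5)[OF M] by simp
    next
      case (Suc i)
      then obtain t' k where *: "t' \<in> polys M (inv s) i" "k \<in> M" "t = t' \<oplus> k \<otimes> inv s [^] Suc i"
        by (elim polys_SucE)
      have c: "t' \<in> carrier R" "k \<in> carrier R"
        using * submodD(5)[OF polys_submod[OF V M w(1)]] submodD(5)[OF M] by auto
      have "s [^] Suc i \<otimes> inv s [^] Suc i = (s \<otimes> inv s) [^] Suc i"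
        by (rule nat_pow_distrib[OF sc w(1), symmetric])
      then have e: "s [^] Suc i \<otimes> inv s [^] Suc i = \<one>" using sU by (simp del: nat_pow_Suc)
      have "s [^] Suc i \<otimes> t = s [^] Suc i \<otimes> t' \<oplus> k \<otimes> (s [^] Suc i \<otimes> inv s [^] Suc i)"
        unfolding *(3) using c sc w by (simp add: r_distr m_lcomm del: nat_pow_Suc)
      moreover have "s [^] Suc i \<otimes> t' = s \<otimes> (s [^] i \<otimes> t')"
        using c sc by (simp add: m_comm[of "s [^] i" s] m_assoc)
      ultimately have "s [^] Suc i \<otimes> t = s \<otimes> (s [^] i \<otimes> t') \<oplus> k" using e c by simp
      then show ?case using submodD(3)[OF M submodD(4)[OF M sV Suc.IH[OF *(1)]] *(2)] by simp
    qed
    have desc: "t \<in> M" if "s \<otimes> t \<in> M" "t \<in> V" for t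
    proof -
      have tc: "t \<in> carrier R" using that(2) subringE(1)[OF V] by blast
      have "t = s \<otimes> t \<oplus> m \<otimes> t"
        using mc tc unfolding s_def a_minus_def by (simp add: l_distr l_minus a_assoc l_neg)
      moreover have "m \<otimes> t \<in> M" using submodD(4)[OF M that(2) m] mc tc by (simp add: m_comm)
      ultimately show ?thesis using submodD(3)[OF M that(1), of "m \<otimes> t"] by metis
    qed
    have "s [^] n \<in> M" using clear[OF n] sc by simp
    moreover have "\<one> \<in> M" if "s [^] j \<in> M" for j :: nat
      using that
    proof (induction j)
      case (Suc j)
      have "s [^] j \<in> V" using sV subringE(3,6)[OF V] by (induction j) auto
      then show ?case using desc[of "s [^] j"] Suc sc by (simp add: m_comm)
    qed simp
    ultimately show False using one by blast
  qed
  then show ?thesis using w s_def by blast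
qed


text \<open>
  The degree descent for relations in $x$ and $y = x^{-1}$. In the relation $1 = m_0 + m_1 y +
  \dots + m_k y^k$ the factor $1 - m_0$ is a unit, and multiplication by $x^n$ expresses $x^n$
  by lower powers of $x$. Substitution in the relation for $x$ lowers its degree.
\<close>

lemma maximal_pair_reduce:
  assumes VM: "maximal_pair V M" and xy: "x \<in> carrier R" "y \<in> carrier R" "x \<otimes> y = \<one>"
    and n: "\<one> \<in> polys M x n" and k: "\<one> \<in> polys M y k" "k \<le> n" and n1: "1 \<le> n"
  shows "\<one> \<in> polys M x (n - 1)"
proof -
  have V: "subring V R" and M: "submod V M" and MV: "M \<subseteq> V" and one: "\<one> \<notin> M"
    using VM unfolding ring_ideal_pair_def maximal_pair_def by blast+
  note P = submodD[OF polys_submod[OF V M xy(1)]]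
  have *: "\<exists>m\<in>M. x [^] n \<otimes> (t \<ominus> m) \<in> polys M x (n - 1)"
    if "t \<in> polys M y i" "i \<le> n" for t i
    using that
  proof (induction i arbitrary: t)
    case 0
    then have "t \<in> M" by simp
    moreover have "t \<in> carrier R" using submodD(5)[OF M \<open>t \<in> M\<close>] .
    ultimately show ?case using P(2) xy by (intro bexI[of _ t]) (auto simp: a_minus_def r_neg)
  next
    case (Suc i)
    then obtain t' k where *: "t' \<in> polys M y i" "k \<in> M" "t = t' \<oplus> k \<otimes> y [^] Suc i"
      by (elim polys_SucE)
    obtain m where m: "m \<in> M" "x [^] n \<otimes> (t' \<ominus> m) \<in> polys M x (n - 1)"
      using Suc.IH[OF *(1)] Suc.prems(2) by auto
    have c: "t' \<in> carrier R" "k \<in> carrier R" "m \<in> carrier R"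
      using * m submodD(5)[OF polys_submod[OF V M xy(2)]] submodD(5)[OF M] by auto
    define j where "j = n - Suc i"
    have "x [^] Suc i \<otimes> y [^] Suc i = (x \<otimes> y) [^] Suc i"
      by (rule nat_pow_distrib[OF xy(1,2), symmetric])
    then have e: "x [^] Suc i \<otimes> y [^] Suc i = \<one>" using xy(3) by (simp del: nat_pow_Suc)
    have "x [^] n = x [^] j \<otimes> x [^] Suc i"
      using Suc.prems(2) xy(1) nat_pow_mult[of x j "Suc i"] by (simp add: j_def del: nat_pow_Suc)
    then have e2: "x [^] n \<otimes> y [^] Suc i = x [^] j"
      using e xy by (simp add: m_assoc del: nat_pow_Suc)
    define u where "u = y [^] Suc i"
    have uc: "u \<in> carrier R" using xy by (simp add: u_def del: nat_pow_Suc)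
    have "t \<ominus> m = (t' \<ominus> m) \<oplus> k \<otimes> u"
      unfolding *(3) u_def[symmetric] a_minus_def using c uc by (simp add: a_ac)
    then have "x [^] n \<otimes> (t \<ominus> m) = x [^] n \<otimes> (t' \<ominus> m) \<oplus> k \<otimes> (x [^] n \<otimes> u)"
      using c uc xy(1) by (simp add: r_distr m_lcomm)
    also have "x [^] n \<otimes> u = x [^] j" using e2 by (simp add: u_def)
    finally have "x [^] n \<otimes> (t \<ominus> m) = x [^] n \<otimes> (t' \<ominus> m) \<oplus> k \<otimes> x [^] j" .
    moreover have "k \<otimes> x [^] j \<in> polys M x (n - 1)"
      using polys_monom[OF V M xy(1) *(2), of j "n - 1"] by (simp add: j_def)
    ultimately show ?case using P(3)[OF m(2)] m(1) by metis
  qed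
  obtain m where m: "m \<in> M" "x [^] n \<otimes> (\<one> \<ominus> m) \<in> polys M x (n - 1)" using *[OF k] by blast
  obtain w where w: "w \<in> V" "w \<otimes> (\<one> \<ominus> m) = \<one>" using maximal_pair_unit[OF VM m(1)] by blast
  have c: "m \<in> carrier R" "w \<in> carrier R"
    using m w submodD(5)[OF M] subringE(1)[OF V] by auto
  have "w \<otimes> (x [^] n \<otimes> (\<one> \<ominus> m)) = x [^] n \<otimes> (w \<otimes> (\<one> \<ominus> m))"
    using c xy(1) by (simp add: m_lcomm)
  then have xn: "x [^] n \<in> polys M x (n - 1)"
    using P(4)[OF w(1) m(2)] w(2) xy(1) by simp
  obtain n' where n': "n = Suc n'" using n1 by (cases n) auto
  then obtain s k' where s: "s \<in> polys M x n'" "k' \<in> M" "\<one> = s \<oplus> k' \<otimes> x [^] n"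
    using n polys_SucE by metis
  show ?thesis
    using P(3)[OF s(1) P(4)[OF subsetD[OF MV s(2)]]] xn s(3) n' by simp
qed

text \<open>
  The condition is stated with $xy = 1$ instead of an inverse, whose value at zero is unspecified.
\<close>

definition valuation_ring :: "'a set \<Rightarrow> bool"
  where "valuation_ring V \<longleftrightarrow> subring V R \<and>
    (\<forall>x\<in>carrier R. \<forall>y\<in>carrier R. x \<otimes> y = \<one> \<longrightarrow> x \<in> V \<or> y \<in> V)"

text \<open>
  If neither $x$ nor $y = x^{-1}$ were in \<open>V\<close>, both would satisfy a relation as in
  \<open>maximal_pair_adjoin\<close>. Taken of minimal degree, the longer one contradicts the degree descent.
\<close>

lemma maximal_pair_valuation_ring:
  assumes VM: "maximal_pair V M"
  shows "valuation_ring V"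
proof -
  have V: "subring V R" and M: "submod V M" and MV: "M \<subseteq> V" and one: "\<one> \<notin> M"
    using VM unfolding ring_ideal_pair_def maximal_pair_def by blast+
  have False if xy: "x \<in> carrier R" "y \<in> carrier R" "x \<otimes> y = \<one>" "x \<notin> V" "y \<notin> V" for x y
  proof -
    define n where "n = (LEAST n. \<one> \<in> polys M x n)"
    define k where "k = (LEAST n. \<one> \<in> polys M y n)"
    have n0: "\<one> \<notin> polys M x i" if "i < n" for i
      using that not_less_Least unfolding n_def by blast
    have n: "\<one> \<in> polys M x n"
      using maximal_pair_adjoin[OF VM xy(1,4)] unfolding n_def by (auto intro: LeastI)
    have k: "\<one> \<in> polys M y k" 
      using maximal_pair_adjoin[OF VM xy(2,5)] unfolding k_def by (auto intro: LeastI)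
    have k0: "\<one> \<notin> polys M y i" if "i < k" for i
      using that not_less_Least unfolding k_def by blast
    have pos: "1 \<le> n" "1 \<le> k" using n k one by (cases n; cases k; simp)+
    have yx: "y \<otimes> x = \<one>" using xy m_comm by simp
    show False
    proof (cases "k \<le> n")
      case True
      then show False using maximal_pair_reduce[OF VM xy(1-3) n k True pos(1)] n0[of "n - 1"] pos by simp
    next
      case False
      then show False
        using maximal_pair_reduce[OF VM xy(2,1) yx k n _ pos(2)] k0[of "k - 1"] pos by simp
    qed
  qed
  then show ?thesis unfolding valuation_ring_def using V by blast
qed

lemma dominating_valuation_ring:
  assumes "ring_ideal_pair A I"
  obtains V M where "valuation_ring V" "ring_ideal_pair V M" "A \<subseteq> V" "I \<subseteq> M"
  using maximal_pair_exists[OF assms] maximal_pair_valuation_ring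
  unfolding maximal_pair_def by metis

section \<open>Integral dependence and valuation rings\<close>

text \<open>
  Let $d > 0$. For an ideal \<open>I\<close> of a ring containing \<open>z\<close>, \<open>rees I z d\<close> is the degree \<open>d\<close> part
  $I\,(I, z)^{d-1}$ of an ideal of a Rees ring, and \<open>rees I z d (z [^] d)\<close> is an equation of integral
  dependence of \<open>z\<close> on \<open>I\<close>. If \<open>I\<close> is a subring and \<open>z\<close> is arbitrary, it consists of
  the values at \<open>z\<close> of polynomials of degree less than \<open>d\<close> over \<open>I\<close>, and the same equation says
  that \<open>z\<close> is integral over \<open>I\<close>.
\<close>

inductive rees :: "'a set \<Rightarrow> 'a \<Rightarrow> nat \<Rightarrow> 'a \<Rightarrow> bool" for I z where
  rees_gen: "y \<in> I \<Longrightarrow> rees I z 1 y"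
| rees_add: "rees I z d s \<Longrightarrow> rees I z d t \<Longrightarrow> rees I z d (s \<oplus> t)"
| rees_mult: "rees I z d s \<Longrightarrow> rees I z e t \<Longrightarrow> rees I z (d + e) (s \<otimes> t)"
| rees_shift: "rees I z d s \<Longrightarrow> rees I z (Suc d) (s \<otimes> z)"

context
  fixes A I z
  assumes A: "subring A R" and I: "submod A I" and z: "z \<in> carrier R"
begin

lemma rees_closed: "rees I z d t \<Longrightarrow> t \<in> carrier R"
  by (induction rule: rees.induct) (use z submodD(5)[OF I] in auto)

lemma rees_smult: "rees I z d t \<Longrightarrow> a \<in> A \<Longrightarrow> rees I z d (a \<otimes> t)"
proof (induction rule: rees.induct)
  case (rees_gen y)
  then show ?case using submodD(4)[OF I] rees.rees_gen by blast
next
  case (rees_add d s t)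
  then show ?case
    using rees.rees_add[of I z d "a \<otimes> s" "a \<otimes> t"] rees_closed subringE(1)[OF A] by (simp add: r_distr subset_iff)
next
  case (rees_mult d s e t)
  then show ?case
    using rees.rees_mult[of I z d "a \<otimes> s" e t] rees_closed subringE(1)[OF A] by (simp add: m_assoc subset_iff)
next
  case (rees_shift d s)
  then show ?case
    using rees.rees_shift[of I z d "a \<otimes> s"] rees_closed subringE(1)[OF A] z by (simp add: m_assoc subset_iff)
qed

lemma rees_shift_pow: "rees I z d t \<Longrightarrow> rees I z (d + k) (t \<otimes> z [^] k)"
proof (induction k)
  case (Suc k)
  then show ?case
    using rees.rees_shift[of I z "d + k" "t \<otimes> z [^] k"] rees_closed z by (simp add: m_assoc)
qed (use rees_closed in simp)

text \<open>
  The fractions $t/z^d$ with \<open>rees I z d t\<close> form the ideal \<open>N\<close> of $A + N$ that is generated by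
  $z^{-1} I$. If \<open>z\<close> is not integral over \<open>I\<close>, this ideal is proper, so some valuation ring
  dominates it. There $y/z$ is a non-unit for all $y \in I$, and \<open>z\<close> is no multiple of \<open>y\<close>.
\<close>

lemma valuative_criterion:
  assumes z0: "z \<noteq> \<zero>" and no: "\<And>d. \<not> rees I z d (z [^] d)"
  obtains V where "valuation_ring V" "A \<subseteq> V" "\<And>a y. a \<in> V \<Longrightarrow> y \<in> I \<Longrightarrow> z \<noteq> a \<otimes> y"
proof -
  have zU: "z \<in> Units R" using z z0 field_Units by blast
  define w where "w = inv z"
  have w: "w \<in> carrier R" "w \<otimes> z = \<one>" "z \<otimes> w = \<one>" using zU by (simp_all add: w_def)
  have zw: "z [^] d \<otimes> w [^] d = \<one>" for d :: nat
    using nat_pow_distrib[OF z w(1), of d] w(3) by simp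
  define N where "N = {t \<otimes> w [^] d | t d. rees I z d t}"
  have NI: "t \<otimes> w [^] d \<in> N" if "rees I z d t" for t d using that unfolding N_def by blast
  have NE: "\<exists>t d. rees I z d t \<and> n = t \<otimes> w [^] d" if "n \<in> N" for n using that unfolding N_def by blast
  have Nc: "n \<in> carrier R" if "n \<in> N" for n using NE[OF that] rees_closed w by auto
  have lift: "t \<otimes> w [^] d = (t \<otimes> z [^] k) \<otimes> w [^] (d + k)" if "t \<in> carrier R" for t and d k :: nat
  proof -
    have "(t \<otimes> z [^] k) \<otimes> w [^] (d + k) = (t \<otimes> z [^] k) \<otimes> (w [^] d \<otimes> w [^] k)"
      using w(1) by (simp add: nat_pow_mult)
    also have "\<dots> = t \<otimes> w [^] d \<otimes> (z [^] k \<otimes> w [^] k)" using that z w(1) by (simp add: m_ac)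
    finally show ?thesis using zw that w(1) by simp
  qed
  have N0: "\<zero> \<in> N" using NI[OF rees_gen[OF submodD(2)[OF I]]] w(1) by simp
  have Nadd: "m \<oplus> n \<in> N" if mn: "m \<in> N" "n \<in> N" for m n
  proof -
    obtain s d t e where *: "rees I z d s" "m = s \<otimes> w [^] d" "rees I z e t" "n = t \<otimes> w [^] e"
      using NE[OF mn(1)] NE[OF mn(2)] by blast
    have c: "s \<in> carrier R" "t \<in> carrier R" using * rees_closed by auto
    have r: "rees I z (d + e) (s \<otimes> z [^] e)" "rees I z (d + e) (t \<otimes> z [^] d)"
      using rees_shift_pow[OF *(1), of e] rees_shift_pow[OF *(3), of d] by (simp_all add: add.commute)
    have "m \<oplus> n = (s \<otimes> z [^] e \<oplus> t \<otimes> z [^] d) \<otimes> w [^] (d + e)"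
      unfolding *(2,4) lift[OF c(1), of d e] lift[OF c(2), of e d] add.commute[of e d]
      by (rule l_distr[symmetric]) (use c z w in auto)
    then show ?thesis using NI[OF rees_add[OF r]] by simp
  qed
  have Nmult: "m \<otimes> n \<in> N" if mn: "m \<in> N" "n \<in> N" for m n
  proof -
    obtain s d t e where *: "rees I z d s" "m = s \<otimes> w [^] d" "rees I z e t" "n = t \<otimes> w [^] e"
      using NE[OF mn(1)] NE[OF mn(2)] by blast
    have c: "s \<in> carrier R" "t \<in> carrier R" using * rees_closed by auto
    have "m \<otimes> n = (s \<otimes> t) \<otimes> (w [^] d \<otimes> w [^] e)"
      unfolding *(2,4) using c w(1) by (simp add: m_ac)
    then show ?thesis using NI[OF rees_mult[OF *(1,3)]] w(1) by (simp add: nat_pow_mult)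
  qed
  have Nsm: "a \<otimes> n \<in> N" if an: "a \<in> A" "n \<in> N" for a n
  proof -
    obtain t e where *: "rees I z e t" "n = t \<otimes> w [^] e" using NE[OF an(2)] by blast
    have c: "a \<in> carrier R" "t \<in> carrier R" using * rees_closed an(1) subringE(1)[OF A] by auto
    show ?thesis using NI[OF rees_smult[OF *(1) an(1)]] c w(1) *(2) by (simp add: m_assoc)
  qed
  have N1: "\<one> \<notin> N"
  proof
    assume "\<one> \<in> N"
    then obtain t d where *: "rees I z d t" "\<one> = t \<otimes> w [^] d" using NE by blast
    have tc: "t \<in> carrier R" using rees_closed[OF *(1)] .
    have "z [^] d = z [^] d \<otimes> (t \<otimes> w [^] d)" using *(2)[symmetric] z by simp
    also have "\<dots> = t \<otimes> (z [^] d \<otimes> w [^] d)" using tc z w(1) by (simp add: m_lcomm)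
    also have "\<dots> = t" using zw tc by simp
    finally show False using no[of d] *(1) by simp
  qed
  have Ac: "a \<in> carrier R" if "a \<in> A" for a using that subringE(1)[OF A] by blast
  define S where "S = {a \<oplus> n | a n. a \<in> A \<and> n \<in> N}"
  have SI: "a \<oplus> n \<in> S" if "a \<in> A" "n \<in> N" for a n using that unfolding S_def by blast
  have SE: "\<exists>a n. a \<in> A \<and> n \<in> N \<and> h = a \<oplus> n" if "h \<in> S" for h using that unfolding S_def by blast
  have AS: "a \<in> S" if "a \<in> A" for a using SI[OF that N0] Ac[OF that] by simp
  have NS: "n \<in> S" if "n \<in> N" for n using SI[OF subringE(2)[OF A] that] Nc[OF that] by simp
  have SN: "h \<otimes> n \<in> N" if hn: "h \<in> S" "n \<in> N" for h n
  proof -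
    obtain a m where *: "a \<in> A" "m \<in> N" "h = a \<oplus> m" using SE[OF hn(1)] by blast
    have "h \<otimes> n = a \<otimes> n \<oplus> m \<otimes> n" unfolding *(3) using * Ac Nc hn(2) by (simp add: l_distr)
    then show ?thesis using Nadd[OF Nsm[OF *(1) hn(2)] Nmult[OF *(2) hn(2)]] by simp
  qed
  have S: "subring S R"
  proof (rule subringI)
    show Sc: "S \<subseteq> carrier R" unfolding S_def using Ac Nc by auto
    show "\<one> \<in> S" using AS subringE(3)[OF A] .
    show "h \<oplus> k \<in> S" if hk: "h \<in> S" "k \<in> S" for h k
    proof -
      obtain a m b n where *: "a \<in> A" "m \<in> N" "h = a \<oplus> m" "b \<in> A" "n \<in> N" "k = b \<oplus> n"
        using SE[OF hk(1)] SE[OF hk(2)] by blast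
      have "h \<oplus> k = (a \<oplus> b) \<oplus> (m \<oplus> n)" unfolding *(3,6) using * Ac Nc by (simp add: a_ac)
      then show ?thesis using SI[OF subringE(7)[OF A *(1,4)] Nadd[OF *(2,5)]] by simp
    qed
    then have addS: "h \<oplus> k \<in> S" if "h \<in> S" "k \<in> S" for h k using that by blast
    have sm: "a \<otimes> h \<in> S" if ah: "a \<in> A" "h \<in> S" for a h
    proof -
      obtain b n where *: "b \<in> A" "n \<in> N" "h = b \<oplus> n" using SE[OF ah(2)] by blast
      have "a \<otimes> h = a \<otimes> b \<oplus> a \<otimes> n" unfolding *(3) using * ah(1) Ac Nc by (simp add: r_distr)
      then show ?thesis using SI[OF subringE(6)[OF A ah(1) *(1)] Nsm[OF ah(1) *(2)]] by simp
    qed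
    show "\<ominus> h \<in> S" if "h \<in> S" for h
    proof -
      have "\<ominus> \<one> \<otimes> h \<in> S" using sm[OF subringE(5)[OF A subringE(3)[OF A]] that] .
      then show ?thesis using that Sc by (simp add: l_minus subset_iff)
    qed
    show "h \<otimes> k \<in> S" if hk: "h \<in> S" "k \<in> S" for h k
    proof -
      obtain a m where *: "a \<in> A" "m \<in> N" "h = a \<oplus> m" using SE[OF hk(1)] by blast
      have kc: "k \<in> carrier R" using hk(2) Sc by blast
      have "h \<otimes> k = a \<otimes> k \<oplus> k \<otimes> m" unfolding *(3) using * Ac Nc kc by (simp add: l_distr m_comm[of m k])
      then show ?thesis using addS[OF sm[OF *(1) hk(2)] NS[OF SN[OF hk(2) *(2)]]] by simp
    qed
  qed
  have "submod S N" unfolding submod_def using Nc N0 Nadd SN by blast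
  then have "ring_ideal_pair S N" unfolding ring_ideal_pair_def using S NS N1 by blast
  then obtain V M where V: "valuation_ring V" "ring_ideal_pair V M" "S \<subseteq> V" "N \<subseteq> M"
    using dominating_valuation_ring by metis
  have M: "submod V M" "\<one> \<notin> M" using V(2) unfolding ring_ideal_pair_def by blast+
  have "z \<noteq> a \<otimes> y" if ay: "a \<in> V" "y \<in> I" for a y
  proof
    assume eq: "z = a \<otimes> y"
    have c: "a \<in> carrier R" "y \<in> carrier R"
      using ay V(1) subringE(1) submodD(5)[OF I] unfolding valuation_ring_def by blast+
    have "y \<otimes> w [^] (1::nat) \<in> M" using NI[OF rees_gen[OF ay(2)]] V(4) by blast
    then have "a \<otimes> (y \<otimes> w) \<in> M" using submodD(4)[OF M(1) ay(1)] w(1) by simp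
    then have "z \<otimes> w \<in> M" unfolding eq using c w(1) by (simp add: m_assoc)
    then show False using w(3) M(2) by simp
  qed
  then show ?thesis using that[OF V(1)] V(3) AS by blast
qed

end

end

subsection \<open>The integral closure as an intersection of valuation rings\<close>

context field
begin

lemma rees_unit_polys:
  assumes A: "subring A R" and z: "z \<in> carrier R" and r: "rees A z d t"
  shows "\<exists>i. d = Suc i \<and> t \<in> polys A z i"
proof -
  note S = submod_self[OF A]
  note P = submodD[OF polys_submod[OF A S z]]
  show ?thesis
    using r
  proof (induction rule: rees.induct)
    case (rees_gen y)
    then show ?case by auto
  next
    case (rees_add d s t)
    then show ?case using P(3) by auto
  next
    case (rees_mult d s e t)
    then obtain i j where *: "d = Suc i" "s \<in> polys A z i" "e = Suc j" "t \<in> polys A z j" by blast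
    have "s \<otimes> t \<in> polys A z (Suc (i + j))"
      using polys_mult[OF A S z *(2,4)] polys_Suc_mono[OF A S z] by blast
    then show ?case using * by (intro exI[of _ "Suc (i + j)"]) simp
  next
    case (rees_shift d s)
    then obtain i where *: "d = Suc i" "s \<in> polys A z i" by blast
    have "z [^] (1::nat) \<otimes> s \<in> polys A z (1 + i)" using polys_shift[OF A S z *(2)] .
    then have "s \<otimes> z \<in> polys A z (Suc i)" using P(5)[OF *(2)] z by (simp add: m_comm del: polys.simps)
    then show ?case using * by blast
  qed
qed

text \<open>
  The list \<open>cs\<close> has full length \<open>Suc n\<close>, possibly with leading zeros, so that prefixing \<open>\<one>\<close>
  yields a monic polynomial of degree \<open>Suc n\<close>.
\<close>

lemma polys_eval:
  assumes "t \<in> polys A z n"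
  shows "\<exists>cs. length cs = Suc n \<and> set cs \<subseteq> A \<and> (A \<subseteq> carrier R \<longrightarrow> z \<in> carrier R \<longrightarrow> eval cs z = t)"
  using assms
proof (induction n arbitrary: t)
  case 0
  then show ?case by (intro exI[of _ "[t]"]) auto
next
  case (Suc n)
  then obtain s m where *: "s \<in> polys A z n" "m \<in> A" "t = s \<oplus> m \<otimes> z [^] Suc n"
    by (elim polys_SucE)
  obtain cs where cs: "length cs = Suc n" "set cs \<subseteq> A"
    "A \<subseteq> carrier R \<longrightarrow> z \<in> carrier R \<longrightarrow> eval cs z = s"
    using Suc.IH[OF *(1)] by blast
  have "eval (m # cs) z = t" if "A \<subseteq> carrier R" "z \<in> carrier R"
  proof -
    have "eval cs z \<in> carrier R" using that cs(2) by (intro eval_in_carrier) auto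
    then show ?thesis using that cs * a_comm by (auto simp del: nat_pow_Suc)
  qed
  then show ?case using cs * by (intro exI[of _ "m # cs"]) auto
qed

lemma rees_integral:
  assumes A: "subring A R" and z: "z \<in> carrier R" and r: "rees A z d (z [^] d)"
  shows "z \<in> integral_closure R A"
proof -
  obtain i where i: "d = Suc i" "z [^] d \<in> polys A z i" using rees_unit_polys[OF assms] by blast
  have Ac: "A \<subseteq> carrier R" using subringE(1)[OF A] .
  have "\<ominus> (z [^] d) \<in> polys A z i"
    using submod_minus[OF A polys_submod[OF A submod_self[OF A] z] i(2)] .
  then obtain cs where "length cs = Suc i" and cs: "set cs \<subseteq> A" "eval cs z = \<ominus> (z [^] d)"
    using polys_eval[of "\<ominus> (z [^] d)" A z i] Ac z by blast
  then have "length cs = d" using i(1) by simp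
  note cs = this cs
  have "eval (\<one> # cs) z = \<zero>" using cs z by (simp add: r_neg)
  moreover have "polynomial\<^bsub>R\<^esub> A (\<one> # cs)"
    using cs(2) subringE(3)[OF A] by (simp add: polynomial_def)
  ultimately show ?thesis unfolding integral_closure_def
    using z by (intro CollectI conjI exI[of _ "\<one> # cs"]) auto
qed

text \<open>
  If $w = z^{-1} \in V$, then dividing a monic equation of degree $n$ by $z^{n-1}$ expresses $z$
  as a polynomial in $w$ over \<open>V\<close>.
\<close>

lemma valuation_ring_integrally_closed:
  assumes V: "valuation_ring V" and AV: "A \<subseteq> V" and z: "z \<in> integral_closure R A"
  shows "z \<in> V"
proof (rule ccontr)
  assume zV: "z \<notin> V"
  have sV: "subring V R" using V by (simp add: valuation_ring_def)
  obtain f where f: "z \<in> carrier R" "polynomial\<^bsub>R\<^esub> A f" "f \<noteq> []" "lead_coeff f = \<one>" "eval f z = \<zero>"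
    using z unfolding integral_closure_def by blast
  then obtain cs where cs: "f = \<one> # cs" by (cases f) auto
  have csA: "set cs \<subseteq> V" using f(2) cs AV by (auto simp: polynomial_def)
  have Vc: "v \<in> carrier R" if "v \<in> V" for v using that subringE(1)[OF sV] by blast
  have "z \<noteq> \<zero>" using zV subringE(2)[OF sV] by auto
  then have zU: "z \<in> Units R" using f(1) field_Units by blast
  define w where "w = inv z"
  have w: "w \<in> carrier R" "z \<otimes> w = \<one>" using zU by (simp_all add: w_def)
  have wV: "w \<in> V" using V zV f(1) w unfolding valuation_ring_def by blast
  have wpV: "w [^] k \<in> V" for k :: nat using wV subringE(3,6)[OF sV] by (induction k) auto
  have cancel: "w [^] (k + l) \<otimes> z [^] l = w [^] k" for k l :: nat
  proof -
    have "w [^] l \<otimes> z [^] l = (w \<otimes> z) [^] l" by (rule nat_pow_distrib[OF w(1) f(1), symmetric])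
    then have "w [^] l \<otimes> z [^] l = \<one>" using w f(1) by (simp add: m_comm)
    then show ?thesis using w(1) f(1) by (simp add: nat_pow_mult[symmetric] m_assoc)
  qed
  have claim: "w [^] j \<otimes> eval ds z \<in> V" if "set ds \<subseteq> V" "length ds \<le> Suc j" for ds and j :: nat
    using that
  proof (induction ds)
    case Nil
    then show ?case using w(1) subringE(2)[OF sV] by simp
  next
    case (Cons c ds)
    have cV: "c \<in> V" and dsV: "set ds \<subseteq> V" and len: "length ds \<le> j" using Cons.prems by auto
    have ec: "eval ds z \<in> carrier R" using dsV f(1) Vc by (intro eval_in_carrier) auto
    have "w [^] j \<otimes> z [^] length ds = w [^] (j - length ds)"
      using cancel[of "j - length ds" "length ds"] len by simp
    moreover have "w [^] j \<otimes> eval (c # ds) z =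
        c \<otimes> (w [^] j \<otimes> z [^] length ds) \<oplus> w [^] j \<otimes> eval ds z"
      using ec w(1) f(1) Vc[OF cV] by (simp add: r_distr m_lcomm)
    ultimately show ?case
      using Cons.IH[OF dsV] len subringE(6)[OF sV cV wpV] subringE(7)[OF sV] by simp
  qed
  have e0: "z [^] length cs \<oplus> eval cs z = \<zero>" using f(5,1) cs by simp
  have csne: "cs \<noteq> []" using e0 by auto
  then obtain l where l: "length cs = Suc l" by (cases cs) auto
  have ec: "eval cs z \<in> carrier R" using csA f(1) Vc by (intro eval_in_carrier) auto
  have "w [^] l \<otimes> z [^] Suc l = (w [^] (0 + l) \<otimes> z [^] l) \<otimes> z"
    using w(1) f(1) by (simp add: m_assoc)
  also have "\<dots> = z" using cancel[of 0 l] f(1) by simp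
  finally have "z \<oplus> w [^] l \<otimes> eval cs z = w [^] l \<otimes> (z [^] Suc l \<oplus> eval cs z)"
    using w(1) f(1) ec by (simp add: r_distr del: nat_pow_Suc)
  then have "z \<oplus> w [^] l \<otimes> eval cs z = \<zero>" using e0 l w(1) by simp
  then have "z = \<ominus> (w [^] l \<otimes> eval cs z)" using f(1) w(1) ec minus_equality[of z] by simp
  moreover have "w [^] l \<otimes> eval cs z \<in> V" using claim[OF csA, of l] l by simp
  ultimately show False using zV subringE(5)[OF sV, of "w [^] l \<otimes> eval cs z"] by metis
qed

text \<open>
  An intersection of subrings is a subring. This is how sums and products of integral elements are
  seen to be integral.
\<close>

lemma integral_closure_eq_valuation_rings:
  assumes A: "subring A R"
  shows "integral_closure R A = {z \<in> carrier R. \<forall>V. valuation_ring V \<and> A \<subseteq> V \<longrightarrow> z \<in> V}"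
proof (intro equalityI subsetI)
  fix z assume z: "z \<in> integral_closure R A"
  then show "z \<in> {z \<in> carrier R. \<forall>V. valuation_ring V \<and> A \<subseteq> V \<longrightarrow> z \<in> V}"
    using valuation_ring_integrally_closed[OF _ _ z] by (auto simp: integral_closure_def)
next
  fix z assume "z \<in> {z \<in> carrier R. \<forall>V. valuation_ring V \<and> A \<subseteq> V \<longrightarrow> z \<in> V}"
  then have z: "z \<in> carrier R" "\<And>V. valuation_ring V \<Longrightarrow> A \<subseteq> V \<Longrightarrow> z \<in> V" by auto
  have "\<exists>d. rees A z d (z [^] d)"
  proof (cases "z = \<zero>")
    case True
    then have "rees A z 1 (z [^] (1::nat))"
      using rees_gen[of \<zero> A z] subringE(2)[OF A] by simp
    then show ?thesis by blast
  next
    case False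
    show ?thesis
    proof (rule ccontr)
      assume "\<not> ?thesis"
      then obtain V where V: "valuation_ring V" "A \<subseteq> V" "\<And>a y. a \<in> V \<Longrightarrow> y \<in> A \<Longrightarrow> z \<noteq> a \<otimes> y"
        using valuative_criterion[OF A submod_self[OF A] z(1) False] by blast
      then show False using z V(3)[of z \<one>] subringE(3)[OF A] by simp
    qed
  qed
  then show "z \<in> integral_closure R A" using rees_integral[OF A z(1)] by blast
qed

lemma integral_closure_subring:
  assumes A: "subring A R"
  shows "subring (integral_closure R A) R"
  unfolding integral_closure_eq_valuation_rings[OF A]
  by (rule subringI) (auto simp: valuation_ring_def intro: subringE)

lemma subset_integral_closure:
  assumes A: "subring A R"
  shows "A \<subseteq> integral_closure R A"
  unfolding integral_closure_eq_valuation_rings[OF A] using subringE(1)[OF A] by auto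

end

lemma (in algebraically_closed) integral_root_exists:
  assumes A: "subring A L" and x: "x \<in> A" and n: "0 < n"
  shows "\<exists>z\<in>integral_closure L A. z [^] (n::nat) = x"
proof -
  have Ac: "A \<subseteq> carrier L" using subringE(1)[OF A] .
  define f where "f = \<one> # (replicate (n - 1) \<zero> @ [\<ominus> x])"
  have fA: "polynomial\<^bsub>L\<^esub> A f"
    using subringE(2)[OF A] subringE(3)[OF A] subringE(5)[OF A x] unfolding f_def polynomial_def
    by (auto split: if_splits)
  have "polynomial\<^bsub>L\<^esub> (carrier L) f" using fA Ac unfolding polynomial_def by blast
  then have fL: "f \<in> carrier (poly_ring L)" using univ_poly_carrier by blast
  have len: "length f = Suc n" using n by (simp add: f_def)
  have "size (roots f) = n" using roots_over_carrier[OF fL] len by (simp add: splitted_def)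
  then obtain z where "z \<in># roots f" using n by (metis gr0_conv_Suc size_eq_Suc_imp_elem)
  then have "is_root f z" using roots_mem_iff_is_root[OF fL] by simp
  then have z: "z \<in> carrier L" "eval f z = \<zero>" by (auto simp: is_root_def)
  have "eval (replicate k \<zero> @ [c]) z = c" if "c \<in> carrier L" for k c
    using that z(1) by (induction k) auto
  then have "eval f z = z [^] n \<oplus> \<ominus> x" using z(1) x Ac n by (auto simp: f_def subset_iff)
  then have "z [^] n = x" using z x Ac minus_equality[of "z [^] n" "\<ominus> x"] by (auto simp: subset_iff)
  moreover have "z \<in> integral_closure L A"
    unfolding integral_closure_def using z fA by (intro CollectI conjI exI[of _ f]) (auto simp: f_def)
  ultimately show ?thesis by blast
qed

section \<open>The valuation of a valuation ring\<close>

text \<open>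
  The value group is the multiplicative group of the field modulo the units of \<open>V\<close>, ordered by
  divisibility. Its elements are cosets, so it is a group on sets of field elements.
\<close>

lemma (in field) valuation_of_valuation_ring:
  assumes V: "valuation_ring V"
  obtains \<Gamma> :: "'a set monoid" and r v where "valuation R \<Gamma> r v"
    "\<And>x y. x \<in> carrier R \<Longrightarrow> y \<in> carrier R \<Longrightarrow> val_le r (v x) (v y) \<longleftrightarrow> (\<exists>a\<in>V. y = a \<otimes> x)"
proof -
  have sV: "subring V R" using V by (simp add: valuation_ring_def)
  have Vc: "v \<in> carrier R" if "v \<in> V" for v using that subringE(1)[OF sV] by blast
  define G where "G = units_of R"
  have G: "carrier G = carrier R - {\<zero>}" "monoid.mult G = monoid.mult R" "one G = \<one>" by (simp_all add: G_def units_of_def field_Units)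
  interpret G: comm_group G
    unfolding G_def by (rule units_comm_group)
  have Ginv: "\<exists>y\<in>carrier G. x \<otimes> y = \<one>" if "x \<in> carrier G" for x
    using G.Units_r_inv_ex[of x] that G by simp
  define U where "U = {u \<in> carrier G. u \<in> V \<and> (\<exists>w\<in>V. u \<otimes> w = \<one>)}"
  have UV: "u \<in> V" "u \<in> carrier R" "u \<noteq> \<zero>" if "u \<in> U" for u using that by (auto simp: U_def G)
  have U: "subgroup U G"
  proof (rule G.subgroupI)
    show "U \<subseteq> carrier G" by (auto simp: U_def)
    have "\<one> \<in> U" using subringE(3)[OF sV] by (auto simp: U_def G intro!: bexI[of _ \<one>])
    then show "U \<noteq> {}" by blast
    show "inv\<^bsub>G\<^esub> u \<in> U" if u: "u \<in> U" for u
    proof -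
      obtain w where w: "w \<in> V" "u \<otimes> w = \<one>" using u by (auto simp: U_def)
      have "w \<noteq> \<zero>" using w(2) UV[OF u] by auto
      then have wG: "w \<in> carrier G" using w(1) Vc by (auto simp: G)
      have "inv\<^bsub>G\<^esub> u = w"
        using G.inv_equality[of w u] w(2) wG u UV[OF u] by (simp add: U_def G m_comm)
      moreover have "w \<in> U" using w wG UV[OF u] by (auto simp: U_def G m_comm intro!: bexI[of _ u])
      ultimately show ?thesis by simp
    qed
    show "a \<otimes>\<^bsub>G\<^esub> b \<in> U" if ab: "a \<in> U" "b \<in> U" for a b
    proof -
      obtain w w' where w: "w \<in> V" "a \<otimes> w = \<one>" "w' \<in> V" "b \<otimes> w' = \<one>" using ab by (auto simp: U_def)
      have c: "a \<in> carrier R" "b \<in> carrier R" "w \<in> carrier R" "w' \<in> carrier R"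
        using w Vc UV[OF ab(1)] UV[OF ab(2)] by auto
      have "(a \<otimes> b) \<otimes> (w \<otimes> w') = (a \<otimes> w) \<otimes> (b \<otimes> w')" using c by (simp add: m_ac)
      then have "(a \<otimes> b) \<otimes> (w \<otimes> w') = \<one>" using w by simp
      moreover have "w \<otimes> w' \<in> V" "a \<otimes> b \<in> V" using subringE(6)[OF sV] w UV[OF ab(1)] UV[OF ab(2)] by auto
      ultimately show ?thesis using c UV[OF ab(1)] UV[OF ab(2)] by (auto simp: U_def G integral_iff)
    qed
  qed
  interpret N: normal U G using G.subgroup_imp_normal[OF U] .
  define \<Gamma> where "\<Gamma> = G Mod U"
  define c where "c x = U #>\<^bsub>G\<^esub> x" for x
  have car: "carrier \<Gamma> = c ` carrier G" by (auto simp: \<Gamma>_def FactGroup_def RCOSETS_def c_def)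
  have cmult: "c x \<otimes>\<^bsub>\<Gamma>\<^esub> c y = c (x \<otimes> y)" if "x \<in> carrier G" "y \<in> carrier G" for x y
    using N.rcos_sum[OF that] by (simp add: \<Gamma>_def FactGroup_def c_def G)
  have cmem: "\<exists>u\<in>U. x = u \<otimes> y" if "x \<in> carrier G" "c x = c y" for x y
  proof -
    have "x \<in> c y" using G.rcos_self[OF that(1) U] that(2) by (simp add: c_def)
    then show ?thesis by (auto simp: c_def r_coset_def G)
  qed
  define le where "le x y \<longleftrightarrow> (\<exists>a\<in>V. y = a \<otimes> x)" for x y
  define r where "r = {(c x, c y) | x y. x \<in> carrier G \<and> y \<in> carrier G \<and> le x y}"
  have rle: "(c x, c y) \<in> r \<longleftrightarrow> le x y" if xy: "x \<in> carrier G" "y \<in> carrier G" for x y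
  proof
    assume "(c x, c y) \<in> r"
    then obtain x' y' a where *: "c x = c x'" "c y = c y'" "x' \<in> carrier G" "y' \<in> carrier G"
      "a \<in> V" "y' = a \<otimes> x'" by (auto simp: r_def le_def)
    obtain u u' where u: "u \<in> U" "x' = u \<otimes> x" "u' \<in> U" "y = u' \<otimes> y'"
      using cmem[OF *(3), of x] cmem[OF xy(2), of y'] * by auto
    have "y = (u' \<otimes> (a \<otimes> u)) \<otimes> x"
      unfolding u(4) *(6) u(2) using xy Vc[OF *(5)] UV[OF u(1)] UV[OF u(3)] by (simp add: m_assoc G)
    moreover have "u' \<otimes> (a \<otimes> u) \<in> V" using subringE(6)[OF sV] *(5) UV[OF u(1)] UV[OF u(3)] by blast
    ultimately show "le x y" unfolding le_def by blast
  qed (use xy in \<open>auto simp: r_def\<close>)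
  have le_refl: "le x x" if "x \<in> carrier R" for x
    using that subringE(3)[OF sV] by (auto simp: le_def intro!: bexI[of _ \<one>])
  have le_trans: "le x z" if xyz: "le x y" "le y z" "x \<in> carrier R" for x y z
  proof -
    obtain a b where ab: "a \<in> V" "y = a \<otimes> x" "b \<in> V" "z = b \<otimes> y" using xyz(1,2) by (auto simp: le_def)
    have "z = (b \<otimes> a) \<otimes> x" unfolding ab(4) ab(2) using ab xyz(3) Vc by (simp add: m_assoc)
    then show ?thesis using subringE(6)[OF sV ab(3,1)] by (auto simp: le_def)
  qed
  have le_total: "le x y \<or> le y x" if xy: "x \<in> carrier R" "y \<in> carrier R" for x y
  proof (cases "x = \<zero> \<or> y = \<zero>")
    case True
    then show ?thesis using xy subringE(2)[OF sV] by (auto simp: le_def intro!: bexI[of _ \<zero>])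
  next
    case False
    then have "x \<in> carrier G" "y \<in> carrier G" using xy by (auto simp: G)
    then obtain x' y' where i: "x' \<in> carrier G" "x \<otimes> x' = \<one>" "y' \<in> carrier G" "y \<otimes> y' = \<one>"
      using Ginv by blast
    have ic: "x' \<in> carrier R" "y' \<in> carrier R" using i by (auto simp: G)
    have "(y \<otimes> x') \<otimes> (x \<otimes> y') = (x \<otimes> x') \<otimes> (y \<otimes> y')" using xy ic by (simp add: m_ac)
    then have "(y \<otimes> x') \<otimes> (x \<otimes> y') = \<one>" using i by simp
    then have "y \<otimes> x' \<in> V \<or> x \<otimes> y' \<in> V" using V xy ic unfolding valuation_ring_def by simp
    moreover have "(y \<otimes> x') \<otimes> x = y \<otimes> (x \<otimes> x')" "(x \<otimes> y') \<otimes> y = x \<otimes> (y \<otimes> y')"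
      using xy ic by (simp_all add: m_ac)
    then have "(y \<otimes> x') \<otimes> x = y" "(x \<otimes> y') \<otimes> y = x" using i xy by simp_all
    ultimately show ?thesis unfolding le_def by metis
  qed
  have GR: "x \<in> carrier R" if "x \<in> carrier G" for x using that by (simp add: G)
  have lin: "linear_order_on (carrier \<Gamma>) r"
  proof -
    have sub: "r \<subseteq> carrier \<Gamma> \<times> carrier \<Gamma>" by (auto simp: r_def car)
    moreover have "refl_on (carrier \<Gamma>) r"
      by (rule refl_onI) (auto simp: car rle le_refl GR)
    moreover have "trans r"
    proof (rule transI)
      fix p q s assume pq: "(p, q) \<in> r" "(q, s) \<in> r"
      then have "p \<in> carrier \<Gamma>" "q \<in> carrier \<Gamma>" "s \<in> carrier \<Gamma>" using sub by auto
      then obtain x y z where *: "x \<in> carrier G" "y \<in> carrier G" "z \<in> carrier G" "p = c x" "q = c y" "s = c z"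
        unfolding car by blast
      then show "(p, s) \<in> r" using pq le_trans[of x y z] GR by (simp add: rle)
    qed
    moreover have "antisym r"
    proof (rule antisymI)
      fix p q assume pq: "(p, q) \<in> r" "(q, p) \<in> r"
      then have "p \<in> carrier \<Gamma>" "q \<in> carrier \<Gamma>" using sub by auto
      then obtain x y where *: "x \<in> carrier G" "y \<in> carrier G" "p = c x" "q = c y"
        unfolding car by blast
      then obtain a b where ab: "a \<in> V" "y = a \<otimes> x" "b \<in> V" "x = b \<otimes> y"
        using pq by (auto simp: rle le_def)
      have ac: "a \<in> carrier R" "b \<in> carrier R" using ab Vc by auto
      have "(b \<otimes> a) \<otimes> x = b \<otimes> y" unfolding ab(2) using ac *(1) by (simp add: m_assoc G)
      then have "(b \<otimes> a) \<otimes> x = \<one> \<otimes> x" using ab(4) *(1) by (simp add: G)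
      then have "b \<otimes> a = \<one>" using m_rcancel[of x "b \<otimes> a" \<one>] ac *(1) by (simp add: G)
      then have "a \<otimes> b = \<one>" using ac by (simp add: m_comm)
      then have "a \<in> U" using ab ac by (auto simp: U_def G)
      then have "y \<in> U #>\<^bsub>G\<^esub> x" unfolding ab(2) r_coset_def by (auto simp: G)
      then show "p = q" using G.repr_independence[OF _ *(1) U] *(3,4) by (simp add: c_def)
    qed
    moreover have "total_on (carrier \<Gamma>) r"
      unfolding total_on_def using le_total GR by (auto simp: car rle)
    ultimately show ?thesis unfolding order_on_defs by simp
  qed
  have og: "ordered_abelian_group \<Gamma> r"
  proof (intro ordered_abelian_group.intro ordered_abelian_group_axioms.intro)
    show "comm_group \<Gamma>" unfolding \<Gamma>_def using G.abelian_FactGroup[OF U] .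
    show "linear_order_on (carrier \<Gamma>) r" by (rule lin)
    fix p q s assume pq: "(p, q) \<in> r" and s: "s \<in> carrier \<Gamma>"
    obtain x y z where *: "x \<in> carrier G" "y \<in> carrier G" "z \<in> carrier G" "p = c x" "q = c y" "s = c z" "le x y"
      using pq s by (auto simp: r_def car)
    then obtain a where a: "a \<in> V" "y = a \<otimes> x" by (auto simp: le_def)
    have "y \<otimes> z = a \<otimes> (x \<otimes> z)" unfolding a(2) using Vc[OF a(1)] * GR by (simp add: m_assoc)
    then have "le (x \<otimes> z) (y \<otimes> z)" using a(1) by (auto simp: le_def)
    then show "(p \<otimes>\<^bsub>\<Gamma>\<^esub> s, q \<otimes>\<^bsub>\<Gamma>\<^esub> s) \<in> r"
      using * cmult rle G.m_closed[of _ z] by (simp add: G)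
  qed
  define v where "v x = (if x = \<zero> then None else Some (c x))" for x
  have vle: "val_le r (v x) (v y) \<longleftrightarrow> le x y" if xy: "x \<in> carrier R" "y \<in> carrier R" for x y
  proof (cases "x = \<zero> \<or> y = \<zero>")
    case True
    then show ?thesis
      using xy subringE(2)[OF sV] Vc by (auto simp: v_def val_le_def le_def intro!: bexI[of _ \<zero>])
  next
    case False
    then show ?thesis using rle[of x y] xy by (auto simp: v_def val_le_def G)
  qed
  have "valuation R \<Gamma> r v"
  proof (intro valuation.intro valuation_axioms.intro)
    show "field R" by (rule field_axioms)
    show "ordered_abelian_group \<Gamma> r" by (rule og)
    show "v \<zero> = None" by (simp add: v_def)
    fix x y assume x: "x \<in> carrier R"
    show "v x \<in> Some ` carrier \<Gamma>" if "x \<noteq> \<zero>" using that x by (auto simp: v_def car G)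
    assume y: "y \<in> carrier R"
    show "v (x \<otimes> y) = val_mult \<Gamma> (v x) (v y)"
      using x y cmult[of x y] by (auto simp: v_def val_mult_def integral_iff G)
    have sum: "le x (x \<oplus> y)" if xy: "x \<in> carrier R" "y \<in> carrier R" "le x y" for x y
    proof -
      obtain a where a: "a \<in> V" "y = a \<otimes> x" using xy(3) by (auto simp: le_def)
      have "x \<oplus> y = (\<one> \<oplus> a) \<otimes> x" unfolding a(2) using xy(1) Vc[OF a(1)] by (simp add: l_distr)
      then show ?thesis using subringE(7)[OF sV subringE(3)[OF sV] a(1)] unfolding le_def by blast
    qed
    show "val_le r (v x) (v (x \<oplus> y)) \<or> val_le r (v y) (v (x \<oplus> y))"
      using le_total[OF x y] sum[OF x y] sum[OF y x] x y by (auto simp: vle a_comm)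
  qed
  then show thesis using that vle unfolding le_def by blast
qed

section \<open>Rational powers\<close>

subsection \<open>From valuations to powers of ideals\<close>

lemma (in cring) lprod_in_ipow:
  assumes Q: "ideal Q R" and xs: "set xs \<subseteq> Q"
  shows "lprod xs \<in> ipow Q (length xs)"
  using xs
proof (induction xs)
  case (Cons x xs)
  then have "x \<otimes> lprod xs \<in> ipow Q 1 \<cdot> ipow Q (length xs)"
    using ipow_1[OF Q] by (auto intro: ideal_prod.prod)
  then show ?case using ipow_add[OF Q, of 1 "length xs"] by simp
qed (simp add: ipow_0)

text \<open>
  Write $Q = (I, z)$. The hypothesis says that $Q^{D+1} = I Q^D$, because every monomial of degree
  $D + 1$ other than $z^{D+1}$ contains a factor from \<open>I\<close>. By iteration $Q^{k+D} \subseteq I^k Q^D$.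
\<close>

lemma (in cring) ipow_of_reduction:
  assumes I: "ideal I R" and z: "z \<in> carrier R"
    and zd: "z [^] Suc D \<in> I \<cdot> ipow (Idl (insert z I)) D"
  shows "z [^] (k + D) \<in> ipow I k"
proof -
  define Q where "Q = Idl (insert z I)"
  have gen: "insert z I \<subseteq> carrier R" using z idealD(1)[OF I] by blast
  have Q: "ideal Q R" unfolding Q_def by (rule genideal_ideal[OF gen])
  have IQ: "insert z I \<subseteq> Q" unfolding Q_def by (rule genideal_self[OF gen])
  note Qn = ipow_ideal[OF Q] and In = ipow_ideal[OF I]
  define H where "H = I \<cdot> ipow Q D"
  have H: "ideal H R" unfolding H_def by (rule ideal_prod_is_ideal[OF I Qn])
  have mono: "lprod xs = z [^] n \<or> (\<exists>m. n = Suc m \<and> lprod xs \<in> I \<cdot> ipow Q m)"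
    if "length xs = n" "set xs \<subseteq> insert z I" for xs n
    using that
  proof (induction xs arbitrary: n)
    case (Cons x xs)
    obtain m where n: "n = Suc m" "length xs = m" using Cons.prems by (cases n) auto
    have xs: "set xs \<subseteq> insert z I" "x \<in> insert z I" using Cons.prems by auto
    have lc: "lprod xs \<in> carrier R" using xs gen by (intro lprod_closed) blast
    have lQ: "lprod xs \<in> ipow Q m" using lprod_in_ipow[OF Q, of xs] xs IQ n by auto
    show ?case
    proof (cases "x \<in> I")
      case True
      then show ?thesis using lQ n by (auto intro: ideal_prod.prod)
    next
      case False
      then have x: "x = z" using xs by blast
      from Cons.IH[OF n(2) xs(1)] show ?thesis
      proof
        assume "lprod xs = z [^] m"
        then show ?thesis using x z n by (simp add: m_comm)
      next
        assume "\<exists>m'. m = Suc m' \<and> lprod xs \<in> I \<cdot> ipow Q m'"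
        then obtain m' where m': "m = Suc m'" "lprod xs \<in> I \<cdot> ipow Q m'" by blast
        have "lprod xs \<otimes> z \<in> (I \<cdot> ipow Q m') \<cdot> Q" using m'(2) IQ by (auto intro: ideal_prod.prod)
        also have "(I \<cdot> ipow Q m') \<cdot> Q = I \<cdot> ipow Q m"
          using ideal_prod_assoc[OF I Qn Q] m'(1) by (simp add: ipow_Suc)
        finally show ?thesis using x z lc n by (simp add: m_comm)
      qed
    qed
  qed simp
  have "ipow (Idl (insert z I)) (Suc D) \<subseteq> H"
  proof (rule ipow_genideal_subset[OF gen H])
    fix xs assume "length xs = Suc D" "set xs \<subseteq> insert z I"
    then show "lprod xs \<in> H" using mono[of xs "Suc D"] zd unfolding H_def Q_def by auto
  qed
  then have "ipow Q (Suc D) \<subseteq> H" by (simp add: Q_def)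
  then have step: "ipow Q D \<cdot> Q \<subseteq> I \<cdot> ipow Q D" by (simp add: ipow_Suc H_def)
  have "ipow Q (k + D) \<subseteq> ipow I k \<cdot> ipow Q D"
  proof (induction k)
    case 0
    have "carrier R \<cdot> ipow Q D = ipow Q D"
      using ideal_prod_commute[OF oneideal Qn] ideal_prod_one[OF Qn] by simp
    then show ?case by (simp add: ipow_0)
  next
    case (Suc k)
    have "ipow Q (Suc k + D) = ipow Q (k + D) \<cdot> Q" by (simp add: ipow_Suc)
    also have "\<dots> \<subseteq> (ipow I k \<cdot> ipow Q D) \<cdot> Q" by (intro ideal_prod_mono Suc order_refl)
    also have "\<dots> = ipow I k \<cdot> (ipow Q D \<cdot> Q)" by (rule ideal_prod_assoc[OF In Qn Q])
    also have "\<dots> \<subseteq> ipow I k \<cdot> (I \<cdot> ipow Q D)" by (intro ideal_prod_mono step order_refl)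
    also have "\<dots> = ipow I (Suc k) \<cdot> ipow Q D"
      using ideal_prod_assoc[OF In I Qn] by (simp add: ipow_Suc)
    finally show ?case .
  qed
  moreover have "z [^] (k + D) \<in> ipow Q (k + D)" using pow_in_ipow[OF Q] IQ by blast
  ultimately show ?thesis using ideal_prod_inter[OF In Qn] by blast
qed

lemma (in field) rees_in_ideal_prod:
  assumes A: "subring A R" and I: "ideal I (R\<lparr>carrier := A\<rparr>)" and z: "z \<in> A"
    and r: "rees I z d t"
  defines "S \<equiv> R\<lparr>carrier := A\<rparr>"
  shows "\<exists>i. d = Suc i \<and> t \<in> I \<cdot>\<^bsub>S\<^esub> cring.ipow S (Idl\<^bsub>S\<^esub> (insert z I)) i"
  using r
proof -
  interpret S: cring S unfolding S_def using A subcring_iff subcringI'[OF A] subringE(1)[OF A] by blast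
  have SI: "ideal I S" using I by (simp add: S_def)
  have ops: "x \<otimes>\<^bsub>S\<^esub> y = x \<otimes> y" "x \<oplus>\<^bsub>S\<^esub> y = x \<oplus> y" "carrier S = A" for x y by (simp_all add: S_def)
  define Q where "Q = Idl\<^bsub>S\<^esub> (insert z I)"
  have gen: "insert z I \<subseteq> carrier S" using z idealD(1)[OF SI] by (simp add: ops)
  have Q: "ideal Q S" unfolding Q_def by (rule S.genideal_ideal[OF gen])
  have IQ: "insert z I \<subseteq> Q" unfolding Q_def by (rule S.genideal_self[OF gen])
  note Qn = S.ipow_ideal[OF Q]
  define H where "H i = I \<cdot>\<^bsub>S\<^esub> S.ipow Q i" for i
  have H: "ideal (H i) S" for i unfolding H_def by (rule S.ideal_prod_is_ideal[OF SI Qn])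
  have HQ: "H i \<cdot>\<^bsub>S\<^esub> S.ipow Q j = H (i + j)" for i j
    unfolding H_def using S.ideal_prod_assoc[OF SI Qn Qn] S.ipow_add[OF Q] by simp
  have HsQ: "H i \<subseteq> S.ipow Q (Suc i)" for i
    unfolding H_def S.ipow_Suc S.ideal_prod_commute[OF SI Qn]
    using IQ by (intro S.ideal_prod_mono) auto
  have "\<exists>i. d = Suc i \<and> t \<in> H i"
    using r
  proof (induction rule: rees.induct)
    case (rees_gen y)
    have "y \<otimes>\<^bsub>S\<^esub> \<one>\<^bsub>S\<^esub> \<in> H 0" unfolding H_def using rees_gen
      by (intro ideal_prod.prod) (auto simp: S.ipow_0)
    then show ?case using rees_gen gen by auto
  next
    case (rees_add d s t)
    then show ?case using idealD(3)[OF H] ops(2) by auto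
  next
    case (rees_mult d s e t)
    then obtain i j where *: "d = Suc i" "s \<in> H i" "e = Suc j" "t \<in> H j" by blast
    then have "s \<otimes>\<^bsub>S\<^esub> t \<in> H i \<cdot>\<^bsub>S\<^esub> S.ipow Q (Suc j)" using HsQ by (blast intro: ideal_prod.prod)
    then show ?case using * HQ[of i "Suc j"] by (simp add: ops)
  next
    case (rees_shift d s)
    then obtain i where *: "d = Suc i" "s \<in> H i" by blast
    then have "s \<otimes>\<^bsub>S\<^esub> z \<in> H i \<cdot>\<^bsub>S\<^esub> S.ipow Q 1"
      using IQ S.ipow_1[OF Q] by (auto intro: ideal_prod.prod)
    then show ?case using * HQ[of i 1] by (simp add: ops)
  qed
  then show ?thesis by (simp add: H_def Q_def)
qed

lemma (in valuation) v_one: "v \<one>\<^bsub>K\<^esub> = Some \<one>\<^bsub>\<Gamma>\<^esub>"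
proof -
  obtain u where u: "v \<one>\<^bsub>K\<^esub> = Some u" "u \<in> carrier \<Gamma>" using val_nonzero[of "\<one>\<^bsub>K\<^esub>"] by auto
  have "u \<otimes>\<^bsub>\<Gamma>\<^esub> u = u" using val_times[of "\<one>\<^bsub>K\<^esub>" "\<one>\<^bsub>K\<^esub>"] u by (simp add: val_mult_def)
  then show ?thesis using u G.l_cancel_one by simp
qed

lemma (in valuation) v_pow: "x \<in> carrier K \<Longrightarrow> v (x [^]\<^bsub>K\<^esub> n) = val_pow \<Gamma> n (v x)" if "x \<noteq> \<zero>\<^bsub>K\<^esub> \<or> 0 < n" for n :: nat
proof (cases "x = \<zero>\<^bsub>K\<^esub>")
  case True
  then show ?thesis using that by (cases n) (auto simp: val_pow_def val_zero)
next
  case False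
  assume x: "x \<in> carrier K"
  obtain g where g: "v x = Some g" using val_nonzero[OF x False] by auto
  show ?thesis
  proof (induction n)
    case 0
    then show ?case using g v_one by (simp add: val_pow_def)
  next
    case (Suc n)
    then show ?case using val_times[of "x [^]\<^bsub>K\<^esub> n" x] x g by (simp add: val_pow_def val_mult_def)
  qed
qed

text \<open>
  The valuative criterion of integral dependence. The conclusion is the consequence of an integral
  equation that is needed later: \<open>z\<close> behaves like an element of \<open>I\<close> up to a fixed shift of exponents.
\<close>

lemma (in field) valuative_criterion_powers:
  assumes A: "subring A R" and I: "ideal I (R\<lparr>carrier := A\<rparr>)" and z: "z \<in> A"
    and val: "\<And>(\<Gamma> :: 'a set monoid) r v. valuation R \<Gamma> r v \<Longrightarrow>
      (\<And>a. a \<in> A \<Longrightarrow> val_le r (Some \<one>\<^bsub>\<Gamma>\<^esub>) (v a)) \<Longrightarrow> \<exists>y\<in>I. val_le r (v y) (v z)"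
  shows "\<exists>D. \<forall>k. z [^] (k + D) \<in> cring.ipow (R\<lparr>carrier := A\<rparr>) I k"
proof -
  define S where "S = R\<lparr>carrier := A\<rparr>"
  interpret S: cring S unfolding S_def using A subcring_iff subcringI'[OF A] subringE(1)[OF A] by blast
  have SI: "ideal I S" using I by (simp add: S_def)
  have ops: "x \<otimes>\<^bsub>S\<^esub> y = x \<otimes> y" "x \<oplus>\<^bsub>S\<^esub> y = x \<oplus> y" "carrier S = A" "\<zero>\<^bsub>S\<^esub> = \<zero>"
    "x [^]\<^bsub>S\<^esub> (n::nat) = x [^] n" for x y n by (simp_all add: S_def nat_pow_def)
  have Ac: "A \<subseteq> carrier R" using subringE(1)[OF A] .
  have IA: "submod A I" unfolding submod_def using idealD[OF SI] Ac by (auto simp: ops)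
  have zc: "z \<in> carrier R" using z Ac by blast
  have "\<exists>d. rees I z d (z [^] d)"
  proof (cases "z = \<zero>")
    case True
    then have "rees I z 1 (z [^] (1::nat))" using rees_gen[of \<zero> I z] submodD(2)[OF IA] by simp
    then show ?thesis by blast
  next
    case False
    show ?thesis
    proof (rule ccontr)
      assume "\<not> ?thesis"
      then obtain V where V: "valuation_ring V" "A \<subseteq> V" "\<And>a y. a \<in> V \<Longrightarrow> y \<in> I \<Longrightarrow> z \<noteq> a \<otimes> y"
        using valuative_criterion[OF A IA zc False] by blast
      obtain \<Gamma> :: "'a set monoid" and r v where v: "valuation R \<Gamma> r v"
        "\<And>x y. x \<in> carrier R \<Longrightarrow> y \<in> carrier R \<Longrightarrow> val_le r (v x) (v y) \<longleftrightarrow> (\<exists>a\<in>V. y = a \<otimes> x)"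
        using valuation_of_valuation_ring[OF V(1)] by blast
      have "val_le r (Some \<one>\<^bsub>\<Gamma>\<^esub>) (v a)" if "a \<in> A" for a
      proof -
        have "a \<in> V" "a = a \<otimes> \<one>" "a \<in> carrier R" using that Ac V(2) by auto
        then have "val_le r (v \<one>) (v a)" using v(2)[of \<one> a] by blast
        then show ?thesis using valuation.v_one[OF v(1)] by simp
      qed
      then obtain y where y: "y \<in> I" "val_le r (v y) (v z)" using val[OF v(1)] by blast
      have "y \<in> carrier R" using y(1) submodD(5)[OF IA] by blast
      then show False using v(2)[of y z] zc y V(3) by blast
    qed
  qed
  then obtain d where d: "rees I z d (z [^] d)" by blast
  obtain D where D: "d = Suc D" "z [^] d \<in> I \<cdot>\<^bsub>S\<^esub> S.ipow (Idl\<^bsub>S\<^esub> (insert z I)) D"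
    using rees_in_ideal_prod[OF A I z d] unfolding S_def by blast
  have "\<forall>k. z [^] (k + D) \<in> S.ipow I k"
    using S.ipow_of_reduction[OF SI, of z D] D z by (simp add: ops del: nat_pow_Suc)
  then show ?thesis unfolding S_def by blast
qed

text \<open>
  Membership of \<open>x\<close> in the rational power of exponent $m/n$ says that $v(x^n) \ge v(y^m)$ for some
  $y \in I$, depending on the valuation; as $y^m \in I^m$, the valuative criterion applies to $x^n$ and
  $I^m$.
\<close>

lemma rational_power_integral:
  assumes L: "field L" and A: "subring A L" and I: "ideal I (L\<lparr>carrier := A\<rparr>)"
    and x: "x \<in> rational_power L A I s" and s: "0 < s"
  shows "\<exists>m n D. 0 < n \<and> s = of_nat m / of_nat n \<and>
    (\<forall>k. x [^]\<^bsub>L\<^esub> (n * (k + D)) \<in> cring.ipow (L\<lparr>carrier := A\<rparr>) I (m * k))"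
proof -
  interpret L: field L by (rule L)
  define F where "F = generate_field L A"
  define K where "K = L\<lparr>carrier := F\<rparr>"
  have AL: "A \<subseteq> carrier L" using subringE(1)[OF A] .
  interpret K: field K unfolding K_def F_def by (rule L.generate_field_is_field[OF AL])
  have AF: "A \<subseteq> F" unfolding F_def by (auto intro: generate_field.incl)
  have KA: "K\<lparr>carrier := A\<rparr> = L\<lparr>carrier := A\<rparr>" by (simp add: K_def)
  define S where "S = L\<lparr>carrier := A\<rparr>"
  interpret S: cring S unfolding S_def
    using A L.subcring_iff L.subcringI'[OF A] AL by blast
  have SI: "ideal I S" using I by (simp add: S_def)
  have Kpow: "y [^]\<^bsub>K\<^esub> n = y [^]\<^bsub>L\<^esub> n" "y [^]\<^bsub>S\<^esub> n = y [^]\<^bsub>L\<^esub> n" for y and n :: nat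
    by (simp_all add: K_def S_def nat_pow_def)
  have KAs: "subring A K"
    using K.ring_incl_imp_subring[of A] S.ring_axioms AF by (simp add: KA S_def[symmetric]) (simp add: K_def)
  obtain m' n' where q: "quotient_of s = (m', n')" by fastforce
  have n': "0 < n'" using quotient_of_denom_pos[OF q] .
  have sq: "s = of_int m' / of_int n'" using quotient_of_div[OF q] .
  have m': "0 < m'" using s n' sq by (simp add: zero_less_divide_iff)
  define m n where "m = nat m'" and "n = nat n'"
  have mn: "0 < m" "0 < n" "s = of_nat m / of_nat n" using m' n' sq by (simp_all add: m_def n_def)
  have xA: "x \<in> A" using x by (simp add: rational_power_def)
  have xnA: "x [^]\<^bsub>L\<^esub> n \<in> A" using S.nat_pow_closed[of x n] xA Kpow by (simp add: S_def)
  have Im: "ideal (S.ipow I m) S" using S.ipow_ideal[OF SI] .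
  have "\<exists>D. \<forall>k. (x [^]\<^bsub>L\<^esub> n) [^]\<^bsub>K\<^esub> (k + D) \<in> cring.ipow (K\<lparr>carrier := A\<rparr>) (S.ipow I m) k"
  proof (rule K.valuative_criterion_powers[OF KAs _ xnA])
    show "ideal (S.ipow I m) (K\<lparr>carrier := A\<rparr>)" using Im by (simp add: KA S_def)
    fix \<Gamma> :: "'a set monoid" and r v
    assume v: "valuation K \<Gamma> r v" and pos: "\<And>a. a \<in> A \<Longrightarrow> val_le r (Some \<one>\<^bsub>\<Gamma>\<^esub>) (v a)"
    interpret V: valuation K \<Gamma> r v by (rule v)
    have "valuation_over L A \<Gamma> r v"
      unfolding valuation_over_def using v pos by (simp add: K_def F_def)
    then obtain y where y: "y \<in> I" "val_ge_rat \<Gamma> r s (v x) (v y)"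
      using x unfolding rational_power_def by blast
    have yA: "y \<in> A" using y(1) idealD(1)[OF SI] by (auto simp: S_def)
    have c: "x \<in> carrier K" "y \<in> carrier K" using xA yA AF by (auto simp: K_def)
    have "val_le r (v (y [^]\<^bsub>K\<^esub> m)) (v (x [^]\<^bsub>K\<^esub> n))"
      using y(2) V.v_pow[OF _ c(1), of n] V.v_pow[OF _ c(2), of m] mn q
      by (simp add: val_ge_rat_def m_def n_def)
    moreover have "y [^]\<^bsub>S\<^esub> m \<in> S.ipow I m" using S.pow_in_ipow[OF SI y(1)] .
    ultimately show "\<exists>y\<in>S.ipow I m. val_le r (v y) (v (x [^]\<^bsub>L\<^esub> n))" unfolding Kpow by blast
  qed
  then obtain D where D: "\<And>k. (x [^]\<^bsub>L\<^esub> n) [^]\<^bsub>L\<^esub> (k + D) \<in> S.ipow (S.ipow I m) k"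
    unfolding KA S_def[symmetric] Kpow by blast
  have "x [^]\<^bsub>L\<^esub> (n * (k + D)) \<in> S.ipow I (m * k)" for k
    using D[of k] xA AL S.ipow_mult[OF SI] by (simp add: L.nat_pow_pow subset_iff)
  then show ?thesis using mn unfolding S_def by blast
qed

subsection \<open>Roots of elements of powers of ideals\<close>

context ordered_abelian_group
begin

lemma order_facts:
  "a \<in> carrier \<Gamma> \<Longrightarrow> (a, a) \<in> r" "(a, b) \<in> r \<Longrightarrow> (b, c) \<in> r \<Longrightarrow> (a, c) \<in> r"
  "(a, b) \<in> r \<Longrightarrow> (b, a) \<in> r \<Longrightarrow> a = b"
  "a \<in> carrier \<Gamma> \<Longrightarrow> b \<in> carrier \<Gamma> \<Longrightarrow> (a, b) \<in> r \<or> (b, a) \<in> r"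
  "(a, b) \<in> r \<Longrightarrow> a \<in> carrier \<Gamma>" "(a, b) \<in> r \<Longrightarrow> b \<in> carrier \<Gamma>"
proof -
  have L: "refl_on (carrier \<Gamma>) r" "trans r" "antisym r" "total_on (carrier \<Gamma>) r" "r \<subseteq> carrier \<Gamma> \<times> carrier \<Gamma>"
    using linear_order unfolding order_on_defs by auto
  show "a \<in> carrier \<Gamma> \<Longrightarrow> (a, a) \<in> r" using L(1) by (rule refl_onD)
  show "(a, b) \<in> r \<Longrightarrow> (b, c) \<in> r \<Longrightarrow> (a, c) \<in> r" using L(2) by (rule transD)
  show "(a, b) \<in> r \<Longrightarrow> (b, a) \<in> r \<Longrightarrow> a = b" using L(3) by (rule antisymD)
  show "a \<in> carrier \<Gamma> \<Longrightarrow> b \<in> carrier \<Gamma> \<Longrightarrow> (a, b) \<in> r \<or> (b, a) \<in> r"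
    using L(1,4) unfolding total_on_def by (cases "a = b") (auto dest: refl_onD)
  show "(a, b) \<in> r \<Longrightarrow> a \<in> carrier \<Gamma>" "(a, b) \<in> r \<Longrightarrow> b \<in> carrier \<Gamma>" using L(5) by auto
qed

lemma mult_mono: "(a, b) \<in> r \<Longrightarrow> (c, d) \<in> r \<Longrightarrow> (a \<otimes> c, b \<otimes> d) \<in> r"
proof -
  assume ab: "(a, b) \<in> r" and cd: "(c, d) \<in> r"
  note c = order_facts(5,6)[OF ab] order_facts(5,6)[OF cd]
  have "(a \<otimes> c, b \<otimes> c) \<in> r" using translate[OF ab] c by blast
  moreover have "(c \<otimes> b, d \<otimes> b) \<in> r" using translate[OF cd] c by blast
  ultimately show ?thesis using order_facts(2) c by (simp add: m_comm[of _ b])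
qed

lemma pow_mono: "(a, b) \<in> r \<Longrightarrow> (a [^] n, b [^] n) \<in> r" for n :: nat
  by (induction n) (auto intro: mult_mono order_facts)

lemma pow_cancel:
  assumes "(a [^] n, b [^] n) \<in> r" "0 < (n::nat)" and c: "a \<in> carrier \<Gamma>" "b \<in> carrier \<Gamma>"
  shows "(a, b) \<in> r"
proof (rule ccontr)
  assume no: "(a, b) \<notin> r"
  then have ba: "(b, a) \<in> r" using order_facts(4)[OF c] by blast
  obtain m where m: "n = Suc m" using assms(2) by (cases n) auto
  have "(b [^] m \<otimes> b, b [^] m \<otimes> a) \<in> r" "(b [^] m \<otimes> a, a [^] m \<otimes> a) \<in> r"
    using pow_mono[OF ba, of m] ba c by (auto intro!: mult_mono order_facts(1))
  moreover have "(a [^] m \<otimes> a, b [^] m \<otimes> b) \<in> r" using assms(1) m by simp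
  ultimately have "b [^] m \<otimes> b = b [^] m \<otimes> a" using order_facts(2,3) by blast
  then have "b = a" using c by simp
  then show False using no order_facts(1) c by blast
qed

end

context valuation
begin

abbreviation le where "le a b \<equiv> val_le r a b"

lemma v_cases:
  assumes "x \<in> carrier K" obtains "v x = None" | g where "v x = Some g" "g \<in> carrier \<Gamma>"
  using val_nonzero[OF assms] val_zero by (cases "x = \<zero>\<^bsub>K\<^esub>") auto

lemma le_trans: "le a b \<Longrightarrow> le b c \<Longrightarrow> le a c"
  by (auto simp: val_le_def intro: G.order_facts(2))

lemma le_total: "x \<in> carrier K \<Longrightarrow> y \<in> carrier K \<Longrightarrow> le (v x) (v y) \<or> le (v y) (v x)"
  by (elim v_cases) (auto simp: val_le_def dest: G.order_facts(4))

lemma le_mult: "le a b \<Longrightarrow> le c d \<Longrightarrow> le (val_mult \<Gamma> a c) (val_mult \<Gamma> b d)"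
  by (auto simp: val_le_def val_mult_def split: option.splits intro: G.mult_mono)

lemma le_pow: "le a b \<Longrightarrow> le (val_pow \<Gamma> n a) (val_pow \<Gamma> n b)"
  by (auto simp: val_le_def val_pow_def intro: G.pow_mono)

lemma val_pow_Suc: "val_pow \<Gamma> (Suc n) a = val_mult \<Gamma> (val_pow \<Gamma> n a) a"
  by (cases a) (simp_all add: val_pow_def val_mult_def)

text \<open>
  An element of $I^{n+1}$ is a sum of products of $n+1$ elements of \<open>I\<close>. The element of \<open>I\<close>
  of least value among the factors that occur serves as \<open>b\<close>. Exponent zero is excluded because
  \<open>val_pow\<close> sends the value \<open>None\<close> of $0$ to \<open>None\<close> for every exponent, so \<open>b\<close>
  would have to be nonzero.
\<close>

lemma ideal_power_value:
  assumes R: "subring S K" and I: "ideal I (K\<lparr>carrier := S\<rparr>)"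
    and y: "y \<in> cring.ipow (K\<lparr>carrier := S\<rparr>) I (Suc n)"
  shows "\<exists>b\<in>I. le (val_pow \<Gamma> (Suc n) (v b)) (v y)"
proof -
  define T where "T = K\<lparr>carrier := S\<rparr>"
  interpret T: cring T unfolding T_def
    using R K.subcring_iff K.subcringI'[OF R] subringE(1)[OF R] by blast
  have TI: "ideal I T" using I by (simp add: T_def)
  have ops: "x \<otimes>\<^bsub>T\<^esub> y = x \<otimes>\<^bsub>K\<^esub> y" "x \<oplus>\<^bsub>T\<^esub> y = x \<oplus>\<^bsub>K\<^esub> y" "carrier T = S" for x y by (simp_all add: T_def)
  have IK: "b \<in> carrier K" if "b \<in> I" for b
    using that idealD(1)[OF TI] subringE(1)[OF R] by (auto simp: ops)
  have TK: "b \<in> carrier K" if "b \<in> T.ipow I n" for b n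
    using that idealD(1)[OF T.ipow_ideal[OF TI]] subringE(1)[OF R] by (auto simp: ops)
  have min: "\<exists>c\<in>I. le (v c) (v a) \<and> le (v c) (v b)" if ab: "a \<in> I" "b \<in> I" for a b
    using le_total[OF IK[OF ab(1)] IK[OF ab(2)]] le_total[OF IK[OF ab(1)] IK[OF ab(1)]]
      le_total[OF IK[OF ab(2)] IK[OF ab(2)]] ab by blast
  have "\<exists>b\<in>I. le (val_pow \<Gamma> (Suc n) (v b)) (v y)" if "y \<in> T.ipow I (Suc n)" for y
    using that
  proof (induction n arbitrary: y)
    case 0
    then have y: "y \<in> I" using T.ipow_1[OF TI] by simp
    have "val_pow \<Gamma> (Suc 0) (v y) = v y"
      using v_pow[of y 1] IK[OF y] by simp
    then show ?case using y le_total[OF IK[OF y] IK[OF y]] by metis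
  next
    case (Suc n)
    then have "y \<in> T.ipow I (Suc n) \<cdot>\<^bsub>T\<^esub> I" using T.ipow_Suc[of I "Suc n"] by simp
    then show ?case
    proof (induction rule: ideal_prod.induct)
      case (prod i j)
      obtain b where b: "b \<in> I" "le (val_pow \<Gamma> (Suc n) (v b)) (v i)" using Suc.IH[OF prod(1)] by blast
      obtain c where c: "c \<in> I" "le (v c) (v b)" "le (v c) (v j)" using min[OF b(1) prod(2)] by blast
      have "le (val_pow \<Gamma> (Suc (Suc n)) (v c)) (val_mult \<Gamma> (v i) (v j))"
        unfolding val_pow_Suc[of "Suc n"] using le_trans[OF le_pow[OF c(2)] b(2)] c(3) by (rule le_mult)
      then show ?case using val_times[OF TK[OF prod(1)] IK[OF prod(2)]] c(1) by (auto simp: ops)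
    next
      case (sum s t)
      obtain a b where ab: "a \<in> I" "le (val_pow \<Gamma> (Suc (Suc n)) (v a)) (v s)"
        "b \<in> I" "le (val_pow \<Gamma> (Suc (Suc n)) (v b)) (v t)" using sum by blast
      obtain c where c: "c \<in> I" "le (v c) (v a)" "le (v c) (v b)" using min[OF ab(1,3)] by blast
      have st: "s \<in> carrier K" "t \<in> carrier K"
        using sum(1,2) TK[of _ "Suc (Suc n)"] T.ipow_Suc[of I "Suc n"] by auto
      have "le (val_pow \<Gamma> (Suc (Suc n)) (v c)) (v s)" "le (val_pow \<Gamma> (Suc (Suc n)) (v c)) (v t)"
        using le_trans[OF le_pow[OF c(2)] ab(2)] le_trans[OF le_pow[OF c(3)] ab(4)] by auto
      then have "le (val_pow \<Gamma> (Suc (Suc n)) (v c)) (v (s \<oplus>\<^bsub>K\<^esub> t))"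
        using val_plus[OF st] le_trans by blast
      then show ?case using c(1) by (auto simp: ops)
    qed
  qed
  then show ?thesis using y unfolding T_def by blast
qed

lemma val_pow_pow:
  assumes "x \<in> carrier K"
  shows "val_pow \<Gamma> m (val_pow \<Gamma> n (v x)) = val_pow \<Gamma> (n * m) (v x)"
  using assms by (elim v_cases) (simp_all add: val_pow_def G.nat_pow_pow)

lemma le_pow_cancel:
  assumes "x \<in> carrier K" "y \<in> carrier K" "0 < q"
    and "le (val_pow \<Gamma> q (val_pow \<Gamma> m (v x))) (val_pow \<Gamma> q (val_pow \<Gamma> n (v y)))"
  shows "le (val_pow \<Gamma> m (v x)) (val_pow \<Gamma> n (v y))"
  using assms by (elim v_cases) (auto simp: val_pow_def val_le_def dest: G.pow_cancel)

end

text \<open>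
  The exponent of the rational power is read off from its fraction in lowest terms, so the
  inequality $q\,v(x) \ge n\,v(b)$ must be divided by a common factor; ordered groups are torsion-free.
\<close>

lemma root_in_rational_power:
  assumes L: "field L" and R: "subring R L" and A: "subring A L" and RA: "R \<subseteq> A"
    and I: "ideal I (L\<lparr>carrier := R\<rparr>)" and IJ: "I \<subseteq> J"
    and x: "x \<in> A" and q: "0 < q" and n: "0 < n"
    and y: "x [^]\<^bsub>L\<^esub> q \<in> cring.ipow (L\<lparr>carrier := R\<rparr>) I n"
  shows "x \<in> rational_power L A J (of_nat n / of_nat q)"
proof -
  interpret L: field L by (rule L)
  define F where "F = generate_field L A"
  define K where "K = L\<lparr>carrier := F\<rparr>"
  have AL: "A \<subseteq> carrier L" using subringE(1)[OF A] .
  have AF: "A \<subseteq> F" unfolding F_def by (auto intro: generate_field.incl)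
  have KR: "K\<lparr>carrier := R\<rparr> = L\<lparr>carrier := R\<rparr>" by (simp add: K_def)
  have RI: "I \<subseteq> R" using idealD(1)[OF I] by simp
  obtain m' n' where Q: "quotient_of (of_nat n / of_nat q) = (m', n')" by fastforce
  have n': "0 < n'" using quotient_of_denom_pos[OF Q] .
  have sq: "of_nat n / of_nat q = (of_int m' / of_int n' :: rat)" using quotient_of_div[OF Q] .
  then have eq: "of_nat n * of_int n' = (of_int m' * of_nat q :: rat)"
    using q n' by (simp add: field_simps)
  have "of_int (int n * n') = (of_int (m' * int q) :: rat)" using eq by simp
  then have eqi: "int n * n' = m' * int q" by (simp only: of_int_eq_iff)
  have m': "0 < m'" using eqi n q n' by (metis mult_pos_pos of_nat_0_less_iff zero_less_mult_pos2)
  define k l where "k = nat m'" and "l = nat n'"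
  have kl: "n * l = k * q" "0 < l" using eqi m' n' unfolding k_def l_def
    by (auto simp: nat_mult_distrib[symmetric] simp flip: of_nat_eq_iff[where 'a=int])
  show ?thesis
    unfolding rational_power_def
  proof (intro CollectI conjI allI impI x)
    fix \<Gamma> :: "'a set monoid" and r v
    assume "valuation_over L A \<Gamma> r v"
    then have "valuation K \<Gamma> r v" unfolding valuation_over_def K_def F_def by blast
    then interpret V: valuation K \<Gamma> r v .
    have "ring (K\<lparr>carrier := R\<rparr>)" unfolding KR by (rule L.subring_is_ring[OF R])
    then have RK: "subring R K"
      using RA AF by (intro V.K.ring_incl_imp_subring) (auto simp: K_def)
    obtain n0 where n0: "n = Suc n0" using n by (cases n) auto
    obtain b where b: "b \<in> I" "val_le r (val_pow \<Gamma> n (v b)) (v (x [^]\<^bsub>L\<^esub> q))"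
      using V.ideal_power_value[OF RK, of I "x [^]\<^bsub>L\<^esub> q" n0] I y unfolding KR n0 by blast
    have c: "x \<in> carrier K" "b \<in> carrier K" using x b(1) RI RA AF by (auto simp: K_def)
    have "x [^]\<^bsub>L\<^esub> q = x [^]\<^bsub>K\<^esub> q" by (simp add: K_def nat_pow_def)
    then have "val_le r (val_pow \<Gamma> n (v b)) (val_pow \<Gamma> q (v x))"
      using b(2) V.v_pow[OF _ c(1), of q] q by simp
    then have "val_le r (val_pow \<Gamma> l (val_pow \<Gamma> n (v b))) (val_pow \<Gamma> l (val_pow \<Gamma> q (v x)))"
      by (rule V.le_pow)
    then have "val_le r (val_pow \<Gamma> q (val_pow \<Gamma> k (v b))) (val_pow \<Gamma> q (val_pow \<Gamma> l (v x)))"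
      using c kl by (simp add: V.val_pow_pow mult.commute)
    then have "val_le r (val_pow \<Gamma> k (v b)) (val_pow \<Gamma> l (v x))"
      by (rule V.le_pow_cancel[OF c(2,1) q])
    then show "\<exists>y\<in>J. val_ge_rat \<Gamma> r (of_nat n / of_nat q) (v x) (v y)"
      using b(1) IJ Q by (auto simp: val_ge_rat_def k_def l_def)
  qed
qed

section \<open>Test elements\<close>

subsection \<open>Frobenius powers\<close>

lemma (in cring) frobenius_power_ideal: "ideal I R \<Longrightarrow> ideal (frobenius_power R I q) R"
  unfolding frobenius_power_def using idealD(1) by (intro genideal_ideal) fast

lemma (in cring) frobenius_powerI: "ideal I R \<Longrightarrow> x \<in> I \<Longrightarrow> x [^] q \<in> frobenius_power R I q"
  unfolding frobenius_power_def
  using idealD(1)[of I R] genideal_self[of "(\<lambda>x. x [^] q) ` I"] by fast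

lemma (in cring) frobenius_power_subset:
  "ideal H R \<Longrightarrow> (\<And>x. x \<in> I \<Longrightarrow> x [^] q \<in> H) \<Longrightarrow> frobenius_power R I q \<subseteq> H"
  unfolding frobenius_power_def by (intro genideal_minimal) auto

lemma (in cring) frobenius_power_mono:
  assumes "ideal I R" "ideal J R" "I \<subseteq> J"
  shows "frobenius_power R I q \<subseteq> frobenius_power R J q"
  using assms by (intro frobenius_power_subset frobenius_power_ideal frobenius_powerI) auto

lemma (in cring) frobenius_power_subset_self:
  assumes I: "ideal I R" and q: "0 < (q::nat)"
  shows "frobenius_power R I q \<subseteq> I"
proof (rule frobenius_power_subset[OF I])
  fix x assume x: "x \<in> I"
  obtain m where "q = Suc m" using q by (cases q) auto
  then show "x [^] q \<in> I" using idealD(4)[OF I _ x, of "x [^] m"] idealD(1)[OF I] x by auto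
qed

context char_p_cring
begin

lemma frob_preimage_ideal:
  assumes H: "ideal H R"
  shows "ideal {x \<in> carrier R. x [^] (p ^ e) \<in> H} R"
  using idealD[OF H] frob_zero frob_add by (intro ideal_criterion) (auto simp: nat_pow_distrib)

lemma frobenius_power_frob:
  assumes I: "ideal I R" and x: "x \<in> frobenius_power R I q"
  shows "x [^] (p ^ e) \<in> frobenius_power R I (q * p ^ e)"
proof -
  have "frobenius_power R I q \<subseteq> {x \<in> carrier R. x [^] (p ^ e) \<in> frobenius_power R I (q * p ^ e)}"
    using idealD(1)[OF I] frobenius_powerI[OF I]
    by (intro frobenius_power_subset frob_preimage_ideal frobenius_power_ideal I) (auto simp: nat_pow_pow)
  then show ?thesis using x by blast
qed

subsection \<open>Additive maps that are linear over Frobenius\<close>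

text \<open>
  These are the maps that become \<open>R\<close>-linear when the source is viewed as $R^{1/p^k}$.
\<close>

definition plinear :: "nat \<Rightarrow> ('a \<Rightarrow> 'a) \<Rightarrow> bool"
  where "plinear k \<theta> \<longleftrightarrow> (\<forall>x\<in>carrier R. \<theta> x \<in> carrier R) \<and>
    (\<forall>x\<in>carrier R. \<forall>y\<in>carrier R. \<theta> (x \<oplus> y) = \<theta> x \<oplus> \<theta> y) \<and>
    (\<forall>r\<in>carrier R. \<forall>x\<in>carrier R. \<theta> (r [^] (p ^ k) \<otimes> x) = r \<otimes> \<theta> x)"

lemma plinearD:
  assumes "plinear k \<theta>"
  shows "x \<in> carrier R \<Longrightarrow> \<theta> x \<in> carrier R"
    "x \<in> carrier R \<Longrightarrow> y \<in> carrier R \<Longrightarrow> \<theta> (x \<oplus> y) = \<theta> x \<oplus> \<theta> y"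
    "r \<in> carrier R \<Longrightarrow> x \<in> carrier R \<Longrightarrow> \<theta> (r [^] (p ^ k) \<otimes> x) = r \<otimes> \<theta> x"
  using assms by (auto simp: plinear_def)

lemma plinear_zero: "plinear k \<theta> \<Longrightarrow> \<theta> \<zero> = \<zero>"
  using plinearD(3)[of k \<theta> \<zero> \<zero>] plinearD(1)[of k \<theta> \<zero>] by simp

lemma plinear_id: "plinear 0 (\<lambda>x. x)"
  by (simp add: plinear_def)

lemma plinear_smult: "plinear k \<theta> \<Longrightarrow> s \<in> carrier R \<Longrightarrow> plinear k (\<lambda>x. \<theta> (s \<otimes> x))"
  by (simp add: plinear_def r_distr m_lcomm[of s])

lemma plinear_comp:
  assumes "plinear j \<theta>" "plinear k \<eta>"
  shows "plinear (j + k) (\<lambda>x. \<theta> (\<eta> x))"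
proof -
  have "\<theta> (\<eta> (r [^] (p ^ (j + k)) \<otimes> x)) = r \<otimes> \<theta> (\<eta> x)" if "r \<in> carrier R" "x \<in> carrier R" for r x
  proof -
    have "r [^] (p ^ (j + k)) = (r [^] (p ^ j)) [^] (p ^ k)"
      using that by (simp add: nat_pow_pow power_add)
    then show ?thesis using that plinearD[OF assms(1)] plinearD[OF assms(2)] by simp
  qed
  then show ?thesis using plinearD(1,2)[OF assms(1)] plinearD(1,2)[OF assms(2)] by (simp add: plinear_def)
qed

text \<open>
  If $R$ is free of finite rank over its $p^k$-th powers, this is the smallest ideal $I$ with $c \in I^{[p^k]}$: it is
  generated by the $p^k$-th roots of the coordinates of $c$.
\<close>

definition trace_ideal :: "nat \<Rightarrow> 'a \<Rightarrow> 'a set"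
  where "trace_ideal k c = {\<theta> c | \<theta>. plinear k \<theta>}"

lemma trace_idealI: "plinear k \<theta> \<Longrightarrow> \<theta> c \<in> trace_ideal k c"
  unfolding trace_ideal_def by blast

lemma trace_idealE:
  assumes "a \<in> trace_ideal k c" obtains \<theta> where "plinear k \<theta>" "a = \<theta> c"
  using assms unfolding trace_ideal_def by blast

lemma trace_ideal_ideal:
  assumes c: "c \<in> carrier R"
  shows "ideal (trace_ideal k c) R"
proof (rule ideal_criterion)
  show "trace_ideal k c \<subseteq> carrier R" using c plinearD(1) by (auto simp: trace_ideal_def)
  have "plinear k (\<lambda>x. \<zero>)" by (simp add: plinear_def)
  then show "\<zero> \<in> trace_ideal k c"
    unfolding trace_ideal_def by (intro CollectI exI[of _ "\<lambda>x. \<zero>"]) simp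
  fix a b assume "a \<in> trace_ideal k c" "b \<in> trace_ideal k c"
  then obtain \<theta> \<eta> where *: "plinear k \<theta>" "plinear k \<eta>" "a = \<theta> c" "b = \<eta> c"
    unfolding trace_ideal_def by blast
  have "plinear k (\<lambda>x. \<theta> x \<oplus> \<eta> x)"
    unfolding plinear_def using plinearD[OF *(1)] plinearD[OF *(2)]
    by (intro conjI ballI) (simp_all add: r_distr a_ac)
  from trace_idealI[OF this, of c] show "a \<oplus> b \<in> trace_ideal k c" using *(3,4) by simp
next
  fix r a assume r: "r \<in> carrier R" and "a \<in> trace_ideal k c"
  then obtain \<theta> where *: "plinear k \<theta>" "a = \<theta> c" unfolding trace_ideal_def by blast
  have "plinear k (\<lambda>x. r \<otimes> \<theta> x)"
    unfolding plinear_def using plinearD[OF *(1)] r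
    by (intro conjI ballI) (simp_all add: r_distr m_lcomm[of r])
  from trace_idealI[OF this, of c] show "r \<otimes> a \<in> trace_ideal k c" using *(2) by simp
qed

lemma trace_ideal_trans: "v \<in> trace_ideal j u \<Longrightarrow> trace_ideal k v \<subseteq> trace_ideal (k + j) u"
  by (auto elim!: trace_idealE intro: trace_idealI[OF plinear_comp])

text \<open>
  The factor \<open>s\<close> in the auxiliary ideal is needed because $\theta$ is additive but not linear: the
  set of $x$ with $\theta(x) \in I^{[p^e]}$ need not be an ideal.
\<close>

lemma plinear_frobenius_power:
  assumes \<theta>: "plinear k \<theta>" and I: "ideal I R" and u: "u \<in> frobenius_power R I (p ^ (e + k))"
  shows "\<theta> u \<in> frobenius_power R I (p ^ e)"
proof -
  define H where "H = frobenius_power R I (p ^ e)"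
  have H: "ideal H R" unfolding H_def by (rule frobenius_power_ideal[OF I])
  have "frobenius_power R I (p ^ (e + k)) \<subseteq> {x \<in> carrier R. \<forall>s\<in>carrier R. \<theta> (s \<otimes> x) \<in> H}"
  proof (rule frobenius_power_subset)
    show "ideal {x \<in> carrier R. \<forall>s\<in>carrier R. \<theta> (s \<otimes> x) \<in> H} R"
      using idealD(2,3)[OF H] plinear_zero[OF \<theta>] plinearD(2)[OF \<theta>]
      by (intro ideal_criterion) (auto simp: r_distr m_assoc[symmetric])
    fix y assume y: "y \<in> I"
    have yc: "y \<in> carrier R" using y idealD(1)[OF I] by blast
    have "\<theta> (s \<otimes> y [^] (p ^ (e + k))) \<in> H" if s: "s \<in> carrier R" for s
    proof -
      have "s \<otimes> y [^] (p ^ (e + k)) = (y [^] (p ^ e)) [^] (p ^ k) \<otimes> s"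
        using s yc by (simp add: nat_pow_pow power_add m_comm)
      then have "\<theta> (s \<otimes> y [^] (p ^ (e + k))) = y [^] (p ^ e) \<otimes> \<theta> s"
        using plinearD(3)[OF \<theta>] s yc by simp
      then show ?thesis
        using idealD(5)[OF H plinearD(1)[OF \<theta> s]] frobenius_powerI[OF I y, of "p ^ e"] H_def by simp
    qed
    then show "y [^] (p ^ (e + k)) \<in> {x \<in> carrier R. \<forall>s\<in>carrier R. \<theta> (s \<otimes> x) \<in> H}" using yc by simp
  qed
  then have "\<theta> (\<one> \<otimes> u) \<in> H" "u \<in> carrier R" using u by auto
  then show ?thesis by (simp add: H_def)
qed

end

subsection \<open>Consequences of the ascending chain condition\<close>

lemma (in noetherian_ring) ideal_sequence_stabilizes:
  assumes "\<And>n. ideal (f n) R" "\<And>n. f n \<subseteq> f (Suc n)"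
  shows "\<exists>n. \<forall>m\<ge>n. f m = f (n :: nat)"
proof -
  have mono: "m \<le> n \<Longrightarrow> f m \<subseteq> f n" for m n by (rule lift_Suc_mono_le) (use assms(2) in auto)
  have "\<Union>(range f) \<in> range f"
  proof (rule ideal_chain_is_trivial)
    show "subset.chain {I. ideal I R} (range f)"
      unfolding subset_chain_def
    proof (intro conjI ballI)
      show "range f \<subseteq> {I. ideal I R}" using assms(1) by blast
      fix I J assume "I \<in> range f" "J \<in> range f"
      then obtain m n where "I = f m" "J = f n" by blast
      then show "I \<subseteq> J \<or> J \<subseteq> I" using mono[of m n] mono[of n m] by (cases "m \<le> n") auto
    qed
  qed auto
  then obtain n where n: "\<Union>(range f) = f n" by blast
  have "f m = f n" if "n \<le> m" for m using mono[OF that] n by blast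
  then show ?thesis by blast
qed

locale noetherian_char_p_domain = noetherian_domain + char_p_cring
begin

text \<open>
  A form of Krull's intersection theorem for Frobenius powers: the colon ideals $(I^{[p^k]} : c)$ are
  eventually contained in \<open>I\<close>. Choose \<open>H\<close> maximal among the ideals containing $Ic$ with
  $(H : c) \subseteq I$. Every $a \in I$ has a power in \<open>H\<close>: for $m$ with
  $(H : a^m) = (H : a^{m+1})$ the ideal $H + (a^m)$ still has both properties. As \<open>I\<close> is finitely
  generated, $I^{[p^k]} \subseteq H$ for large $k$.
\<close>

lemma frobenius_colon:
  assumes I: "ideal I R" and c: "c \<in> carrier R" "c \<noteq> \<zero>"
  shows "\<exists>N. \<forall>k\<ge>N. \<forall>s\<in>carrier R. s \<otimes> c \<in> frobenius_power R I (p ^ k) \<longrightarrow> s \<in> I"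
proof -
  let ?Ic = "{i \<otimes> c | i. i \<in> I}"
  define \<H> where "\<H> = {H. ideal H R \<and> (\<forall>i\<in>I. i \<otimes> c \<in> H) \<and> (\<forall>s\<in>carrier R. s \<otimes> c \<in> H \<longrightarrow> s \<in> I)}"
  note ID = idealD[OF I]
  have "\<exists>H\<in>\<H>. \<forall>H'\<in>\<H>. H \<subseteq> H' \<longrightarrow> H' = H"
  proof (rule subset_Zorn_nonempty)
    have "?Ic \<in> \<H>"
    proof -
      have "ideal ?Ic R"
      proof (rule ideal_criterion)
        show "?Ic \<subseteq> carrier R" using ID(1) c by auto
        have "\<zero> = \<zero> \<otimes> c" using c by simp
        then show "\<zero> \<in> ?Ic" using ID(2) by blast
        fix a b assume "a \<in> ?Ic" "b \<in> ?Ic"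
        then obtain i j where *: "i \<in> I" "j \<in> I" "a = i \<otimes> c" "b = j \<otimes> c" by blast
        have "a \<oplus> b = (i \<oplus> j) \<otimes> c" using * ID(1) c by (simp add: l_distr subset_iff)
        then show "a \<oplus> b \<in> ?Ic" using ID(3)[OF *(1,2)] by blast
      next
        fix r a assume r: "r \<in> carrier R" and "a \<in> ?Ic"
        then obtain i where *: "i \<in> I" "a = i \<otimes> c" by blast
        have "r \<otimes> a = (r \<otimes> i) \<otimes> c" using * ID(1) c r by (simp add: m_assoc subset_iff)
        then show "r \<otimes> a \<in> ?Ic" using ID(4)[OF r *(1)] by blast
      qed
      moreover have "s \<in> I" if "s \<in> carrier R" "i \<in> I" "s \<otimes> c = i \<otimes> c" for s i
        using that m_rcancel[of c s i] c ID(1) by auto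
      ultimately show ?thesis unfolding \<H>_def by blast
    qed
    then show "\<H> \<noteq> {}" by blast
    fix C assume C: "C \<noteq> {}" "subset.chain \<H> C"
    have "subset.chain {I. ideal I R} C" using C(2) unfolding pred_on.chain_def \<H>_def by blast
    then have "\<Union>C \<in> C" using ideal_chain_is_trivial C(1) by blast
    then show "\<Union>C \<in> \<H>" using C(2) unfolding pred_on.chain_def by blast
  qed
  then obtain H where H: "H \<in> \<H>" and max: "\<And>H'. H' \<in> \<H> \<Longrightarrow> H \<subseteq> H' \<Longrightarrow> H' = H" by blast
  have HI: "ideal H R" and Hc: "\<And>i. i \<in> I \<Longrightarrow> i \<otimes> c \<in> H"
    and Hs: "\<And>s. s \<in> carrier R \<Longrightarrow> s \<otimes> c \<in> H \<Longrightarrow> s \<in> I" using H by (auto simp: \<H>_def)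
  note HD = idealD[OF HI]
  have nil: "\<exists>m::nat. a [^] m \<in> H" if a: "a \<in> I" for a
  proof -
    have ac: "a \<in> carrier R" using a ID(1) by blast
    define f where "f m = {r \<in> carrier R. r \<otimes> a [^] m \<in> H}" for m :: nat
    have "\<exists>n. \<forall>m\<ge>n. f m = f n"
    proof (rule ideal_sequence_stabilizes)
      show "ideal (f n) R" for n unfolding f_def using colon_ideal[OF HI] ac by simp
      show "f n \<subseteq> f (Suc n)" for n
        unfolding f_def using HD(5)[OF ac] ac by (auto simp: m_assoc[symmetric])
    qed
    then obtain n where n: "\<forall>m\<ge>n. f m = f n" by blast
    then obtain m where m: "f (Suc m) = f m" by (meson le_SucI le_refl)
    define y where "y = a [^] m"
    have yc: "y \<in> carrier R" using ac by (simp add: y_def)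
    define H' where "H' = set_add R H (PIdl y)"
    have H'I: "h \<oplus> r \<otimes> y \<in> H'" if "h \<in> H" "r \<in> carrier R" for h r
      using that unfolding H'_def set_add_def' cgenideal_def by blast
    have Hcar: "h \<in> carrier R" if "h \<in> H" for h using that HD(1) by blast
    have "ideal H' R" unfolding H'_def by (rule add_ideals[OF HI cgenideal_ideal[OF yc]])
    moreover have sub: "H \<subseteq> H'" using H'I[OF _ zero_closed] Hcar yc by fastforce
    moreover have "s \<in> I" if s: "s \<in> carrier R" "s \<otimes> c \<in> H'" for s
    proof -
      obtain h r where *: "h \<in> H" "r \<in> carrier R" "s \<otimes> c = h \<oplus> r \<otimes> y" using s(2) unfolding H'_def set_add_def' cgenideal_def by blast
      have hc: "h \<in> carrier R" using Hcar[OF *(1)] .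
      have ry: "r \<otimes> y = s \<otimes> c \<ominus> h"
        unfolding *(3) a_minus_def using hc *(2) yc by (simp add: a_comm[of h] a_assoc r_neg)
      \<comment> \<open>The product \<open>a \<otimes> (s \<otimes> c)\<close> lies in \<open>Ic \<subseteq> H\<close>, which moves \<open>r\<close> into \<open>(H : a^(m+1))\<close>.\<close>
      have "a \<otimes> (s \<otimes> c) = (s \<otimes> a) \<otimes> c" using ac s(1) c by (simp add: m_ac)
      then have "a \<otimes> (s \<otimes> c) \<in> H" using Hc[OF ID(4)[OF s(1) a]] by simp
      moreover have "r \<otimes> a [^] Suc m = a \<otimes> (s \<otimes> c) \<oplus> \<ominus> (a \<otimes> h)"
      proof -
        have "r \<otimes> a [^] Suc m = a \<otimes> (r \<otimes> y)" using ac *(2) by (simp add: y_def m_ac)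
        then show ?thesis unfolding ry using ac s(1) c hc by (simp add: a_minus_def r_distr r_minus)
      qed
      ultimately have "r \<otimes> a [^] Suc m \<in> H" using HD(3) HD(6)[OF HD(4)[OF ac *(1)]] by simp
      then have "r \<in> f m" using m *(2) unfolding f_def by blast
      then have "r \<otimes> y \<in> H" by (simp add: f_def y_def)
      then have "s \<otimes> c \<in> H" using *(1,3) HD(3) by simp
      then show ?thesis using Hs s(1) by blast
    qed
    ultimately have "H' \<in> \<H>" using Hc unfolding \<H>_def by blast
    then have "H' = H" using max sub by blast
    moreover have "\<zero> \<oplus> \<one> \<otimes> y \<in> H'" using H'I[OF HD(2) one_closed] .
    ultimately have "y \<in> H" using yc by simp
    then show ?thesis unfolding y_def by blast
  qed
  obtain U where U: "U \<subseteq> carrier R" "finite U" "I = Idl U" using finetely_gen[OF I] by blast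
  have UI: "U \<subseteq> I" using genideal_self[OF U(1)] U(3) by simp
  obtain m where m: "\<And>g. g \<in> U \<Longrightarrow> g [^] (m g :: nat) \<in> H" using nil UI by (metis subsetD)
  define N where "N = (\<Sum>g\<in>U. m g)"
  have "s \<in> I" if k: "N \<le> k" and s: "s \<in> carrier R" "s \<otimes> c \<in> frobenius_power R I (p ^ k)" for k s
  proof -
    have "k < p ^ k" using p_pos(2) power_gt_expt by simp
    have "U \<subseteq> {x \<in> carrier R. x [^] (p ^ k) \<in> H}"
    proof
      fix g assume g: "g \<in> U"
      have gc: "g \<in> carrier R" using g U(1) by blast
      have "m g \<le> N" unfolding N_def using member_le_sum[OF g, of m] U(2) by simp
      then have "g [^] (p ^ k) = g [^] (p ^ k - m g) \<otimes> g [^] m g"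
        using gc k \<open>k < p ^ k\<close> by (simp add: nat_pow_mult)
      then show "g \<in> {x \<in> carrier R. x [^] (p ^ k) \<in> H}" using HD(4)[OF _ m[OF g]] gc by simp
    qed
    then have "I \<subseteq> {x \<in> carrier R. x [^] (p ^ k) \<in> H}"
      unfolding U(3) by (rule genideal_minimal[OF frob_preimage_ideal[OF HI]])
    then have "frobenius_power R I (p ^ k) \<subseteq> H" by (intro frobenius_power_subset[OF HI]) blast
    then show ?thesis using Hs s by blast
  qed
  then show ?thesis by blast
qed

end

context noetherian_char_p_domain
begin

subsection \<open>Coordinates over the subring of p-th powers\<close>

definition frob_comb :: "'a set \<Rightarrow> ('a \<Rightarrow> 'a) \<Rightarrow> 'a"
  where "frob_comb A f = (\<Oplus>a\<in>A. f a [^] p \<otimes> a)"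

definition F_span :: "'a set \<Rightarrow> 'a set"
  where "F_span A = {frob_comb A f | f. f \<in> A \<rightarrow> carrier R}"

definition F_indep :: "'a set \<Rightarrow> bool"
  where "F_indep B \<longleftrightarrow> (\<forall>f\<in>B \<rightarrow> carrier R. frob_comb B f = \<zero> \<longrightarrow> (\<forall>b\<in>B. f b = \<zero>))"

lemma frob1: "x \<in> carrier R \<Longrightarrow> y \<in> carrier R \<Longrightarrow> (x \<oplus> y) [^] p = x [^] p \<oplus> y [^] p"
  "\<zero> [^] p = \<zero>" "x \<in> carrier R \<Longrightarrow> (\<ominus> x) [^] p = \<ominus> (x [^] p)"
  using frob_add[of x y 1] frob_zero[of 1] frob_minus[of x 1] by auto

lemma pow_nonzero: "x \<in> carrier R \<Longrightarrow> x \<noteq> \<zero> \<Longrightarrow> x [^] (n::nat) \<noteq> \<zero>"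
  by (induction n) (auto simp: integral_iff)

context
  fixes B assumes B: "finite B" "B \<subseteq> carrier R"
begin

lemma frob_comb_closed: "f \<in> B \<rightarrow> carrier R \<Longrightarrow> frob_comb B f \<in> carrier R"
  unfolding frob_comb_def using B by (intro finsum_closed) (auto simp: Pi_iff subset_iff)

lemma frob_comb_add:
  assumes "f \<in> B \<rightarrow> carrier R" "g \<in> B \<rightarrow> carrier R"
  shows "frob_comb B (\<lambda>b. f b \<oplus> g b) = frob_comb B f \<oplus> frob_comb B g"
proof -
  have "frob_comb B (\<lambda>b. f b \<oplus> g b) = (\<Oplus>b\<in>B. f b [^] p \<otimes> b \<oplus> g b [^] p \<otimes> b)"
    unfolding frob_comb_def
    by (rule finsum_cong') (use assms B in \<open>auto simp: Pi_iff subset_iff frob1 l_distr\<close>)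
  also have "\<dots> = frob_comb B f \<oplus> frob_comb B g"
    unfolding frob_comb_def by (rule finsum_addf) (use assms B in \<open>auto simp: Pi_iff subset_iff\<close>)
  finally show ?thesis .
qed

lemma frob_comb_smult:
  assumes "f \<in> B \<rightarrow> carrier R" "r \<in> carrier R"
  shows "frob_comb B (\<lambda>b. r \<otimes> f b) = r [^] p \<otimes> frob_comb B f"
proof -
  have "frob_comb B (\<lambda>b. r \<otimes> f b) = (\<Oplus>b\<in>B. r [^] p \<otimes> (f b [^] p \<otimes> b))"
    unfolding frob_comb_def
    by (rule finsum_cong') (use assms B in \<open>auto simp: Pi_iff subset_iff nat_pow_distrib m_assoc\<close>)
  also have "\<dots> = r [^] p \<otimes> frob_comb B f"
    unfolding frob_comb_def
    by (rule finsum_rdistr[symmetric]) (use assms B in \<open>auto simp: Pi_iff subset_iff\<close>)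
  finally show ?thesis .
qed

lemma frob_comb_zero: "frob_comb B (\<lambda>b. \<zero>) = \<zero>"
proof -
  have "frob_comb B (\<lambda>b. \<zero>) = (\<Oplus>b\<in>B. \<zero>)"
    unfolding frob_comb_def by (rule finsum_cong') (use B in \<open>auto simp: frob1\<close>)
  then show ?thesis by simp
qed

lemma F_span_closure:
  "F_span B \<subseteq> carrier R" "\<zero> \<in> F_span B"
  "\<And>x y. x \<in> F_span B \<Longrightarrow> y \<in> F_span B \<Longrightarrow> x \<oplus> y \<in> F_span B"
  "\<And>r x. r \<in> carrier R \<Longrightarrow> x \<in> F_span B \<Longrightarrow> r [^] p \<otimes> x \<in> F_span B"
proof -
  have I: "frob_comb B f \<in> F_span B" if "f \<in> B \<rightarrow> carrier R" for f using that unfolding F_span_def by blast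
  have E: "\<exists>f. f \<in> B \<rightarrow> carrier R \<and> x = frob_comb B f" if "x \<in> F_span B" for x
    using that unfolding F_span_def by blast
  show "F_span B \<subseteq> carrier R" using E frob_comb_closed by blast
  show "\<zero> \<in> F_span B" using I[of "\<lambda>b. \<zero>"] frob_comb_zero by simp
  show "x \<oplus> y \<in> F_span B" if xy: "x \<in> F_span B" "y \<in> F_span B" for x y
  proof -
    obtain f g where *: "f \<in> B \<rightarrow> carrier R" "x = frob_comb B f" "g \<in> B \<rightarrow> carrier R" "y = frob_comb B g"
      using E[OF xy(1)] E[OF xy(2)] by blast
    have "(\<lambda>b. f b \<oplus> g b) \<in> B \<rightarrow> carrier R" using * by auto
    then show ?thesis using I frob_comb_add[OF *(1,3)] *(2,4) by metis
  qed
  show "r [^] p \<otimes> x \<in> F_span B" if rx: "r \<in> carrier R" "x \<in> F_span B" for r x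
  proof -
    obtain f where *: "f \<in> B \<rightarrow> carrier R" "x = frob_comb B f" using E[OF rx(2)] by blast
    have "(\<lambda>b. r \<otimes> f b) \<in> B \<rightarrow> carrier R" using * rx by auto
    then show ?thesis using I frob_comb_smult[OF *(1) rx(1)] *(2) by metis
  qed
qed

lemma frob_comb_mem:
  assumes "f \<in> B \<rightarrow> carrier R" "\<zero> \<in> H" "\<And>x y. x \<in> H \<Longrightarrow> y \<in> H \<Longrightarrow> x \<oplus> y \<in> H"
    "\<And>b. b \<in> B \<Longrightarrow> f b [^] p \<otimes> b \<in> H"
  shows "frob_comb B f \<in> H"
proof -
  have "(\<Oplus>b\<in>C. f b [^] p \<otimes> b) \<in> H" if "C \<subseteq> B" for C
    using finite_subset[OF that B(1)] that
  proof (induction C rule: finite_induct)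
    case (insert x C)
    then have "(\<Oplus>b\<in>insert x C. f b [^] p \<otimes> b) = f x [^] p \<otimes> x \<oplus> (\<Oplus>b\<in>C. f b [^] p \<otimes> b)"
      using assms(1) B by (intro finsum_insert) (auto simp: Pi_iff subset_iff)
    then show ?case using insert assms(3,4) by simp
  qed (use assms(2) in simp)
  then show ?thesis unfolding frob_comb_def by blast
qed

lemma F_span_base:
  assumes b: "b \<in> B" shows "b \<in> F_span B"
proof -
  have "frob_comb B (\<lambda>x. if x = b then \<one> else \<zero>) = (\<Oplus>x\<in>B. if b = x then x else \<zero>)"
    unfolding frob_comb_def
    by (rule finsum_cong') (use B in \<open>auto simp: frob1 subset_iff\<close>)
  also have "\<dots> = b" using finsum_singleton[OF b B(1), of "\<lambda>x. x"] B by auto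
  finally have "b = frob_comb B (\<lambda>x. if x = b then \<one> else \<zero>)" by (rule sym)
  moreover have "(\<lambda>x. if x = b then \<one> else \<zero>) \<in> B \<rightarrow> carrier R" by simp
  ultimately show ?thesis unfolding F_span_def by blast
qed

end

lemma F_span_denominator:
  assumes B: "finite B" "B \<subseteq> carrier R" and A: "finite A" "A \<subseteq> carrier R"
    and den: "\<And>a. a \<in> A \<Longrightarrow> \<exists>d\<in>carrier R. d \<noteq> \<zero> \<and> d [^] p \<otimes> a \<in> F_span B"
  shows "\<exists>d\<in>carrier R. d \<noteq> \<zero> \<and> (\<forall>a\<in>A. d [^] p \<otimes> a \<in> F_span B)"
  using A den
proof (induction A rule: finite_induct)
  case empty
  then show ?case by (intro bexI[of _ \<one>]) auto
next
  case (insert x A)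
  obtain d where d: "d \<in> carrier R" "d \<noteq> \<zero>" "\<And>a. a \<in> A \<Longrightarrow> d [^] p \<otimes> a \<in> F_span B"
    using insert by auto
  obtain e where e: "e \<in> carrier R" "e \<noteq> \<zero>" "e [^] p \<otimes> x \<in> F_span B" using insert.prems(2) by auto
  have S: "r [^] p \<otimes> u \<in> F_span B" if "r \<in> carrier R" "u \<in> F_span B" for r u
    using F_span_closure(4)[OF B that] .
  have "(d \<otimes> e) [^] p \<otimes> a \<in> F_span B" if a: "a \<in> insert x A" for a
  proof -
    have ac: "a \<in> carrier R" using a insert.prems(1) by blast
    have "(d \<otimes> e) [^] p \<otimes> a = e [^] p \<otimes> (d [^] p \<otimes> a)" "(d \<otimes> e) [^] p \<otimes> a = d [^] p \<otimes> (e [^] p \<otimes> a)"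
      using d e ac by (simp_all add: nat_pow_distrib m_ac)
    then show ?thesis using a S[OF e(1) d(3)] S[OF d(1) e(3)] by (cases "a = x") auto
  qed
  then show ?case using d e by (intro bexI[of _ "d \<otimes> e"]) (auto simp: integral_iff)
qed

text \<open>
  The elements of \<open>A\<close> generate $R$ over its subring of $p$-th powers. A maximal independent
  subset \<open>B\<close> need not generate $R$, but each of the finitely many generators has a nonzero multiple
  by a $p$-th power in the span of \<open>B\<close>, and $d$ is a product of these denominators.
\<close>

lemma exists_F_basis:
  assumes A: "finite A" "A \<subseteq> carrier R" and span: "carrier R \<subseteq> F_span A"
  obtains B d where "finite B" "B \<subseteq> carrier R" "F_indep B" "d \<in> carrier R" "d \<noteq> \<zero>"
    "\<And>u. u \<in> carrier R \<Longrightarrow> d [^] p \<otimes> u \<in> F_span B"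
proof -
  have fin: "finite {B. B \<subseteq> A \<and> F_indep B}" using A(1) by (auto intro: finite_subset[of _ "Pow A"])
  have "F_indep {}" by (simp add: F_indep_def)
  then have ne: "{B. B \<subseteq> A \<and> F_indep B} \<noteq> {}" by blast
  obtain B where B0: "B \<in> {B. B \<subseteq> A \<and> F_indep B}"
    and max0: "\<forall>C\<in>{B. B \<subseteq> A \<and> F_indep B}. B \<subseteq> C \<longrightarrow> B = C"
    using finite_has_maximal[OF fin ne] by blast
  from B0 have B: "B \<subseteq> A" "F_indep B" by auto
  have max: "C = B" if "C \<subseteq> A" "F_indep C" "B \<subseteq> C" for C using max0 that by blast
  have Bf: "finite B" "B \<subseteq> carrier R" using finite_subset[OF B(1) A(1)] B(1) A(2) by blast+
  have "\<exists>d\<in>carrier R. d \<noteq> \<zero> \<and> d [^] p \<otimes> a \<in> F_span B" if a: "a \<in> A" for a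
  proof (cases "a \<in> B")
    case True
    then show ?thesis using F_span_base[OF Bf True] Bf by (intro bexI[of _ \<one>]) auto
  next
    case False
    have ac: "a \<in> carrier R" using a A by blast
    have "\<not> F_indep (insert a B)" using max[of "insert a B"] False a B(1) by auto
    then obtain f where f: "f \<in> insert a B \<rightarrow> carrier R" "frob_comb (insert a B) f = \<zero>"
      "\<exists>b\<in>insert a B. f b \<noteq> \<zero>" unfolding F_indep_def by blast
    have fB: "f \<in> B \<rightarrow> carrier R" and fa: "f a \<in> carrier R" using f(1) by auto
    have cc: "frob_comb B f \<in> carrier R" by (rule frob_comb_closed[OF Bf fB])
    have eq: "f a [^] p \<otimes> a \<oplus> frob_comb B f = \<zero>"
      using f(2) Bf False fB fa ac
      unfolding frob_comb_def by (subst (asm) finsum_insert) (auto simp: Pi_iff subset_iff)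
    have "f a \<noteq> \<zero>"
    proof
      assume 0: "f a = \<zero>"
      then have "frob_comb B f = \<zero>" using eq cc ac by (simp add: frob1)
      then have "\<forall>b\<in>B. f b = \<zero>" using B(2) fB unfolding F_indep_def by blast
      then show False using f(3) 0 by blast
    qed
    moreover have "f a [^] p \<otimes> a = \<ominus> (frob_comb B f)" using minus_equality[OF eq] cc fa ac by simp
    moreover have "\<ominus> (frob_comb B f) = (\<ominus> \<one>) [^] p \<otimes> frob_comb B f"
      using cc by (simp add: frob1 l_minus)
    moreover have "frob_comb B f \<in> F_span B" using fB unfolding F_span_def by blast
    ultimately show ?thesis using F_span_closure(4)[OF Bf, of "\<ominus> \<one>"] fa by auto
  qed
  then obtain d where d: "d \<in> carrier R" "d \<noteq> \<zero>" "\<And>a. a \<in> A \<Longrightarrow> d [^] p \<otimes> a \<in> F_span B"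
    using F_span_denominator[OF Bf A] by blast
  have "d [^] p \<otimes> u \<in> F_span B" if u: "u \<in> carrier R" for u
  proof -
    let ?D = "{x \<in> carrier R. d [^] p \<otimes> x \<in> F_span B}"
    obtain f where f: "f \<in> A \<rightarrow> carrier R" "u = frob_comb A f" using span u unfolding F_span_def by blast
    have "u \<in> ?D"
      unfolding f(2)
    proof (rule frob_comb_mem[OF A f(1)])
      show "\<zero> \<in> ?D" using d F_span_closure(2)[OF Bf] by simp
      show "x \<oplus> y \<in> ?D"
        if "x \<in> ?D" "y \<in> ?D" for x y
        using that d F_span_closure(3)[OF Bf] by (simp add: r_distr)
      fix a assume a: "a \<in> A"
      have c: "a \<in> carrier R" "f a \<in> carrier R" using a A f(1) by auto
      have "d [^] p \<otimes> (f a [^] p \<otimes> a) = f a [^] p \<otimes> (d [^] p \<otimes> a)" using c d by (simp add: m_lcomm)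
      then show "f a [^] p \<otimes> a \<in> ?D"
        using F_span_closure(4)[OF Bf c(2) d(3)[OF a]] c by simp
    qed
    then show ?thesis by blast
  qed
  then show thesis using that[OF Bf B(2) d(1,2)] by blast
qed

text \<open>
  The coordinates of $d^p u$ with respect to an independent \<open>B\<close> are $p$-th powers
  $\theta_b(u)^p$, and each $\theta_b$ is a map of the required kind, by uniqueness of coordinates.
  So $d^p u = \sum_b \theta_b(u)^p\, b$ is the asserted membership. After inverting $d$, the set
  \<open>B\<close> is a basis of $R$ over the $p$-th powers.
\<close>

lemma trace_ideal_generates:
  assumes A: "finite A" "A \<subseteq> carrier R" and span: "carrier R \<subseteq> F_span A"
  shows "\<exists>d\<in>carrier R. d \<noteq> \<zero> \<and>
    (\<forall>u\<in>carrier R. d [^] p \<otimes> u \<in> frobenius_power R (trace_ideal 1 u) p)"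
proof -
  obtain B d where B: "finite B" "B \<subseteq> carrier R" and ind: "F_indep B" and d: "d \<in> carrier R" "d \<noteq> \<zero>"
    and dB: "\<And>u. u \<in> carrier R \<Longrightarrow> d [^] p \<otimes> u \<in> F_span B"
    using exists_F_basis[OF assms] by blast
  define coord where "coord u = (SOME f. f \<in> B \<rightarrow> carrier R \<and> d [^] p \<otimes> u = frob_comb B f)" for u
  have coord: "coord u \<in> B \<rightarrow> carrier R" "d [^] p \<otimes> u = frob_comb B (coord u)" if u: "u \<in> carrier R" for u
  proof -
    have "\<exists>f. f \<in> B \<rightarrow> carrier R \<and> d [^] p \<otimes> u = frob_comb B f" using dB[OF u] by (auto simp: F_span_def)
    from someI_ex[OF this] show "coord u \<in> B \<rightarrow> carrier R" "d [^] p \<otimes> u = frob_comb B (coord u)"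
      by (auto simp: coord_def)
  qed
  have uniq: "f b = g b" if fg: "f \<in> B \<rightarrow> carrier R" "g \<in> B \<rightarrow> carrier R" "frob_comb B f = frob_comb B g" "b \<in> B"
    for f g b
  proof -
    have g': "(\<lambda>b. \<ominus> \<one> \<otimes> g b) \<in> B \<rightarrow> carrier R" using fg(2) by auto
    have gc: "frob_comb B g \<in> carrier R" by (rule frob_comb_closed[OF B fg(2)])
    have "frob_comb B (\<lambda>b. f b \<oplus> \<ominus> \<one> \<otimes> g b) = frob_comb B f \<oplus> (\<ominus> \<one>) [^] p \<otimes> frob_comb B g"
      using frob_comb_add[OF B fg(1) g'] frob_comb_smult[OF B fg(2), of "\<ominus> \<one>"] by simp
    also have "\<dots> = \<zero>" using fg(3) gc by (simp add: frob1 l_minus r_neg)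
    finally have z: "frob_comb B (\<lambda>b. f b \<oplus> \<ominus> \<one> \<otimes> g b) = \<zero>" .
    have "(\<lambda>b. f b \<oplus> \<ominus> \<one> \<otimes> g b) \<in> B \<rightarrow> carrier R" using fg by auto
    then have "f b \<oplus> \<ominus> \<one> \<otimes> g b = \<zero>" using ind z fg(4) unfolding F_indep_def by blast
    moreover have "f b \<in> carrier R" "g b \<in> carrier R" using fg by auto
    ultimately show ?thesis using minus_equality[of "f b" "\<ominus> g b"] by (simp add: l_minus)
  qed
  have pl: "plinear 1 (\<lambda>u. coord u b)" if b: "b \<in> B" for b
    unfolding plinear_def
  proof (intro conjI ballI)
    show "coord u b \<in> carrier R" if "u \<in> carrier R" for u using coord(1)[OF that] b by auto
    fix x y assume x: "x \<in> carrier R" and y: "y \<in> carrier R"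
    have "frob_comb B (coord (x \<oplus> y)) = frob_comb B (\<lambda>b. coord x b \<oplus> coord y b)"
      using coord(2)[of "x \<oplus> y"] coord(2)[OF x] coord(2)[OF y]
        frob_comb_add[OF B coord(1)[OF x] coord(1)[OF y]] x y d by (simp add: r_distr)
    moreover have "(\<lambda>b. coord x b \<oplus> coord y b) \<in> B \<rightarrow> carrier R"
      using coord(1)[OF x] coord(1)[OF y] by auto
    ultimately show "coord (x \<oplus> y) b = coord x b \<oplus> coord y b"
      using uniq[OF coord(1)[of "x \<oplus> y"] _ _ b] x y by simp
  next
    fix r x assume r: "r \<in> carrier R" and x: "x \<in> carrier R"
    have "frob_comb B (coord (r [^] p \<otimes> x)) = r [^] p \<otimes> frob_comb B (coord x)"
      using coord(2)[of "r [^] p \<otimes> x", symmetric] coord(2)[OF x, symmetric] r x d by (simp add: m_lcomm)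
    also have "\<dots> = frob_comb B (\<lambda>b. r \<otimes> coord x b)" using frob_comb_smult[OF B coord(1)[OF x] r] by simp
    finally have "frob_comb B (coord (r [^] p \<otimes> x)) = frob_comb B (\<lambda>b. r \<otimes> coord x b)" .
    moreover have "(\<lambda>b. r \<otimes> coord x b) \<in> B \<rightarrow> carrier R" using coord(1)[OF x] r by auto
    ultimately show "coord (r [^] (p ^ 1) \<otimes> x) b = r \<otimes> coord x b"
      using uniq[OF coord(1)[of "r [^] p \<otimes> x"] _ _ b] r x by simp
  qed
  have "d [^] p \<otimes> u \<in> frobenius_power R (trace_ideal 1 u) p" if u: "u \<in> carrier R" for u
  proof -
    define H where "H = frobenius_power R (trace_ideal 1 u) p"
    have T: "ideal (trace_ideal 1 u) R" by (rule trace_ideal_ideal[OF u])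
    have H: "ideal H R" unfolding H_def by (rule frobenius_power_ideal[OF T])
    have "frob_comb B (coord u) \<in> H"
    proof (rule frob_comb_mem[OF B coord(1)[OF u] idealD(2,3)[OF H]])
      fix b assume b: "b \<in> B"
      have "coord u b \<in> trace_ideal 1 u" using trace_idealI[OF pl[OF b], of u] .
      then have "coord u b [^] p \<in> H" unfolding H_def by (rule frobenius_powerI[OF T])
      then show "coord u b [^] p \<otimes> b \<in> H" using idealD(5)[OF H] b B by blast
    qed
    then show ?thesis using coord(2)[OF u] by (simp add: H_def)
  qed
  then show ?thesis using d by blast
qed

subsection \<open>Test elements exist\<close>

text \<open>
  After inverting \<open>d\<close>, the ideals \<open>trace_ideal k c\<close> form an ascending chain, which is stationary
  with limit \<open>I\<close>, say, and $c$ lies in $I^{[p^k]}$ for all large $k$. By \<open>frobenius_colon\<close>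
  this forces \<open>I\<close> to be the unit ideal. Instead of localizing, the proof works with the ideals
  \<open>sat k\<close> of elements that a power of \<open>d\<close> moves into \<open>trace_ideal k c\<close>.
\<close>

lemma trace_ideal_contains_power:
  assumes d: "d \<in> carrier R"
    and gen: "\<And>u. u \<in> carrier R \<Longrightarrow> d [^] p \<otimes> u \<in> frobenius_power R (trace_ideal 1 u) p"
    and c: "c \<in> carrier R" "c \<noteq> \<zero>"
  shows "\<exists>k j. d [^] (j::nat) \<in> trace_ideal k c"
proof -
  note TI = trace_ideal_ideal
  have Tc: "v \<in> carrier R" if "v \<in> trace_ideal k u" "u \<in> carrier R" for v k u
    using subsetD[OF idealD(1)[OF TI[OF that(2)]] that(1)] .
  have gen': "\<exists>j. \<forall>u\<in>carrier R. d [^] (j::nat) \<otimes> u \<in> frobenius_power R (trace_ideal k u) (p ^ k)" for k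
  proof (induction k)
    case 0
    have "u \<in> frobenius_power R (trace_ideal 0 u) 1" if u: "u \<in> carrier R" for u
      using frobenius_powerI[OF TI[OF u] trace_idealI[OF plinear_id], of 1] u by simp
    then show ?case by (intro exI[of _ 0]) simp
  next
    case (Suc k)
    then obtain j where j: "\<And>u. u \<in> carrier R \<Longrightarrow> d [^] (j::nat) \<otimes> u \<in> frobenius_power R (trace_ideal k u) (p ^ k)"
      by blast
    have "d [^] (j * p + p) \<otimes> u \<in> frobenius_power R (trace_ideal (Suc k) u) (p ^ Suc k)"
      if u: "u \<in> carrier R" for u
    proof -
      define H where "H = frobenius_power R (trace_ideal (Suc k) u) (p ^ Suc k)"
      have H: "ideal H R" unfolding H_def by (rule frobenius_power_ideal[OF TI[OF u]])
      have "frobenius_power R (trace_ideal 1 u) p \<subseteq> {r \<in> carrier R. r \<otimes> d [^] (j * p) \<in> H}"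
      proof (rule frobenius_power_subset)
        show "ideal {r \<in> carrier R. r \<otimes> d [^] (j * p) \<in> H} R" using colon_ideal[OF H] d by simp
        fix v assume v: "v \<in> trace_ideal 1 u"
        have vc: "v \<in> carrier R" by (rule Tc[OF v u])
        have "frobenius_power R (trace_ideal k v) (p ^ k) \<subseteq> frobenius_power R (trace_ideal (Suc k) u) (p ^ k)"
          using frobenius_power_mono[OF TI[OF vc] TI[OF u] trace_ideal_trans[OF v]] by simp
        then have "d [^] j \<otimes> v \<in> frobenius_power R (trace_ideal (Suc k) u) (p ^ k)" using j[OF vc] by blast
        then have "(d [^] j \<otimes> v) [^] (p ^ 1) \<in> H"
          using frobenius_power_frob[OF TI[OF u], of "d [^] j \<otimes> v" "Suc k" "p ^ k" 1]
          by (simp add: H_def mult.commute)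
        then show "v [^] p \<in> {r \<in> carrier R. r \<otimes> d [^] (j * p) \<in> H}"
          using vc d by (simp add: nat_pow_distrib nat_pow_pow m_comm)
      qed
      then have "d [^] p \<otimes> u \<otimes> d [^] (j * p) \<in> H" using gen[OF u] by blast
      moreover have "d [^] p \<otimes> u \<otimes> d [^] (j * p) = d [^] (j * p + p) \<otimes> u"
        using d u by (simp add: nat_pow_mult[symmetric] m_ac)
      ultimately show ?thesis by (simp add: H_def)
    qed
    then show ?case by blast
  qed
  define sat where "sat k = {u \<in> carrier R. \<exists>j::nat. u \<otimes> d [^] j \<in> trace_ideal k c}" for k
  have up: "u \<otimes> d [^] j \<in> trace_ideal k c" if "u \<otimes> d [^] i \<in> trace_ideal k c" "i \<le> j" "u \<in> carrier R"
    for u k and i j :: nat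
  proof -
    have "u \<otimes> d [^] j = (u \<otimes> d [^] i) \<otimes> d [^] (j - i)"
      using that d by (simp add: m_assoc nat_pow_mult)
    then show ?thesis using idealD(5)[OF TI[OF c(1)] _ that(1)] d by simp
  qed
  have satI: "ideal (sat k) R" for k
  proof (rule ideal_criterion)
    show "sat k \<subseteq> carrier R" by (auto simp: sat_def)
    show "\<zero> \<in> sat k" using d idealD(2)[OF TI[OF c(1)]] by (auto simp: sat_def)
    fix a b assume "a \<in> sat k" "b \<in> sat k"
    then obtain i j where *: "a \<in> carrier R" "b \<in> carrier R" "a \<otimes> d [^] (i::nat) \<in> trace_ideal k c"
      "b \<otimes> d [^] (j::nat) \<in> trace_ideal k c" by (auto simp: sat_def)
    have "(a \<oplus> b) \<otimes> d [^] max i j \<in> trace_ideal k c"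
      using idealD(3)[OF TI[OF c(1)] up[OF *(3) max.cobounded1[of i j] *(1)] up[OF *(4) max.cobounded2[of j i] *(2)]] * d
      by (simp add: l_distr)
    then show "a \<oplus> b \<in> sat k" using * by (auto simp: sat_def)
  next
    fix r a assume r: "r \<in> carrier R" and "a \<in> sat k"
    then obtain i where *: "a \<in> carrier R" "a \<otimes> d [^] (i::nat) \<in> trace_ideal k c" by (auto simp: sat_def)
    have "(r \<otimes> a) \<otimes> d [^] i \<in> trace_ideal k c"
      using idealD(4)[OF TI[OF c(1)] r *(2)] * r d by (simp add: m_assoc)
    then show "r \<otimes> a \<in> sat k" using * r by (auto simp: sat_def)
  qed
  have "\<exists>n. \<forall>m\<ge>n. sat m = sat n"
  proof (rule ideal_sequence_stabilizes)
    fix k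
    show "ideal (sat k) R" by (rule satI)
    show "sat k \<subseteq> sat (Suc k)"
    proof
      fix u assume "u \<in> sat k"
      then obtain j where *: "u \<in> carrier R" "u \<otimes> d [^] (j::nat) \<in> trace_ideal k c" by (auto simp: sat_def)
      define v where "v = u \<otimes> d [^] j"
      have vc: "v \<in> carrier R" using * d by (simp add: v_def)
      have "d [^] p \<otimes> v \<in> trace_ideal 1 v"
        using gen[OF vc] frobenius_power_subset_self[OF TI[OF vc] p_pos(1)] by blast
      then have "d [^] p \<otimes> v \<in> trace_ideal (Suc k) c"
        using trace_ideal_trans[OF *(2), of 1] by (auto simp: v_def)
      moreover have "d [^] p \<otimes> v = u \<otimes> d [^] (j + p)"
        using * d by (simp add: v_def nat_pow_mult[symmetric] m_ac)
      ultimately show "u \<in> sat (Suc k)" using * by (auto simp: sat_def)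
    qed
  qed
  then obtain n where n: "\<And>m. n \<le> m \<Longrightarrow> sat m = sat n" by blast
  obtain N where N: "\<And>k s. N \<le> k \<Longrightarrow> s \<in> carrier R \<Longrightarrow> s \<otimes> c \<in> frobenius_power R (sat n) (p ^ k) \<Longrightarrow> s \<in> sat n"
    using frobenius_colon[OF satI[of n] c] by blast
  define k where "k = max n N"
  have "trace_ideal k c \<subseteq> sat k"
  proof
    fix u assume u: "u \<in> trace_ideal k c"
    have "u \<otimes> d [^] (0::nat) \<in> trace_ideal k c" using u Tc[OF u c(1)] by simp
    then show "u \<in> sat k" using Tc[OF u c(1)] unfolding sat_def by blast
  qed
  then have sub: "trace_ideal k c \<subseteq> sat n" using n[of k] by (simp add: k_def)
  obtain j where j: "d [^] (j::nat) \<otimes> c \<in> frobenius_power R (trace_ideal k c) (p ^ k)" using gen' c(1) by blast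
  then have "d [^] j \<otimes> c \<in> frobenius_power R (sat n) (p ^ k)"
    using frobenius_power_mono[OF TI[OF c(1)] satI sub] by blast
  then have "d [^] j \<in> sat n" using N[of k "d [^] j"] d by (simp add: k_def)
  then obtain i where "d [^] j \<otimes> d [^] (i::nat) \<in> trace_ideal n c" by (auto simp: sat_def)
  then have "d [^] (j + i) \<in> trace_ideal n c" using d by (simp add: nat_pow_mult)
  then show ?thesis by blast
qed

text \<open>
  In a domain the zero ideal is the only minimal prime, so multipliers are the nonzero elements.
\<close>

lemma tight_closureD:
  assumes "x \<in> tight_closure R p I"
  obtains c N where "x \<in> carrier R" "c \<in> carrier R" "c \<noteq> \<zero>"
    "\<And>e. N \<le> e \<Longrightarrow> c \<otimes> x [^] (p ^ e) \<in> frobenius_power R I (p ^ e)"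
proof -
  obtain c N where c: "x \<in> carrier R" "c \<in> carrier R" "\<And>P. minimal_prime R P \<Longrightarrow> c \<notin> P"
    "\<And>e. N \<le> e \<Longrightarrow> c \<otimes> x [^] (p ^ e) \<in> frobenius_power R I (p ^ e)"
    using assms unfolding tight_closure_def by blast
  have "{\<zero>} \<subseteq> Q" if "primeideal Q R" for Q
    using idealD(2)[OF primeideal.axioms(1)[OF that]] by blast
  then have "minimal_prime R {\<zero>}" unfolding minimal_prime_def using zeroprimeideal by auto
  then show thesis using that c by blast
qed

text \<open>
  Let $c\,x^{p^e} \in I^{[p^e]}$ for all large $e$. A map sending $c$ to $d^j$, where \<open>j\<close>
  depends on $c$, gives $d^j x^{p^k} \in I^{[p^k]}$ for all large $k$, and then
  $(dx)^{p^k} \in I^{[p^k]}$ once $p^k \ge j$. To remove the exponent, apply a map of level $k$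
  after multiplication by an element that all these maps can be chosen to fix.
\<close>

theorem test_element_exists:
  assumes A: "finite A" "A \<subseteq> carrier R" and span: "carrier R \<subseteq> F_span A"
  shows "\<exists>t\<in>carrier R. t \<noteq> \<zero> \<and> (\<forall>I x. ideal I R \<longrightarrow> x \<in> tight_closure R p I \<longrightarrow> t \<otimes> x \<in> I)"
proof -
  obtain d where d: "d \<in> carrier R" "d \<noteq> \<zero>"
    and gen: "\<And>u. u \<in> carrier R \<Longrightarrow> d [^] p \<otimes> u \<in> frobenius_power R (trace_ideal 1 u) p"
    using trace_ideal_generates[OF assms] by blast
  have "\<exists>\<theta>. plinear 1 \<theta> \<and> \<theta> \<one> \<noteq> \<zero>"
  proof (rule ccontr)
    assume "\<not> ?thesis"
    then have "trace_ideal 1 \<one> \<subseteq> {\<zero>}" by (auto elim!: trace_idealE)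
    moreover have "d [^] p \<otimes> \<one> \<in> trace_ideal 1 \<one>"
      using gen[OF one_closed] frobenius_power_subset_self[OF trace_ideal_ideal[OF one_closed] p_pos(1)] by blast
    ultimately show False using d pow_nonzero[of d p] by auto
  qed
  then obtain \<theta> where \<theta>: "plinear 1 \<theta>" "\<theta> \<one> \<noteq> \<zero>" by blast
  define \<delta> where "\<delta> = \<theta> \<one>"
  have \<delta>: "\<delta> \<in> carrier R" "\<delta> \<noteq> \<zero>" using plinearD(1)[OF \<theta>(1)] \<theta>(2) by (auto simp: \<delta>_def)
  \<comment> \<open>The exponent is such that \<open>\<eta>\<close> evaluates \<open>\<theta>\<close> on \<open>\<delta> [^] p\<close> when applied to \<open>\<delta> [^] 2\<close>, so it fixes \<open>\<delta> [^] 2\<close>.\<close>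
  define \<eta> where "\<eta> x = \<theta> (\<delta> [^] (p - 2) \<otimes> x)" for x
  have \<eta>: "plinear 1 \<eta>" unfolding \<eta>_def using plinear_smult[OF \<theta>(1)] \<delta> by simp
  have "\<delta> [^] (p - 2) \<otimes> \<delta> [^] (2::nat) = \<delta> [^] (p ^ 1) \<otimes> \<one>"
  proof -
    have "p - 2 + 2 = p" using p_pos by simp
    then show ?thesis using nat_pow_mult[OF \<delta>(1), of "p - 2" 2] \<delta>(1) by (simp only: power_one_right r_one nat_pow_closed)
  qed
  note pw = this
  have fixd: "\<eta> (\<delta> [^] (2::nat)) = \<delta> [^] (2::nat)"
  proof -
    have "\<theta> (\<delta> [^] (p ^ 1) \<otimes> \<one>) = \<delta> \<otimes> \<delta>"
      using plinearD(3)[OF \<theta>(1) \<delta>(1) one_closed] unfolding \<delta>_def .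
    moreover have "\<delta> \<otimes> \<delta> = \<delta> [^] (2::nat)" using \<delta> by (simp add: numeral_2_eq_2)
    ultimately show ?thesis unfolding \<eta>_def pw by simp
  qed
  have iter: "\<exists>\<zeta>. plinear k \<zeta> \<and> \<zeta> (\<delta> [^] (2::nat)) = \<delta> [^] (2::nat)" for k
  proof (induction k)
    case 0
    then show ?case using plinear_id by blast
  next
    case (Suc k)
    then obtain \<zeta> where "plinear k \<zeta>" "\<zeta> (\<delta> [^] (2::nat)) = \<delta> [^] (2::nat)" by blast
    then show ?case
      using plinear_comp[OF \<eta>, of k \<zeta>] fixd by (intro exI[of _ "\<lambda>x. \<eta> (\<zeta> x)"]) simp
  qed
  define t where "t = d \<otimes> \<delta> [^] (2::nat)"
  have t: "t \<in> carrier R" "t \<noteq> \<zero>"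
    using d \<delta> pow_nonzero[of \<delta> 2] by (auto simp: t_def integral_iff)
  have "t \<otimes> x \<in> I" if I: "ideal I R" and x: "x \<in> tight_closure R p I" for I x
  proof -
    obtain c N where c: "x \<in> carrier R" "c \<in> carrier R" "c \<noteq> \<zero>"
      "\<And>e. N \<le> e \<Longrightarrow> c \<otimes> x [^] (p ^ e) \<in> frobenius_power R I (p ^ e)"
      using tight_closureD[OF x] by blast
    obtain k0 j where "d [^] (j::nat) \<in> trace_ideal k0 c"
      using trace_ideal_contains_power[OF d(1) gen c(2,3)] by blast
    then obtain \<xi> where \<xi>: "plinear k0 \<xi>" "d [^] j = \<xi> c" by (auto elim: trace_idealE)
    define k where "k = max N j"
    have "c \<otimes> x [^] (p ^ (k + k0)) = (x [^] (p ^ k)) [^] (p ^ k0) \<otimes> c"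
      using c by (simp add: nat_pow_pow power_add m_comm)
    then have "\<xi> (c \<otimes> x [^] (p ^ (k + k0))) = x [^] (p ^ k) \<otimes> d [^] j"
      using plinearD(3)[OF \<xi>(1)] c \<xi>(2) by simp
    moreover have "\<xi> (c \<otimes> x [^] (p ^ (k + k0))) \<in> frobenius_power R I (p ^ k)"
      using plinear_frobenius_power[OF \<xi>(1) I c(4)] by (simp add: k_def)
    ultimately have m: "x [^] (p ^ k) \<otimes> d [^] j \<in> frobenius_power R I (p ^ k)" by simp
    have "j \<le> p ^ k"
    proof -
      have "k < p ^ k" using p_pos(2) power_gt_expt by simp
      then show ?thesis by (simp add: k_def)
    qed
    then have e: "(d \<otimes> x) [^] (p ^ k) \<otimes> \<delta> [^] (2::nat) =
        (x [^] (p ^ k) \<otimes> d [^] j) \<otimes> (d [^] (p ^ k - j) \<otimes> \<delta> [^] (2::nat))"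
    proof -
      have "d [^] (p ^ k) = d [^] j \<otimes> d [^] (p ^ k - j)" using d \<open>j \<le> p ^ k\<close> by (simp add: nat_pow_mult)
      then show ?thesis using d c \<delta> by (simp add: nat_pow_distrib m_ac)
    qed
    obtain \<zeta> where \<zeta>: "plinear k \<zeta>" "\<zeta> (\<delta> [^] (2::nat)) = \<delta> [^] (2::nat)" using iter by blast
    have "(d \<otimes> x) [^] (p ^ k) \<otimes> \<delta> [^] (2::nat) \<in> frobenius_power R I (p ^ (0 + k))"
      unfolding e using idealD(5)[OF frobenius_power_ideal[OF I] _ m] d \<delta> by simp
    then have "\<zeta> ((d \<otimes> x) [^] (p ^ k) \<otimes> \<delta> [^] (2::nat)) \<in> frobenius_power R I (p ^ 0)"
      by (rule plinear_frobenius_power[OF \<zeta>(1) I])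
    moreover have "\<zeta> ((d \<otimes> x) [^] (p ^ k) \<otimes> \<delta> [^] (2::nat)) = (d \<otimes> x) \<otimes> \<delta> [^] (2::nat)"
      using plinearD(3)[OF \<zeta>(1)] \<zeta>(2) d c \<delta> by simp
    moreover have "(d \<otimes> x) \<otimes> \<delta> [^] (2::nat) = t \<otimes> x" using d c \<delta> by (simp add: t_def m_ac)
    ultimately show ?thesis using frobenius_power_subset_self[OF I, of "p ^ 0"] by auto
  qed
  then show ?thesis using t by blast
qed

corollary tight_closures_of_frobenius_powers_separated:
  assumes A: "finite A" "A \<subseteq> carrier R" and span: "carrier R \<subseteq> F_span A"
    and J: "ideal J R" "J \<noteq> carrier R" and x: "x \<in> carrier R" "x \<noteq> \<zero>"
  shows "\<exists>e. x \<notin> tight_closure R p (frobenius_power R J (p ^ e))"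
proof (rule ccontr)
  assume no: "\<not> ?thesis"
  obtain t where t: "t \<in> carrier R" "t \<noteq> \<zero>"
    "\<And>I x. ideal I R \<Longrightarrow> x \<in> tight_closure R p I \<Longrightarrow> t \<otimes> x \<in> I"
    using test_element_exists[OF A span] by blast
  have tx: "t \<otimes> x \<in> carrier R" "t \<otimes> x \<noteq> \<zero>" using t x by (auto simp: integral_iff)
  obtain N where N: "\<And>k s. N \<le> k \<Longrightarrow> s \<in> carrier R \<Longrightarrow> s \<otimes> (t \<otimes> x) \<in> frobenius_power R J (p ^ k) \<Longrightarrow> s \<in> J"
    using frobenius_colon[OF J(1) tx] by blast
  have "t \<otimes> x \<in> frobenius_power R J (p ^ N)" using t(3)[OF frobenius_power_ideal[OF J(1)]] no by blast
  then have "\<one> \<in> J" using N[of N \<one>] tx by simp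
  then show False using idealD(4)[OF J(1), of _ \<one>] idealD(1)[OF J(1)] J(2) by auto
qed

end

section \<open>Extension of ideals to a perfect algebra\<close>

lemma subring_cring:
  assumes "cring L" "subring S L" shows "cring (L\<lparr>carrier := S\<rparr>)"
  using cring.subcringI'[OF assms] subringE(1)[OF assms(2)] ring.subcring_iff[OF cring.axioms(1)[OF assms(1)]]
  by blast

lemma carrier_update_pow: "x [^]\<^bsub>L\<lparr>carrier := S\<rparr>\<^esub> (n::nat) = x [^]\<^bsub>L\<^esub> n"
  by (simp add: nat_pow_def)

lemma char_p_cring_subring:
  assumes "cring L" "subring S L" "prime p" "[p] \<cdot>\<^bsub>L\<^esub> \<one>\<^bsub>L\<^esub> = \<zero>\<^bsub>L\<^esub>"
  shows "char_p_cring (L\<lparr>carrier := S\<rparr>) p"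
  using subring_cring[OF assms(1,2)] assms(3,4)
  by (simp add: char_p_cring_def char_p_cring_axioms_def add_pow_def nat_pow_def)

lemma char_p_cring_hom:
  assumes S: "char_p_cring S p" and B: "cring B" and h: "h \<in> ring_hom S B"
  shows "char_p_cring B p"
proof -
  interpret S: char_p_cring S p by (rule S)
  interpret B: cring B by (rule B)
  interpret h: ring_hom_cring S B h by unfold_locales (rule h)
  have "h ([n] \<cdot>\<^bsub>S\<^esub> \<one>\<^bsub>S\<^esub>) = [n] \<cdot>\<^bsub>B\<^esub> \<one>\<^bsub>B\<^esub>" for n :: nat
    by (induction n) simp_all
  from this[of p] have "[p] \<cdot>\<^bsub>B\<^esub> \<one>\<^bsub>B\<^esub> = \<zero>\<^bsub>B\<^esub>" using S.char_p by simp
  then show ?thesis using S.prime_p B by (simp add: char_p_cring_def char_p_cring_axioms_def)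
qed

lemma (in ring_hom_cring) preimage_ideal:
  assumes "ideal H S" shows "ideal {x \<in> carrier R. h x \<in> H} R"
  using idealD[OF assms] by (intro R.ideal_criterion) auto

lemma ring_hom_pow:
  assumes "cring S" "cring B" "h \<in> ring_hom S B" "x \<in> carrier S"
  shows "h (x [^]\<^bsub>S\<^esub> (n::nat)) = h x [^]\<^bsub>B\<^esub> n"
proof -
  interpret h: ring_hom_cring S B h
    using assms by (intro ring_hom_cring.intro ring_hom_cring_axioms.intro)
  show ?thesis using assms(4) by (induction n) simp_all
qed

locale perfect_char_p = char_p_cring B p for B (structure) and p +
  assumes perfect: "perfect_ring p B"
begin

lemma frobenius_bij: "bij_betw (\<lambda>b. b [^] (p ^ e)) (carrier B) (carrier B)"
proof (induction e)
  case 0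
  show ?case by (rule bij_betw_cong[THEN iffD1, OF _ bij_betw_id[unfolded id_def]]) simp
next
  case (Suc e)
  have "bij_betw ((\<lambda>b. b [^] p) \<circ> (\<lambda>b. b [^] (p ^ e))) (carrier B) (carrier B)"
    using bij_betw_trans[OF Suc] perfect by (simp add: perfect_ring_def)
  moreover have "((\<lambda>b. b [^] p) \<circ> (\<lambda>b. b [^] (p ^ e))) b = b [^] (p ^ Suc e)" if "b \<in> carrier B" for b
    using that by (simp add: nat_pow_pow mult.commute)
  ultimately show ?case by (subst bij_betw_cong) auto
qed

lemma frobenius_surj: "b \<in> carrier B \<Longrightarrow> \<exists>c\<in>carrier B. b = c [^] (p ^ e)"
  using frobenius_bij[of e] by (auto simp: bij_betw_def)

lemma frobenius_inj: "b \<in> carrier B \<Longrightarrow> c \<in> carrier B \<Longrightarrow> b [^] (p ^ e) = c [^] (p ^ e) \<Longrightarrow> b = c"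
  using frobenius_bij[of e] by (auto simp: bij_betw_def inj_on_def)

lemma frobenius_image_ideal:
  assumes H: "ideal H B"
  shows "ideal ((\<lambda>b. b [^] (p ^ e)) ` H) B"
proof -
  let ?F = "(\<lambda>b. b [^] (p ^ e)) ` H"
  have Hc: "b \<in> carrier B" if "b \<in> H" for b using that idealD(1)[OF H] by blast
  show ?thesis
  proof (rule ideal_criterion)
    show "?F \<subseteq> carrier B" using Hc by auto
    show "\<zero> \<in> ?F"
      using idealD(2)[OF H] frob_zero[of e] by (intro image_eqI[of _ _ \<zero>]) simp_all
    fix a b assume "a \<in> ?F" "b \<in> ?F"
    then obtain a' b' where *: "a' \<in> H" "b' \<in> H" "a = a' [^] (p ^ e)" "b = b' [^] (p ^ e)" by blast
    then show "a \<oplus> b \<in> ?F"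
      using idealD(3)[OF H *(1,2)] frob_add[OF Hc Hc, OF *(1,2)] by (intro image_eqI[of _ _ "a' \<oplus> b'"]) auto
  next
    fix r a assume "r \<in> carrier B" "a \<in> ?F"
    then obtain a' r' where *: "a' \<in> H" "a = a' [^] (p ^ e)" "r' \<in> carrier B" "r = r' [^] (p ^ e)"
      using frobenius_surj[of r e] by blast
    then show "r \<otimes> a \<in> ?F"
      using idealD(4)[OF H *(3,1)] Hc by (intro image_eqI[of _ _ "r' \<otimes> a'"]) (auto simp: nat_pow_distrib)
  qed
qed

text \<open>
  On \<open>B\<close> the map $b \mapsto b^{p^e}$ is an automorphism, and it carries the extension of \<open>J\<close> onto the
  extension of its Frobenius power.
\<close>

lemma frobenius_power_extension_iff:
  assumes S: "char_p_cring S p" and h: "h \<in> ring_hom S B" and J: "ideal J S" and b: "b \<in> carrier B"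
  shows "b [^] (p ^ e) \<in> Idl (h ` frobenius_power S J (p ^ e)) \<longleftrightarrow> b \<in> Idl (h ` J)"
proof -
  interpret S: char_p_cring S p by (rule S)
  interpret h: ring_hom_cring S B h by unfold_locales (rule h)
  have JS: "J \<subseteq> carrier S" using idealD(1)[OF J] .
  have hJ: "h ` J \<subseteq> carrier B" using JS by auto
  have Fi: "ideal (frobenius_power S J (p ^ e)) S" by (rule S.frobenius_power_ideal[OF J])
  have hF: "h ` frobenius_power S J (p ^ e) \<subseteq> carrier B" using idealD(1)[OF Fi] by auto
  have hpow: "h (y [^]\<^bsub>S\<^esub> (p ^ e)) = h y [^] (p ^ e)" if "y \<in> J" for y
    using ring_hom_pow[OF S.is_cring is_cring h] JS that by blast
  show ?thesis
  proof
    assume m: "b [^] (p ^ e) \<in> Idl (h ` frobenius_power S J (p ^ e))"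
    define H where "H = (\<lambda>b. b [^] (p ^ e)) ` (Idl (h ` J))"
    have H: "ideal H B" unfolding H_def by (rule frobenius_image_ideal[OF genideal_ideal[OF hJ]])
    have "frobenius_power S J (p ^ e) \<subseteq> {x \<in> carrier S. h x \<in> H}"
    proof (rule S.frobenius_power_subset[OF h.preimage_ideal[OF H]])
      fix y assume y: "y \<in> J"
      then have "h y \<in> Idl (h ` J)" using genideal_self[OF hJ] by blast
      then show "y [^]\<^bsub>S\<^esub> (p ^ e) \<in> {x \<in> carrier S. h x \<in> H}"
        using hpow[OF y] y JS by (auto simp: H_def)
    qed
    then have "Idl (h ` frobenius_power S J (p ^ e)) \<subseteq> H" by (intro genideal_minimal[OF H]) auto
    then obtain c where c: "c \<in> Idl (h ` J)" "b [^] (p ^ e) = c [^] (p ^ e)" using m by (auto simp: H_def)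
    have "c \<in> carrier B" using c(1) idealD(1)[OF genideal_ideal[OF hJ]] by blast
    then show "b \<in> Idl (h ` J)" using frobenius_inj[OF b _ c(2)] c(1) by simp
  next
    assume m: "b \<in> Idl (h ` J)"
    have "Idl (h ` J) \<subseteq> {x \<in> carrier B. x [^] (p ^ e) \<in> Idl (h ` frobenius_power S J (p ^ e))}"
    proof (rule genideal_minimal[OF frob_preimage_ideal[OF genideal_ideal[OF hF]]])
      show "h ` J \<subseteq> {x \<in> carrier B. x [^] (p ^ e) \<in> Idl (h ` frobenius_power S J (p ^ e))}"
      proof clarify
        fix y assume y: "y \<in> J"
        have "h (y [^]\<^bsub>S\<^esub> (p ^ e)) \<in> Idl (h ` frobenius_power S J (p ^ e))"
          using genideal_self[OF hF] S.frobenius_powerI[OF J y, of "p ^ e"] by blast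
        then show "h y \<in> carrier B \<and> h y [^] (p ^ e) \<in> Idl (h ` frobenius_power S J (p ^ e))"
          using hpow[OF y] hJ y by auto
      qed
    qed
    then show "b [^] (p ^ e) \<in> Idl (h ` frobenius_power S J (p ^ e))" using m by blast
  qed
qed

end

text \<open>
  Used with \<open>A\<close> the integral closure of $R$: the power of the extended ideal is generated by
  monomials in elements of \<open>I\<close>, and these already lie in the power of \<open>I\<close> in $R$.
\<close>

lemma ideal_power_extension:
  assumes L: "cring L" and R: "subring R L" and A: "subring A L" and RA: "R \<subseteq> A"
    and B: "cring B" and \<phi>: "\<phi> \<in> ring_hom (L\<lparr>carrier := A\<rparr>) B" and H: "ideal H B"
    and I: "ideal I (L\<lparr>carrier := R\<rparr>)"
    and sub: "\<And>y. y \<in> cring.ipow (L\<lparr>carrier := R\<rparr>) I n \<Longrightarrow> \<phi> y \<in> H"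
    and u: "u \<in> cring.ipow (L\<lparr>carrier := A\<rparr>) (Idl\<^bsub>L\<lparr>carrier := A\<rparr>\<^esub> I) n"
  shows "\<phi> u \<in> H"
proof -
  define S where "S = L\<lparr>carrier := R\<rparr>"
  define T where "T = L\<lparr>carrier := A\<rparr>"
  interpret S: cring S unfolding S_def by (rule subring_cring[OF L R])
  interpret T: cring T unfolding T_def by (rule subring_cring[OF L A])
  interpret h: ring_hom_cring T B \<phi>
    using T.is_cring B \<phi> by (intro ring_hom_cring.intro ring_hom_cring_axioms.intro) (auto simp: T_def)
  have SI: "ideal I S" using I by (simp add: S_def)
  have "\<one>\<^bsub>T\<^esub> = \<one>\<^bsub>S\<^esub>" "x \<otimes>\<^bsub>T\<^esub> y = x \<otimes>\<^bsub>S\<^esub> y" for x y by (simp_all add: S_def T_def)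
  then have lp: "T.lprod xs = S.lprod xs" for xs by (induction xs) simp_all
  have "T.ipow (Idl\<^bsub>T\<^esub> I) n \<subseteq> {x \<in> carrier T. \<phi> x \<in> H}"
  proof (rule T.ipow_genideal_subset[OF _ h.preimage_ideal[OF H]])
    show IT: "I \<subseteq> carrier T" using idealD(1)[OF SI] RA by (auto simp: S_def T_def)
    fix xs assume xs: "length xs = n" "set xs \<subseteq> I"
    have "T.lprod xs \<in> S.ipow I n" using S.lprod_in_ipow[OF SI xs(2)] xs(1) lp by simp
    then show "T.lprod xs \<in> {x \<in> carrier T. \<phi> x \<in> H}"
      using sub xs(2) IT by (auto simp: S_def intro!: T.lprod_closed)
  qed
  then show ?thesis using u by (auto simp: T_def)
qed

section \<open>The tight closure F-threshold\<close>

text \<open>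
  The positive value \<open>f e0\<close> makes \<open>T\<close> nonempty; otherwise the supremum would be $-\infty$.
\<close>

lemma lim_eq_SUP_below:
  fixes f :: "nat \<Rightarrow> real" and T :: "real set"
  assumes mono: "incseq f" and bdd: "bdd_above (range f)" and pos: "0 < f e0"
    and below: "\<And>e t. 0 \<le> t \<Longrightarrow> t < f e \<Longrightarrow> t \<in> T"
    and upper: "\<And>t. t \<in> T \<Longrightarrow> t \<le> lim f"
  shows "ereal (lim f) = (SUP t\<in>T. ereal t)"
proof -
  have lim: "f \<longlonglongrightarrow> (SUP e. f e)" by (rule LIMSEQ_incseq_SUP[OF bdd mono])
  then have l: "lim f = (SUP e. f e)" by (rule limI)
  have c0: "0 < lim f" unfolding l using cSUP_upper[OF UNIV_I bdd, of e0] pos by simp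
  show ?thesis
  proof (rule antisym)
    show "(SUP t\<in>T. ereal t) \<le> ereal (lim f)" using upper by (intro SUP_least) simp
    show "ereal (lim f) \<le> (SUP t\<in>T. ereal t)"
    proof (rule dense_le_bounded[of "ereal 0"])
      show "ereal 0 < ereal (lim f)" using c0 by simp
      fix w assume w: "ereal 0 < w" "w < ereal (lim f)"
      then obtain t where t: "w = ereal t" by (cases w) auto
      then have "t < (SUP e. f e)" "0 \<le> t" using w l by auto
      then obtain e where "t < f e" using less_cSUP_iff[OF _ bdd] by auto
      then have "t \<in> T" using below \<open>0 \<le> t\<close> by blast
      then show "w \<le> (SUP t\<in>T. ereal t)" unfolding t by (rule SUP_upper)
    qed
  qed
qed

lemma ring_finsum_subring:
  assumes L: "ring L" and R: "subring R L" and A: "finite A" and f: "\<And>a. a \<in> A \<Longrightarrow> f a \<in> R"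
  shows "finsum (L\<lparr>carrier := R\<rparr>) f A = finsum L f A"
proof -
  interpret L: ring L by (rule L)
  interpret S: ring "L\<lparr>carrier := R\<rparr>" by (rule L.subring_is_ring[OF R])
  show ?thesis using A f
  proof (induction A rule: finite_induct)
    case (insert x A)
    have "f x \<in> R" "f \<in> A \<rightarrow> R" using insert by auto
    then show ?case using insert subringE(1)[OF R] by (simp add: Pi_iff subset_iff)
  qed simp
qed

text \<open>
  The coefficients in the definition of \<open>F_finite\<close> are $p$-th powers; their roots are the
  coefficients of a Frobenius combination, and the sum in \<open>L\<close> is a sum in $R$.
\<close>

lemma F_finite_span:
  assumes L: "cring L" and R: "subring R L" and S: "noetherian_char_p_domain (L\<lparr>carrier := R\<rparr>) p"
    and F: "F_finite L R p"
  shows "\<exists>A. finite A \<and> A \<subseteq> R \<and> R \<subseteq> noetherian_char_p_domain.F_span (L\<lparr>carrier := R\<rparr>) p A"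
proof -
  interpret L: cring L by (rule L)
  define S where "S = L\<lparr>carrier := R\<rparr>"
  interpret S: noetherian_char_p_domain S p using S by (simp add: S_def)
  obtain A where A: "finite A" "A \<subseteq> R"
    "\<And>x. x \<in> R \<Longrightarrow> \<exists>c \<in> A \<rightarrow> (\<lambda>x. x [^]\<^bsub>L\<^esub> p) ` R. x = (\<Oplus>\<^bsub>L\<^esub>a\<in>A. c a \<otimes>\<^bsub>L\<^esub> a)"
    using F unfolding F_finite_def module_finite_def by auto
  have "x \<in> S.F_span A" if x: "x \<in> R" for x
  proof -
    obtain c where c: "c \<in> A \<rightarrow> (\<lambda>x. x [^]\<^bsub>L\<^esub> p) ` R" "x = (\<Oplus>\<^bsub>L\<^esub>a\<in>A. c a \<otimes>\<^bsub>L\<^esub> a)" using A(3)[OF x] by blast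
    then have "\<forall>a\<in>A. \<exists>r. r \<in> R \<and> c a = r [^]\<^bsub>L\<^esub> p" by auto
    then obtain f where f: "\<And>a. a \<in> A \<Longrightarrow> f a \<in> R" "\<And>a. a \<in> A \<Longrightarrow> c a = f a [^]\<^bsub>L\<^esub> p" by metis
    have RL: "R \<subseteq> carrier L" using subringE(1)[OF R] .
    have fR: "f a [^]\<^bsub>L\<^esub> p \<otimes>\<^bsub>L\<^esub> a \<in> R" if "a \<in> A" for a
      using S.m_closed[OF S.nat_pow_closed[of "f a" p], of a] f(1)[OF that] that A(2)
      by (auto simp: S_def carrier_update_pow)
    have "x = (\<Oplus>\<^bsub>L\<^esub>a\<in>A. f a [^]\<^bsub>L\<^esub> p \<otimes>\<^bsub>L\<^esub> a)"
      unfolding c(2) by (rule L.finsum_cong') (use f fR RL in auto)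
    also have "\<dots> = finsum S (\<lambda>a. f a [^]\<^bsub>L\<^esub> p \<otimes>\<^bsub>L\<^esub> a) A"
      unfolding S_def using ring_finsum_subring[OF L.ring_axioms R A(1) fR] by simp
    also have "\<dots> = S.frob_comb A f"
      unfolding S.frob_comb_def by (simp add: S_def carrier_update_pow)
    finally show ?thesis unfolding S.F_span_def using f(1) by (auto simp: S_def)
  qed
  then show ?thesis using A unfolding S_def by blast
qed

lemma module_finite_self:
  assumes L: "ring L" and R: "subring R L" shows "module_finite L R R"
proof -
  interpret L: ring L by (rule L)
  have "\<exists>c\<in>{\<one>\<^bsub>L\<^esub>} \<rightarrow> R. x = (\<Oplus>\<^bsub>L\<^esub>a\<in>{\<one>\<^bsub>L\<^esub>}. c a \<otimes>\<^bsub>L\<^esub> a)" if "x \<in> R" for x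
    using that subringE(1)[OF R] by (intro bexI[of _ "\<lambda>_. x"]) (auto simp: subset_iff)
  then show ?thesis unfolding module_finite_def using subringE(3)[OF R]
    by (intro exI[of _ "{\<one>\<^bsub>L\<^esub>}"]) auto
qed


text \<open>
  The BCM* property enters through the finite extension $R$ of itself: contraction of ideals from \<open>B\<close> to
  $R$ is tight closure.
\<close>

locale bcm_star_setting =
  fixes L :: "('a, 'm) ring_scheme" and B :: "('b, 'n) ring_scheme"
    and R \<aa> J :: "'a set" and \<phi> :: "'a \<Rightarrow> 'b" and p :: nat
  assumes L: "algebraically_closed L" and R: "subring R L"
    and S: "noetherian_char_p_domain (L\<lparr>carrier := R\<rparr>) p"
    and F: "F_finite L R p"
    and B: "cring B" and hom: "\<phi> \<in> ring_hom (L\<lparr>carrier := integral_closure L R\<rparr>) B"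
    and star: "\<And>I. ideal I (L\<lparr>carrier := R\<rparr>) \<Longrightarrow>
      {x \<in> R. \<phi> x \<in> Idl\<^bsub>B\<^esub> (\<phi> ` I)} = tight_closure (L\<lparr>carrier := R\<rparr>) p I"
    and perf: "perfect_ring p B"
    and \<aa>: "ideal \<aa> (L\<lparr>carrier := R\<rparr>)" "\<aa> \<noteq> {\<zero>\<^bsub>L\<^esub>}"
    and J: "ideal J (L\<lparr>carrier := R\<rparr>)" "J \<noteq> R"
    and rad: "\<aa> \<subseteq> radical_ideal (L\<lparr>carrier := R\<rparr>) J"
begin

abbreviation A where "A \<equiv> integral_closure L R"
abbreviation S where "S \<equiv> L\<lparr>carrier := R\<rparr>"
abbreviation T where "T \<equiv> L\<lparr>carrier := A\<rparr>"

sublocale L: algebraically_closed L by (rule L)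
sublocale S: noetherian_char_p_domain S p by (rule S)

lemma A: "subring A L" "R \<subseteq> A"
  using L.integral_closure_subring[OF R] L.subset_integral_closure[OF R] .

sublocale T: cring T by (rule subring_cring[OF L.is_cring A(1)])
lemma hom_S: "\<phi> \<in> ring_hom S B"
  using hom A(2) by (auto simp: ring_hom_def Pi_iff subset_iff)

sublocale B: perfect_char_p B p
  using char_p_cring_hom[OF S.char_p_cring_axioms B hom_S] perf
  by (simp add: perfect_char_p_def perfect_char_p_axioms_def)

sublocale h: ring_hom_cring T B \<phi>
  using T.is_cring B hom by (intro ring_hom_cring.intro ring_hom_cring_axioms.intro)

lemma JA: "J \<subseteq> R" "\<aa> \<subseteq> R" using idealD(1)[OF J(1)] idealD(1)[OF \<aa>(1)] by auto

definition JB where "JB = Idl\<^bsub>B\<^esub> (\<phi> ` J)"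

definition closure_pow where "closure_pow e = tight_closure S p (frobenius_power S J (p ^ e))"

text \<open>
  The bridge between the two sides: tight closures of Frobenius powers of \<open>J\<close> in $R$ become
  membership of $p^e$-th roots in the single ideal $JB$.
\<close>

lemma closure_pow_root_iff:
  assumes x: "x \<in> A" and xe: "x [^]\<^bsub>L\<^esub> (p ^ e) \<in> R"
  shows "x [^]\<^bsub>L\<^esub> (p ^ e) \<in> closure_pow e \<longleftrightarrow> \<phi> x \<in> JB"
proof -
  have "\<phi> (x [^]\<^bsub>T\<^esub> (p ^ e)) = \<phi> x [^]\<^bsub>B\<^esub> (p ^ e)"
    using ring_hom_pow[OF T.is_cring B hom, of x "p ^ e"] x by simp
  then have "\<phi> (x [^]\<^bsub>L\<^esub> (p ^ e)) = \<phi> x [^]\<^bsub>B\<^esub> (p ^ e)" by (simp add: carrier_update_pow)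
  moreover have "x [^]\<^bsub>L\<^esub> (p ^ e) \<in> closure_pow e \<longleftrightarrow>
      \<phi> (x [^]\<^bsub>L\<^esub> (p ^ e)) \<in> Idl\<^bsub>B\<^esub> (\<phi> ` frobenius_power S J (p ^ e))"
    unfolding closure_pow_def star[OF S.frobenius_power_ideal[OF J(1)], symmetric] using xe by simp
  moreover have "\<phi> x \<in> carrier B" using h.hom_closed[of x] x by simp
  ultimately show ?thesis
    using B.frobenius_power_extension_iff[OF S.char_p_cring_axioms hom_S J(1)] by (simp add: JB_def)
qed

lemma root_exists:
  assumes "x \<in> R" obtains z where "z \<in> A" "z [^]\<^bsub>L\<^esub> (p ^ e) = x"
  using L.integral_root_exists[OF R assms, of "p ^ e"] S.p_pos by auto

lemma frobenius_power_subset_closure: "frobenius_power S J (p ^ e) \<subseteq> closure_pow e"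
proof -
  have "frobenius_power S J (p ^ e) \<subseteq> R"
    using idealD(1)[OF S.frobenius_power_ideal[OF J(1)]] by simp
  moreover have "\<phi> ` frobenius_power S J (p ^ e) \<subseteq> carrier B"
    using calculation A(2) h.hom_closed by auto
  ultimately show ?thesis
    unfolding closure_pow_def star[OF S.frobenius_power_ideal[OF J(1)], symmetric]
    using B.genideal_self by blast
qed

definition witnesses :: "nat \<Rightarrow> nat set"
  where "witnesses e = {n. 0 < n \<and> \<not> S.ipow \<aa> n \<subseteq> closure_pow e}"

lemma nu_eq: "tight_closure_nu S p \<aa> J e = Sup (witnesses e)"
  by (simp add: tight_closure_nu_def witnesses_def S.ipow_def closure_pow_def)

text \<open>
  If the $s$-th powers of generators of $\mathfrak a$ lie in \<open>J\<close>, their $s p^e$-th powers lie in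
  $J^{[p^e]}$, and the pigeonhole principle bounds the exponents linearly in $p^e$.
\<close>

lemma witnesses_bounded: "\<exists>C. \<forall>e. \<forall>n\<in>witnesses e. n \<le> C * p ^ e"
proof -
  obtain U where U: "U \<subseteq> R" "finite U" "\<aa> = Idl\<^bsub>S\<^esub> U" using S.finetely_gen[OF \<aa>(1)] by auto
  have "U \<subseteq> \<aa>" using S.genideal_self[of U] U by simp
  then have "\<forall>g\<in>U. \<exists>n::nat. g [^]\<^bsub>S\<^esub> n \<in> J" using rad by (auto simp: radical_ideal_def)
  then obtain m where m: "\<And>g. g \<in> U \<Longrightarrow> g [^]\<^bsub>S\<^esub> (m g :: nat) \<in> J" by metis
  define s where "s = (\<Sum>g\<in>U. m g)"
  have gs: "g [^]\<^bsub>S\<^esub> s \<in> J" if g: "g \<in> U" for g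
  proof -
    have gc: "g \<in> carrier S" using g U by auto
    have "m g \<le> s" unfolding s_def using member_le_sum[OF g, of m] U(2) by simp
    then have "g [^]\<^bsub>S\<^esub> s = g [^]\<^bsub>S\<^esub> (s - m g) \<otimes>\<^bsub>S\<^esub> g [^]\<^bsub>S\<^esub> m g"
      using S.nat_pow_mult[OF gc, of "s - m g" "m g"] by simp
    then show ?thesis using idealD(4)[OF J(1) S.nat_pow_closed[OF gc] m[OF g]] by simp
  qed
  have "n \<le> card U * s * p ^ e" if n: "n \<in> witnesses e" for n e
  proof (rule ccontr)
    assume big: "\<not> n \<le> card U * s * p ^ e"
    have "S.ipow (Idl\<^bsub>S\<^esub> U) n \<subseteq> frobenius_power S J (p ^ e)"
    proof (rule S.ipow_pigeonhole[OF _ U(2) S.frobenius_power_ideal[OF J(1)]])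
      show "U \<subseteq> carrier S" using U(1) by simp
      show "card U * (s * p ^ e) < n" using big by (simp add: mult.assoc)
      fix g assume g: "g \<in> U"
      then have "g [^]\<^bsub>S\<^esub> (s * p ^ e) = (g [^]\<^bsub>S\<^esub> s) [^]\<^bsub>S\<^esub> (p ^ e)"
        using S.nat_pow_pow[of g s "p ^ e"] U(1) by auto
      then show "g [^]\<^bsub>S\<^esub> (s * p ^ e) \<in> frobenius_power S J (p ^ e)"
        using S.frobenius_powerI[OF J(1) gs[OF g]] by simp
    qed
    then have "S.ipow \<aa> n \<subseteq> closure_pow e" using frobenius_power_subset_closure[of e] U(3) by blast
    then show False using n by (simp add: witnesses_def)
  qed
  then show ?thesis by blast
qed

abbreviation \<nu> where "\<nu> \<equiv> tight_closure_nu S p \<aa> J"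

lemma witnesses_finite: "finite (witnesses e)"
  using witnesses_bounded finite_nat_set_iff_bounded_le by blast

lemma nu_upper: "n \<in> witnesses e \<Longrightarrow> n \<le> \<nu> e"
  unfolding nu_eq using witnesses_finite by (intro cSup_upper bdd_above_finite) auto

lemma nu_mem: "0 < \<nu> e \<Longrightarrow> \<nu> e \<in> witnesses e"
proof -
  assume "0 < \<nu> e"
  then have "witnesses e \<noteq> {}" unfolding nu_eq by (auto simp: Sup_nat_empty)
  then show ?thesis unfolding nu_eq using witnesses_finite[of e] by (simp add: Sup_nat_def)
qed

lemma witnessI: "0 < n \<Longrightarrow> y \<in> S.ipow \<aa> n \<Longrightarrow> y \<notin> closure_pow e \<Longrightarrow> n \<in> witnesses e"
  by (auto simp: witnesses_def)

text \<open>
  If $y \in \mathfrak a^n$ is a witness at level $e$ with $p^e$-th root $z$, then $y^p \in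
  \mathfrak a^{pn}$ has $z$ as its $p^{e+1}$-th root, and the bridge applies to the same $z$.
\<close>

lemma nu_Suc: "p * \<nu> e \<le> \<nu> (Suc e)"
proof (cases "0 < \<nu> e")
  case True
  then obtain y where y: "y \<in> S.ipow \<aa> (\<nu> e)" "y \<notin> closure_pow e"
    using nu_mem[OF True] by (auto simp: witnesses_def)
  have yR: "y \<in> R" using y(1) idealD(1)[OF S.ipow_ideal[OF \<aa>(1)]] by auto
  obtain z where z: "z \<in> A" "z [^]\<^bsub>L\<^esub> (p ^ e) = y" using root_exists[OF yR] .
  have zL: "z \<in> carrier L" using z(1) subringE(1)[OF A(1)] by blast
  have zp: "z [^]\<^bsub>L\<^esub> (p ^ Suc e) = y [^]\<^bsub>L\<^esub> p"
    using z(2) L.nat_pow_pow[OF zL, of "p ^ e" p] by (simp add: mult.commute)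
  have yp: "y [^]\<^bsub>L\<^esub> p \<in> R" using S.nat_pow_closed[of y p] yR by (simp add: carrier_update_pow)
  have "\<phi> z \<notin> JB" using closure_pow_root_iff[OF z(1), of e] y(2) z(2) yR by simp
  then have "y [^]\<^bsub>L\<^esub> p \<notin> closure_pow (Suc e)"
    using closure_pow_root_iff[OF z(1), of "Suc e"] zp yp by simp
  moreover have "y [^]\<^bsub>S\<^esub> p \<in> S.ipow (S.ipow \<aa> (\<nu> e)) p"
    by (rule S.pow_in_ipow[OF S.ipow_ideal[OF \<aa>(1)] y(1)])
  then have "y [^]\<^bsub>L\<^esub> p \<in> S.ipow \<aa> (p * \<nu> e)"
    using S.ipow_mult[OF \<aa>(1)] by (simp add: carrier_update_pow mult.commute)
  ultimately have "p * \<nu> e \<in> witnesses (Suc e)"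
    using True S.p_pos by (intro witnessI[of _ "y [^]\<^bsub>L\<^esub> p"]) auto
  then show ?thesis by (rule nu_upper)
qed simp

definition ratio :: "nat \<Rightarrow> real" where "ratio e = real (\<nu> e) / real (p ^ e)"

lemma ratio_incseq: "incseq ratio"
proof (rule incseq_SucI)
  fix e
  have "real p * real (\<nu> e) \<le> real (\<nu> (Suc e))" using nu_Suc[of e] by (metis of_nat_le_iff of_nat_mult)
  then show "ratio e \<le> ratio (Suc e)" using S.p_pos by (simp add: ratio_def field_simps)
qed

lemma ratio_bdd: "bdd_above (range ratio)"
proof -
  obtain C where C: "\<And>e n. n \<in> witnesses e \<Longrightarrow> n \<le> C * p ^ e" using witnesses_bounded by blast
  have "\<nu> e \<le> C * p ^ e" for e using C nu_mem[of e] by (cases "0 < \<nu> e") auto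
  then have "real (\<nu> e) \<le> real C * real (p ^ e)" for e by (metis of_nat_le_iff of_nat_mult)
  then have "ratio e \<le> real C" for e
    using S.p_pos by (simp add: ratio_def divide_le_eq)
  then show ?thesis by (intro bdd_aboveI[of _ "real C"]) auto
qed

lemma ratio_le_lim: "ratio e \<le> lim ratio"
proof -
  have "ratio \<longlonglongrightarrow> (SUP e. ratio e)" by (rule LIMSEQ_incseq_SUP[OF ratio_bdd ratio_incseq])
  then have "lim ratio = (SUP e. ratio e)" by (rule limI)
  then show ?thesis using cSUP_upper[OF UNIV_I ratio_bdd, of e] by simp
qed

text \<open>
  Some nonzero element of $\mathfrak a$ avoids $(J^{[p^e]})^*$ for some $e$, since these ideals
  intersect in zero.
\<close>

lemma nu_pos: "\<exists>e. 0 < \<nu> e"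
proof -
  obtain C where C: "finite C" "C \<subseteq> R" "R \<subseteq> S.F_span C"
    using F_finite_span[OF L.is_cring R S F] by blast
  obtain x where x: "x \<in> \<aa>" "x \<noteq> \<zero>\<^bsub>L\<^esub>" using \<aa>(2) idealD(2)[OF \<aa>(1)] by auto
  have "\<exists>e. x \<notin> closure_pow e"
    unfolding closure_pow_def
  proof (rule S.tight_closures_of_frobenius_powers_separated[OF C(1)])
    show "x \<in> carrier S" using x(1) JA(2) by auto
  qed (use C J x in simp_all)
  then obtain e where e: "x \<notin> closure_pow e" by blast
  have "1 \<in> witnesses e" using witnessI[of 1 x e] S.ipow_1[OF \<aa>(1)] x e by simp
  from nu_upper[OF this] show ?thesis by (intro exI[of _ e]) linarith
qed

abbreviation big_powers where "big_powers \<equiv> rational_power_gt L A (Idl\<^bsub>T\<^esub> \<aa>)"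

text \<open>
  The $p^e$-th root of a witness for $\nu(p^e)$ lies in the rational power of exponent
  $\nu(p^e)/p^e$ and not in $JB$.
\<close>

lemma below_ratio_not_in_JB:
  assumes t: "0 \<le> t" "t < ratio e"
  shows "\<not> \<phi> ` big_powers t \<subseteq> JB"
proof -
  have "0 < ratio e" using t by simp
  then have \<nu>0: "0 < \<nu> e" by (cases "\<nu> e = 0") (auto simp: ratio_def)
  then obtain y where y: "y \<in> S.ipow \<aa> (\<nu> e)" "y \<notin> closure_pow e"
    using nu_mem[OF \<nu>0] by (auto simp: witnesses_def)
  have yR: "y \<in> R" using y(1) idealD(1)[OF S.ipow_ideal[OF \<aa>(1)]] by auto
  obtain z where z: "z \<in> A" "z [^]\<^bsub>L\<^esub> (p ^ e) = y" using root_exists[OF yR] .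
  have "\<aa> \<subseteq> Idl\<^bsub>T\<^esub> \<aa>" using JA A(2) by (intro T.genideal_self) auto
  then have "z \<in> rational_power L A (Idl\<^bsub>T\<^esub> \<aa>) (of_nat (\<nu> e) / of_nat (p ^ e))"
    using y(1) z S.p_pos \<nu>0
    by (intro root_in_rational_power[OF L.field_axioms R A \<aa>(1)]) auto
  moreover have "t < real_of_rat (of_nat (\<nu> e) / of_nat (p ^ e))"
    using t(2) by (simp add: ratio_def of_rat_divide of_rat_power)
  ultimately have "z \<in> big_powers t" unfolding rational_power_gt_def by blast
  moreover have "\<phi> z \<notin> JB" using closure_pow_root_iff[OF z(1), of e] y(2) z(2) yR by simp
  ultimately show ?thesis by blast
qed

text \<open>
  For \<open>x\<close> in the rational power of exponent $s = m/n > t$ with image outside $JB$, the powers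
  $x^{n(k+D)} \in (\mathfrak a R^+)^{mk}$ give $\nu(p^e) \ge m(\lfloor p^e/n \rfloor - D)$ for all
  $e$. Hence \<open>lim ratio\<close> is at least \<open>s\<close>.
\<close>

lemma not_in_JB_le_lim:
  assumes t: "0 \<le> t" "\<not> \<phi> ` big_powers t \<subseteq> JB"
  shows "t \<le> lim ratio"
proof -
  obtain x s where s: "t < real_of_rat s" and x: "x \<in> rational_power L A (Idl\<^bsub>T\<^esub> \<aa>) s" "\<phi> x \<notin> JB"
    using t(2) unfolding rational_power_gt_def by auto
  have "0 < real_of_rat s" using t(1) s by linarith
  then have s0: "0 < s" by simp
  have TI: "ideal (Idl\<^bsub>T\<^esub> \<aa>) T" using JA A(2) by (intro T.genideal_ideal) auto
  obtain m n D where mn: "0 < n" "s = of_nat m / of_nat n"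
    and D: "\<And>k. x [^]\<^bsub>L\<^esub> (n * (k + D)) \<in> T.ipow (Idl\<^bsub>T\<^esub> \<aa>) (m * k)"
    using rational_power_integral[OF L.field_axioms A(1) TI x(1) s0] by blast
  have xA: "x \<in> A" using x(1) by (simp add: rational_power_def)
  have xT: "x \<in> carrier T" using xA by simp
  have le: "m * (p ^ e div n - D) \<le> \<nu> e" for e
  proof (cases "0 < m * (p ^ e div n - D)")
    case True
    define k where "k = p ^ e div n - D"
    have kD: "k + D = p ^ e div n" using True by (auto simp: k_def)
    define \<rho> where "\<rho> = p ^ e mod n"
    have "p ^ e = n * (k + D) + \<rho>" unfolding kD \<rho>_def by simp
    then have xq: "x [^]\<^bsub>T\<^esub> (p ^ e) = x [^]\<^bsub>T\<^esub> (n * (k + D)) \<otimes>\<^bsub>T\<^esub> x [^]\<^bsub>T\<^esub> \<rho>"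
      using T.nat_pow_mult[OF xT] by simp
    have "m * k \<in> witnesses e"
    proof (rule ccontr)
      assume "m * k \<notin> witnesses e"
      then have sub: "S.ipow \<aa> (m * k) \<subseteq> closure_pow e" using True by (simp add: witnesses_def k_def)
      define G where "G = Idl\<^bsub>B\<^esub> (\<phi> ` frobenius_power S J (p ^ e))"
      have FR: "frobenius_power S J (p ^ e) \<subseteq> R"
        using idealD(1)[OF S.frobenius_power_ideal[OF J(1)]] by simp
      have G: "ideal G B"
        unfolding G_def using FR A(2) h.hom_closed by (intro B.genideal_ideal) auto
      have "\<phi> y \<in> G" if "y \<in> S.ipow \<aa> (m * k)" for y
        using that sub unfolding closure_pow_def G_def
          star[OF S.frobenius_power_ideal[OF J(1)], symmetric] by blast
      then have "\<phi> (x [^]\<^bsub>L\<^esub> (n * (k + D))) \<in> G"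
        using ideal_power_extension[OF L.is_cring R A B hom G \<aa>(1) _ D[of k]] by blast
      then have "\<phi> (x [^]\<^bsub>T\<^esub> (n * (k + D))) \<otimes>\<^bsub>B\<^esub> \<phi> (x [^]\<^bsub>T\<^esub> \<rho>) \<in> G"
        using idealD(5)[OF G h.hom_closed[OF T.nat_pow_closed[OF xT]]] by (simp add: carrier_update_pow)
      then have "\<phi> (x [^]\<^bsub>T\<^esub> (p ^ e)) \<in> G"
        unfolding xq using h.hom_mult[OF T.nat_pow_closed[OF xT] T.nat_pow_closed[OF xT]] by simp
      then have "\<phi> x [^]\<^bsub>B\<^esub> (p ^ e) \<in> G" using ring_hom_pow[OF T.is_cring B hom xT] by simp
      then show False
        using B.frobenius_power_extension_iff[OF S.char_p_cring_axioms hom_S J(1) h.hom_closed[OF xT]] x(2)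
        by (simp add: G_def JB_def)
    qed
    then show ?thesis using nu_upper by (simp add: k_def)
  next
    case False
    then have "m * (p ^ e div n - D) = 0" by (simp only: not_gr_zero)
    then show ?thesis by (simp only: zero_le)
  qed
  \<comment> \<open>The summand \<open>1\<close> accounts for rounding \<open>p ^ e / n\<close> down, \<open>D\<close> for the integral equation.\<close>
  define K where "K = real m * (real D + 1)"
  have "real_of_rat s - K * inverse (real p ^ e) \<le> lim ratio" for e
  proof -
    define q where "q = p ^ e"
    have q0: "0 < q" using S.p_pos by (simp add: q_def)
    have "real q / real n - 1 \<le> real (q div n)"
    proof -
      have "q = n * (q div n) + q mod n" "q mod n < n" using mn(1) by simp_all
      then have "q \<le> n * (q div n + 1)" unfolding distrib_left mult_1_right by linarith
      then have "real q \<le> real n * (real (q div n) + 1)" by (metis of_nat_1 of_nat_add of_nat_le_iff of_nat_mult)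
      then have "real q / real n \<le> real (q div n) + 1" using mn(1) by (simp add: divide_le_eq mult.commute)
      then show ?thesis by simp
    qed
    then have "real q / real n - 1 - real D \<le> real (q div n - D)" by linarith
    then have "real m * (real q / real n - 1 - real D) \<le> real m * real (q div n - D)"
      by (intro mult_left_mono) auto
    also have "\<dots> \<le> real (\<nu> e)" using le[of e] unfolding q_def by (metis of_nat_le_iff of_nat_mult)
    finally have "real m * (real q / real n) - K \<le> real (\<nu> e)" by (simp add: K_def algebra_simps)
    then have "(real m * (real q / real n) - K) / real q \<le> ratio e"
      using q0 by (simp add: ratio_def q_def divide_right_mono)
    moreover have "(real m * (real q / real n) - K) / real q = real m / real n - K * inverse (real q)"
      using q0 mn(1) by (simp add: field_simps)
    moreover have "real_of_rat s = real m / real n" using mn(2) by (simp add: of_rat_divide)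
    ultimately show ?thesis using ratio_le_lim[of e] by (simp add: q_def)
  qed
  moreover have "(\<lambda>e. real_of_rat s - K * inverse (real p ^ e)) \<longlonglongrightarrow> real_of_rat s - K * 0"
    using S.p_pos by (intro tendsto_intros LIMSEQ_inverse_realpow_zero) simp
  ultimately have "real_of_rat s - K * 0 \<le> lim ratio"
    by (intro LIMSEQ_le_const2) auto
  then show ?thesis using s by simp
qed

theorem threshold_eq_SUP:
  "ereal (tight_closure_F_threshold S p \<aa> J) =
    (SUP t \<in> {t :: real. 0 \<le> t \<and> \<not> \<phi> ` big_powers t \<subseteq> JB}. ereal t)"
proof -
  obtain e0 where e0: "0 < \<nu> e0" using nu_pos by blast
  have "0 < ratio e0" using e0 S.p_pos by (simp add: ratio_def)
  then have "ereal (lim ratio) =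
      (SUP t \<in> {t :: real. 0 \<le> t \<and> \<not> \<phi> ` big_powers t \<subseteq> JB}. ereal t)"
    by (rule lim_eq_SUP_below[OF ratio_incseq ratio_bdd])
      (use below_ratio_not_in_JB not_in_JB_le_lim in auto)
  moreover have "tight_closure_F_threshold S p \<aa> J = lim ratio"
    unfolding tight_closure_F_threshold_def by (simp add: ratio_def[abs_def])
  ultimately show ?thesis by simp
qed

end

theorem corollary3p9:
  fixes L :: "('a, 'm) ring_scheme" and B :: "('b, 'n) ring_scheme"
    and R \<aa> J :: "'a set" and \<phi> :: "'a \<Rightarrow> 'b" and p :: nat
  assumes "prime p" and "[p] \<cdot>\<^bsub>L\<^esub> \<one>\<^bsub>L\<^esub> = \<zero>\<^bsub>L\<^esub>"
    and "subring R L"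
    and "algebraic_closure L (generate_field L R)"
    and "noetherian_domain (L\<lparr>carrier := R\<rparr>)"
    and "complete_local_ring (L\<lparr>carrier := R\<rparr>)"
    and "F_finite L R p"
    and "bcm_star_plus_algebra L R p B \<phi>"
    and "perfect_ring p B"
    and "ideal \<aa> (L\<lparr>carrier := R\<rparr>)" and "\<aa> \<noteq> R" and "\<aa> \<noteq> {\<zero>\<^bsub>L\<^esub>}"
    and "ideal J (L\<lparr>carrier := R\<rparr>)" and "J \<noteq> R" and "J \<noteq> {\<zero>\<^bsub>L\<^esub>}"
    and "\<aa> \<subseteq> radical_ideal (L\<lparr>carrier := R\<rparr>) J"
  shows "ereal (tight_closure_F_threshold (L\<lparr>carrier := R\<rparr>) p \<aa> J) =
    (SUP t \<in> {t :: real. 0 \<le> t \<and>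
        \<not> \<phi> ` rational_power_gt L (integral_closure L R)
            (Idl\<^bsub>L\<lparr>carrier := integral_closure L R\<rparr>\<^esub> \<aa>) t
          \<subseteq> Idl\<^bsub>B\<^esub> (\<phi> ` J)}. ereal t)"
proof -
  interpret C: algebraic_closure L "generate_field L R" by (rule assms(4))
  interpret D: noetherian_domain "L\<lparr>carrier := R\<rparr>" by (rule assms(5))
  have ncp: "noetherian_char_p_domain (L\<lparr>carrier := R\<rparr>) p"
    using assms(5) char_p_cring_subring[OF C.is_cring assms(3,1,2)]
    by (intro noetherian_char_p_domain.intro)
  have RA: "R \<subseteq> integral_closure L R" by (rule C.subset_integral_closure[OF assms(3)])
  have mf: "module_finite L R R" by (rule module_finite_self[OF C.ring_axioms assms(3)])
  have star: "bcm_star (L\<lparr>carrier := R\<rparr>) p B \<phi>"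
    using assms(8) RA mf assms(3) unfolding bcm_star_plus_algebra_def by blast
  interpret M: bcm_star_setting L B R \<aa> J \<phi> p
  proof (rule bcm_star_setting.intro)
    show "algebraically_closed L" by (rule C.algebraically_closed_axioms)
  qed (use assms ncp star in \<open>auto simp: bcm_star_plus_algebra_def bcm_star_def\<close>)
  show ?thesis using M.threshold_eq_SUP unfolding M.JB_def .
qed

end
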